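(* Let $\mathbf I=\mathrm{diag}(I_1,I_2,I_2)$ with $0<I_i<\tfrac12$ and $I_1+2I_2=1$. Consider the hyperbolic relative equilibria $((\mathrm{Id},\mathbf R),(\xi,\eta))$ of the axisymmetric second order model, given for $R>0$ and $\theta\in S^1$, $\theta\neq\frac\pi2$, by $$\xi=|\xi|(\sin\theta,0,\cos\theta),\quad \mathbf R=(0,R,0),\quad |\xi|^2=\frac{2R^2+3-9I_2}{2R^5},\quad \eta=-\frac{I_2-I_1}{I_1}|\xi|\sin\theta .$$ For large orbits satisfying $$R^2>\frac12\Big(3(1-I_2)+\sqrt{3+102I_2-351I_2^2}\Big)$$ hyperbolic equilibria are $G^{\mathrm{axi}}_\mu$-stable for oblate bodies ($I_1>I_2$) and unstable for prolate bodies ($I_1<I_2$).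
   Context: Axisymmetric second order satellite model. Units are chosen so that the satellite has mass $1$ and its inertia tensor $\mathbf I=\mathrm{diag}(I_1,I_2,I_2)$ has trace $1$; the first body axis $\mathbf e_1$ is the symmetry axis. The configuration space is $Q=SO(3)\times\mathbb R^3$ with points $(B,\mathbf R)$ in body coordinates (the potential below being defined for $\mathbf R\neq0$). Tangent vectors are written $(\Omega,\dot{\mathbf R})\in\mathbb R^3\times\mathbb R^3$ with $\dot B=B\widehat\Omega$, where $\widehat\Omega u=\Omega\times u$. The kinetic energy is $K=\frac12(\Omega\cdot\mathbf I\Omega+|\dot{\mathbf R}+\Omega\times\mathbf R|^2)$, the potential is $$V_2(\mathbf R)=-\frac1R-\frac1{2R^3}+\frac{3}{2R^5}\,\mathbf R\cdot\mathbf I\mathbf R,\qquad R=|\mathbf R|,$$ and the system on $T^*Q$ has Hamiltonian $H_2=K+V_2$. Symmetry. Let $\Gamma^{\mathrm{axi}}\subset O(3)$ be the group of block matrices $\mathrm{diag}(s,O)$ with $s\in\{1,-1\}$, $O\in O(2)$, let $\chi(\mathrm{diag}(s,O))=\det O$, and let $G^{\mathrm{axi}}=SO(3)\times\Gamma^{\mathrm{axi}}$ act on $Q$ by $(M,N)\cdot(B,\mathbf R)=(MBN^T\det N,\,N\mathbf R)$, and on $T^*Q$ by cotangent lift. Its Lie algebra is identified with $\mathbb R^3\oplus\mathbb R$, where $(\xi,\eta)$ generates $(\exp(t\widehat\xi),\exp(t\eta\,\widehat{\mathbf e_1}))$, with infinitesimal generator $(\xi,\eta)_Q(B,\mathbf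 R)=(B^T\xi-\eta\mathbf e_1,\ \eta\,\mathbf e_1\times\mathbf R)$. The momentum map $\mathbf J:T^*Q\to\mathbb R^3\oplus\mathbb R$ is that of the cotangent lifted action, and the coadjoint action is $(M,N)\cdot(\mu,\nu)=(M\mu,\chi(N)\nu)$. A relative equilibrium with velocity $(\xi,\eta)$ is a phase space point whose evolution is the orbit of the one-parameter subgroup generated by $(\xi,\eta)$; the pair $(q,(\xi,\eta))$ denotes the point of $T^*_qQ$ that is the Legendre transform of $(\xi,\eta)_Q(q)$. $G^{\mathrm{axi}}_\mu$ is the stabilizer of its momentum value $\mu\in\mathbb R^3\oplus\mathbb R$. Stability. For a symmetry group $G$, a relative equilibrium $p$ with momentum $\mu$ is $G_\mu$-stable if for every $G_\mu$-invariant neighborhood $U$ of $G_\mu\cdot p$ there is a neighborhood $O$ of $p$ such that the Hamiltonian evolution of $O$ stays in $U$ for all time. Instability is understood in the linearized sense: the linearization at $p$ of the Hamiltonian vector field of $H_2-\langle\mathbf J,(\xi,\eta)\rangle$, induced on the symplectic slice $\ker d\mathbf J(p)/(\mathfrak g_\mu\cdot p)$ (with $\mathfrak g_\mu$ the Lie algebra of $G_\mu$), has an eigenvalue with positive real part.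
   Formalization: The printed bound, not real for any prolate body and too weak for some oblate ones, is supplemented, where real, by R^2 > (3(1-I_2)+sqrt(9+102I_2-351I_2^2))/4; instability also excludes θ=-π/2, which is symmetric to the excluded π/2 and where it can fail. *)

theory Defs
  imports "HOL-Analysis.Analysis"
begin

unbundle cross3_syntax

text \<open>
  Tangent and cotangent bundles of \<open>Q = SO(3) \<times> \<real>\<^sup>3\<close> are left trivialized. A tangent vector at
  \<open>(B, R)\<close> is a pair \<open>(\<Omega>, R')\<close> standing for \<open>B' = B hat(\<Omega>)\<close>. A covector \<open>(\<Pi>, P)\<close> acts on it as
  \<open>\<Pi> \<bullet> \<Omega> + P \<bullet> R'\<close>, which is the inner product of \<open>\<real>\<^sup>3 \<times> \<real>\<^sup>3\<close>. A tangent vector to \<open>T\<^sup>*Q\<close>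
  at \<open>(q, \<alpha>)\<close> is a pair \<open>(v, \<beta>)\<close>, with \<open>v\<close> a trivialized tangent vector at \<open>q\<close> and \<open>\<beta>\<close> the velocity
  of the covector \<open>\<alpha> = (\<Pi>, P)\<close>.
\<close>

type_synonym config = "(real^3^3) \<times> (real^3)"
type_synonym tangent = "(real^3) \<times> (real^3)"
type_synonym covector = "(real^3) \<times> (real^3)"
type_synonym phase = "config \<times> covector"
type_synonym phase_tangent = "tangent \<times> covector"
type_synonym group_elt = "(real^3^3) \<times> (real^3^3)"
type_synonym lie_elt = "(real^3) \<times> real"

definition config_space :: "config set" where
  "config_space = {(B, R). rotation_matrix B \<and> R \<noteq> 0}"

definition phase_space :: "phase set" where
  "phase_space = {(q, \<alpha>). q \<in> config_space}"

definition hat :: "real^3 \<Rightarrow> real^3^3" where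
  "hat w = matrix (\<lambda>u. w \<times> u)"

text \<open>Square matrices carry no normed algebra structure in the library, so \<open>exp\<close> is not available for
  them.\<close>

definition mat_exp :: "real^3^3 \<Rightarrow> real^3^3" where
  "mat_exp A = (\<Sum>k. (1 / fact k) *\<^sub>R (((**) A) ^^ k) (mat 1))"

definition config_velocity :: "(real \<Rightarrow> config) \<Rightarrow> tangent \<Rightarrow> real \<Rightarrow> bool" where
  "config_velocity c v t \<longleftrightarrow>
     ((\<lambda>s. fst (c s)) has_vector_derivative fst (c t) ** hat (fst v)) (at t) \<and>
     ((\<lambda>s. snd (c s)) has_vector_derivative snd v) (at t)"

definition phase_velocity :: "(real \<Rightarrow> phase) \<Rightarrow> phase_tangent \<Rightarrow> real \<Rightarrow> bool" where
  "phase_velocity c w t \<longleftrightarrow>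
     config_velocity (\<lambda>s. fst (c s)) (fst w) t \<and>
     ((\<lambda>s. snd (c s)) has_vector_derivative snd w) (at t)"

text \<open>Curves with prescribed initial velocity, used to differentiate along tangent vectors.\<close>

definition config_curve :: "config \<Rightarrow> tangent \<Rightarrow> real \<Rightarrow> config" where
  "config_curve q v t = (fst q ** mat_exp (t *\<^sub>R hat (fst v)), snd q + t *\<^sub>R snd v)"

definition phase_curve :: "phase \<Rightarrow> phase_tangent \<Rightarrow> real \<Rightarrow> phase" where
  "phase_curve z w t = (config_curve (fst z) (fst w) t, snd z + t *\<^sub>R snd w)"

definition deriv_along :: "(phase \<Rightarrow> 'b::real_normed_vector) \<Rightarrow> phase \<Rightarrow> phase_tangent \<Rightarrow> 'b" where
  "deriv_along F z w = vector_derivative (\<lambda>t. F (phase_curve z w t)) (at 0)"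


subsection \<open>Hamiltonian\<close>

definition axi_inertia :: "real \<Rightarrow> real \<Rightarrow> real^3^3" where
  "axi_inertia I1 I2 = vector [vector [I1, 0, 0], vector [0, I2, 0], vector [0, 0, I2]]"

definition kinetic :: "real \<Rightarrow> real \<Rightarrow> config \<Rightarrow> tangent \<Rightarrow> real" where
  "kinetic I1 I2 = (\<lambda>(B, R) (\<Omega>, R').
     (\<Omega> \<bullet> (axi_inertia I1 I2 *v \<Omega>) + (norm (R' + \<Omega> \<times> R))\<^sup>2) / 2)"

definition potential2 :: "real \<Rightarrow> real \<Rightarrow> real^3 \<Rightarrow> real" where
  "potential2 I1 I2 R =
     - 1 / norm R - 1 / (2 * norm R ^ 3)
     + 3 / (2 * norm R ^ 5) * (R \<bullet> (axi_inertia I1 I2 *v R))"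

text \<open>The fibre derivative of the kinetic energy.\<close>

definition legendre :: "real \<Rightarrow> real \<Rightarrow> config \<Rightarrow> tangent \<Rightarrow> covector" where
  "legendre I1 I2 q v = (THE \<alpha>. GDERIV (kinetic I1 I2 q) v :> \<alpha>)"

definition hamiltonian2 :: "real \<Rightarrow> real \<Rightarrow> phase \<Rightarrow> real" where
  "hamiltonian2 I1 I2 = (\<lambda>(q, \<alpha>).
     kinetic I1 I2 q (inv (legendre I1 I2 q) \<alpha>) + potential2 I1 I2 (snd q))"

text \<open>The canonical form \<open>- d\<Theta>\<close>, where \<open>\<Theta>(v, \<beta>) = \<alpha> \<bullet> v\<close>. The third term is due to the left
  trivialization, in which the bracket of left invariant fields is the cross product.\<close>

definition symplectic_form :: "phase \<Rightarrow> phase_tangent \<Rightarrow> phase_tangent \<Rightarrow> real" where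
  "symplectic_form = (\<lambda>(q, \<alpha>) (v, \<beta>) (v', \<beta>').
     \<beta>' \<bullet> v - \<beta> \<bullet> v' + fst \<alpha> \<bullet> (fst v \<times> fst v'))"

definition hamiltonian_field :: "(phase \<Rightarrow> real) \<Rightarrow> phase \<Rightarrow> phase_tangent" where
  "hamiltonian_field F z = (THE X. \<forall>w. symplectic_form z X w = deriv_along F z w)"

definition evolution :: "real \<Rightarrow> real \<Rightarrow> (real \<Rightarrow> phase) \<Rightarrow> bool" where
  "evolution I1 I2 z \<longleftrightarrow>
     (\<forall>t. z t \<in> phase_space \<and> phase_velocity z (hamiltonian_field (hamiltonian2 I1 I2) (z t)) t)"


subsection \<open>Symmetry\<close>

definition e1 :: "real^3" where
  "e1 = axis 1 1"

definition block_diag :: "real \<Rightarrow> real^2^2 \<Rightarrow> real^3^3" where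
  "block_diag s A = vector [vector [s, 0, 0], vector [0, A$1$1, A$1$2], vector [0, A$2$1, A$2$2]]"

definition Gamma_axi :: "(real^3^3) set" where
  "Gamma_axi = {block_diag s A | s A. s \<in> {1, -1} \<and> orthogonal_matrix A}"

definition chi_axi :: "real^3^3 \<Rightarrow> real" where
  "chi_axi N = det (vector [vector [N$2$2, N$2$3], vector [N$3$2, N$3$3]] :: real^2^2)"

definition G_axi :: "group_elt set" where
  "G_axi = {(M, N). rotation_matrix M \<and> N \<in> Gamma_axi}"

definition act :: "group_elt \<Rightarrow> config \<Rightarrow> config" where
  "act = (\<lambda>(M, N) (B, R). (det N *\<^sub>R (M ** B ** transpose N), N *v R))"

definition tangent_lift :: "group_elt \<Rightarrow> config \<Rightarrow> tangent \<Rightarrow> tangent" where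
  "tangent_lift g q v = (THE v'. config_velocity (\<lambda>t. act g (config_curve q v t)) v' 0)"

definition cotangent_lift :: "group_elt \<Rightarrow> phase \<Rightarrow> phase" where
  "cotangent_lift g = (\<lambda>(q, \<alpha>). (act g q, THE \<alpha>'. \<forall>v. \<alpha>' \<bullet> tangent_lift g q v = \<alpha> \<bullet> v))"

definition one_param :: "lie_elt \<Rightarrow> real \<Rightarrow> group_elt" where
  "one_param = (\<lambda>(\<xi>, \<eta>) t. (mat_exp (t *\<^sub>R hat \<xi>), mat_exp ((t * \<eta>) *\<^sub>R hat e1)))"

definition generator_Q :: "lie_elt \<Rightarrow> config \<Rightarrow> tangent" where
  "generator_Q = (\<lambda>(\<xi>, \<eta>) (B, R). (transpose B *v \<xi> - \<eta> *\<^sub>R e1, \<eta> *\<^sub>R (e1 \<times> R)))"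

definition generator_TQ :: "lie_elt \<Rightarrow> phase \<Rightarrow> phase_tangent" where
  "generator_TQ \<zeta> z = (THE w. phase_velocity (\<lambda>t. cotangent_lift (one_param \<zeta> t) z) w 0)"

text \<open>\<open>\<real>\<^sup>3 \<oplus> \<real>\<close> and its dual are identified by the inner product.\<close>

definition momentum :: "phase \<Rightarrow> lie_elt" where
  "momentum = (\<lambda>(q, \<alpha>). THE m. \<forall>\<zeta>. m \<bullet> \<zeta> = \<alpha> \<bullet> generator_Q \<zeta> q)"

definition coadjoint :: "group_elt \<Rightarrow> lie_elt \<Rightarrow> lie_elt" where
  "coadjoint = (\<lambda>(M, N) (\<mu>, \<nu>). (M *v \<mu>, chi_axi N * \<nu>))"

definition stabilizer_axi :: "lie_elt \<Rightarrow> group_elt set" where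
  "stabilizer_axi m = {g \<in> G_axi. coadjoint g m = m}"

definition stabilizer_algebra :: "lie_elt \<Rightarrow> lie_elt set" where
  "stabilizer_algebra m = {\<zeta>. \<forall>t. one_param \<zeta> t \<in> stabilizer_axi m}"


subsection \<open>Relative equilibria and their stability\<close>

definition relative_equilibrium :: "real \<Rightarrow> real \<Rightarrow> phase \<Rightarrow> lie_elt \<Rightarrow> bool" where
  "relative_equilibrium I1 I2 p \<zeta> \<longleftrightarrow>
     p \<in> phase_space \<and> evolution I1 I2 (\<lambda>t. cotangent_lift (one_param \<zeta> t) p)"

definition point_of :: "real \<Rightarrow> real \<Rightarrow> config \<Rightarrow> lie_elt \<Rightarrow> phase" where
  "point_of I1 I2 q \<zeta> = (q, legendre I1 I2 q (generator_Q \<zeta> q))"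

text \<open>Existence of a solution on the whole real line is part of the condition, since the flow on
  the phase space need not be complete.\<close>

definition Gmu_stable :: "real \<Rightarrow> real \<Rightarrow> phase \<Rightarrow> bool" where
  "Gmu_stable I1 I2 p \<longleftrightarrow>
     (\<forall>U. U \<subseteq> phase_space \<and>
          (\<forall>g \<in> stabilizer_axi (momentum p). cotangent_lift g ` U \<subseteq> U) \<and>
          (\<lambda>g. cotangent_lift g p) ` stabilizer_axi (momentum p)
             \<subseteq> (top_of_set phase_space) interior_of U
        \<longrightarrow> (\<exists>V \<subseteq> phase_space. p \<in> (top_of_set phase_space) interior_of V \<and>
               (\<forall>z0 \<in> V. (\<exists>z. evolution I1 I2 z \<and> z 0 = z0) \<and>
                  (\<forall>z. evolution I1 I2 z \<and> z 0 = z0 \<longrightarrow> (\<forall>t. z t \<in> U)))))"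

text \<open>\<open>l\<close> is an eigenvalue of the complexification of the map that \<open>A\<close> induces on \<open>K / W\<close>; \<open>x + \<i> y\<close>
  represents an eigenvector.\<close>

definition quotient_eigenvalue ::
  "('a::real_vector \<Rightarrow> 'a) \<Rightarrow> 'a set \<Rightarrow> 'a set \<Rightarrow> complex \<Rightarrow> bool" where
  "quotient_eigenvalue A K W l \<longleftrightarrow>
     (\<exists>x \<in> K. \<exists>y \<in> K. \<not> (x \<in> W \<and> y \<in> W) \<and>
        A x - (Re l *\<^sub>R x - Im l *\<^sub>R y) \<in> W \<and>
        A y - (Im l *\<^sub>R x + Re l *\<^sub>R y) \<in> W)"

text \<open>The field of \<open>H\<^sub>2 - \<langle>J, \<zeta>\<rangle>\<close> vanishes at a relative equilibrium with velocity \<open>\<zeta>\<close>, so the derivative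
  of its trivialized components is the intrinsic linearization.\<close>

definition linearization :: "real \<Rightarrow> real \<Rightarrow> lie_elt \<Rightarrow> phase \<Rightarrow> phase_tangent \<Rightarrow> phase_tangent" where
  "linearization I1 I2 \<zeta> p =
     deriv_along (hamiltonian_field (\<lambda>z. hamiltonian2 I1 I2 z - momentum z \<bullet> \<zeta>)) p"

definition linearly_unstable :: "real \<Rightarrow> real \<Rightarrow> phase \<Rightarrow> lie_elt \<Rightarrow> bool" where
  "linearly_unstable I1 I2 p \<zeta> \<longleftrightarrow>
     (\<exists>l. Re l > 0 \<and>
        quotient_eigenvalue (linearization I1 I2 \<zeta> p)
          {w. deriv_along momentum p w = 0}
          ((\<lambda>\<zeta>'. generator_TQ \<zeta>' p) ` stabilizer_algebra (momentum p)) l)"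

unbundle no cross3_syntax

end

theory Submission
  imports Defs
begin

text \<open>
  Write \<open>\<Lambda>\<close> for the body angular momentum \<open>\<Pi>\<close> (a binder in HOL-Library). The conserved quantities are
  \<open>B \<Lambda>\<close>, \<open>L\<^sub>1 = (\<Lambda> - R \<times> P)\<^sub>1\<close> and the energy. Completing squares, the energy is a function of
  \<open>L\<^sub>1\<close>, plus the amended potential
  \<open>W(r) = |\<Lambda>|\<^sup>2 / (2 (r\<^sup>2 + I2)) - 1/r + (3 I2 - 1) / (2 r\<^sup>3)\<close>, plus squares that vanish at the equilibrium,
  plus \<open>3 (I1 - I2) R\<^sub>1\<^sup>2 / (2 r\<^sup>5)\<close>.
  For oblate bodies the last term is nonnegative too, and the bound on \<open>R\<close> says \<open>W'' > 0\<close>; hence in a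
  suitable compact region the level set of the conserved quantities is a single group orbit, and a
  solution starting nearby is trapped there and therefore global.
  For prolate bodies the characteristic polynomial of the linearization on the symplectic slice, a
  monic cubic in the square of the eigenvalue, has at \<open>0\<close> the sign of \<open>(I1 - I2) cos\<^sup>2\<theta> W''\<close>. This
  is negative, so there is a positive real eigenvalue; its eigenvector is computed in the frame
  rotating with \<open>\<xi>\<close>.
\<close>

text \<open>Stability demands solutions for all time as well as confinement, and both come from one
  argument. The field is truncated to a bounded Lipschitz field on the vector space that contains
  the phase space; its solutions are global, and one that starts on a nearby level of the conserved
  quantities never reaches the region where the truncation acts. The ambient space holds arbitrary
  matrices, so orthogonality of the attitude is a further invariant to be carried along. Instead of
  a second variation on the whole slice, an energy identity settles the equality case exactly, and
  compactness turns that into a statement about neighbourhoods. The constant in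
  \<open>large'\<close> comes from W'': up to a positive factor this is a quadratic in the square of
  \<open>R\<close>, and the bound is its larger root when the roots are real. The same quadratic
  serves both shapes: it makes the radius a strict minimum for oblate bodies and fixes the sign of
  the characteristic function at 0 for prolate ones. That sign carries the square of cos \<theta> as
  a factor, which is why instability is claimed only away from both poles of the circle of
  parameters.\<close>

unbundle cross3_syntax

declare transpose_matrix_vector [simp del]

section \<open>Matrices and the matrix exponential\<close>

lemma bounded_bilinear_matrix_mult: "bounded_bilinear ((**) :: real^3^3 \<Rightarrow> real^3^3 \<Rightarrow> real^3^3)"
  unfolding bilinear_conv_bounded_bilinear [symmetric]
  by (auto simp: bilinear_def linear_iff matrix_matrix_mult_def vec_eq_iff
      sum.distrib algebra_simps sum_distrib_left)

lemma bounded_bilinear_matrix_vector: "bounded_bilinear ((*v) :: real^3^3 \<Rightarrow> real^3 \<Rightarrow> real^3)"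
  unfolding bilinear_conv_bounded_bilinear [symmetric]
  by (auto simp: bilinear_def linear_iff matrix_vector_mult_def vec_eq_iff
      sum.distrib algebra_simps sum_distrib_left)

lemma bounded_bilinear_cross3: "bounded_bilinear (cross3)"
  using bilinear_cross bilinear_conv_bounded_bilinear by blast

lemma bounded_linear_transpose: "bounded_linear (transpose :: real^3^3 \<Rightarrow> real^3^3)"
  unfolding linear_conv_bounded_linear [symmetric]
  by (auto simp: linear_iff transpose_def vec_eq_iff)

lemma bounded_linear_entry: "bounded_linear (\<lambda>M::real^3^3. M $ i $ j)"
  using bounded_linear_compose[OF bounded_linear_vec_nth bounded_linear_vec_nth] by fastforce

lemma bounded_linear_hat: "bounded_linear hat"
  unfolding linear_conv_bounded_linear [symmetric] 
  by (auto simp: linear_iff hat_def matrix_def vec_eq_iff cross_add_left cross_mult_left)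

lemmas matrix_vderiv = bounded_bilinear.has_vector_derivative[OF bounded_bilinear_matrix_mult]
lemmas matrix_vector_vderiv = bounded_bilinear.has_vector_derivative[OF bounded_bilinear_matrix_vector]
lemmas cross_vderiv = bounded_bilinear.has_vector_derivative[OF bounded_bilinear_cross3]

lemmas matrix_mult_scaleR = bounded_bilinear.scaleR_left[OF bounded_bilinear_matrix_mult]
  bounded_bilinear.scaleR_right[OF bounded_bilinear_matrix_mult]
lemmas matrix_mult_minus = bounded_bilinear.minus_left[OF bounded_bilinear_matrix_mult]
  bounded_bilinear.minus_right[OF bounded_bilinear_matrix_mult]
lemmas matrix_vector_scaleR = bounded_bilinear.scaleR_left[OF bounded_bilinear_matrix_vector]
  bounded_bilinear.scaleR_right[OF bounded_bilinear_matrix_vector]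

lemma hat_mult_vec [simp]: "hat w *v u = w \<times> u"
  unfolding hat_def matrix_def
  by (simp add: vec_eq_iff forall_3 matrix_vector_mult_def sum_3 cross3_def axis_def)

lemma transpose_hat: "transpose (hat w) = - hat w"
  unfolding hat_def matrix_def transpose_def
  by (simp add: vec_eq_iff forall_3 cross3_def axis_def)

lemma hat_inject: "hat v = hat w \<Longrightarrow> v = w"
  unfolding hat_def matrix_def
  by (simp add: vec_eq_iff forall_3 cross3_def axis_def)

lemma hat_0 [simp]: "hat 0 = 0"
  by (simp add: hat_def matrix_def vec_eq_iff)

lemma orthogonal_matrix_vec_inverse:
  fixes N :: "real^3^3"
  assumes "orthogonal_matrix N"
  shows "N *v (transpose N *v u) = u" "transpose N *v (N *v u) = u"
  using assms by (simp_all add: matrix_vector_mul_assoc orthogonal_matrix_def)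

lemma orthogonal_matrix_inner:
  fixes N :: "real^3^3"
  assumes "orthogonal_matrix N"
  shows "(N *v u) \<bullet> (N *v v) = u \<bullet> v"
  by (metis assms orthogonal_matrix_vec_inverse(2) dot_lmul_matrix transpose_matrix_vector
      inner_commute)

text \<open>An orthogonal map preserves cross products up to the sign \<open>det N\<close>, and this
  sign is its own inverse. It is the source of the factor \<open>det N\<close> in the tangent and
  cotangent lifts.\<close>

lemma hat_conjugate:
  assumes "orthogonal_matrix N"
  shows "N ** hat w ** transpose N = det N *\<^sub>R hat (N *v w)"
proof -
  have "(N ** hat w ** transpose N) *v u = (det N *\<^sub>R hat (N *v w)) *v u" for u
  proof -
    have "(N *v w) \<times> (N *v (transpose N *v u)) = det N *\<^sub>R (N *v (w \<times> (transpose N *v u)))"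
      by (rule cross_orthogonal_matrix[OF assms])
    then show ?thesis
      using assms det_orthogonal_matrix[OF assms]
      by (auto simp: orthogonal_matrix_vec_inverse matrix_vector_scaleR
          simp flip: matrix_vector_mul_assoc)
  qed
  then show ?thesis
    by (simp add: matrix_eq)
qed

section \<open>The exponential series of a matrix\<close>

definition mat_pow :: "real^3^3 \<Rightarrow> nat \<Rightarrow> real^3^3" where
  "mat_pow A k = (((**) A) ^^ k) (mat 1)"

lemma mat_pow_0 [simp]: "mat_pow A 0 = mat 1"
  and mat_pow_Suc: "mat_pow A (Suc k) = A ** mat_pow A k"
  by (simp_all add: mat_pow_def)

lemma mat_pow_commute: "mat_pow A k ** A = A ** mat_pow A k"
  by (induction k) (simp_all add: mat_pow_Suc flip: matrix_mul_assoc)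

lemma mat_pow_scaleR: "mat_pow (t *\<^sub>R A) k = t ^ k *\<^sub>R mat_pow A k"
  by (induction k) (simp_all add: mat_pow_Suc matrix_mult_scaleR mult.commute)

text \<open>Boundedness of the bilinear product supplies a constant \<open>K\<close> in the role of
  submultiplicativity, and the real exponential series at \<open>norm A * K\<close>
  dominates.\<close>

lemma summable_mat_exp: "summable (\<lambda>k. (1 / fact k) *\<^sub>R mat_pow A k)"
proof -
  obtain K where K: "0 \<le> K" "\<forall>(A::real^3^3) B::real^3^3. norm (A ** B) \<le> norm A * norm B * K"
    using bounded_bilinear.nonneg_bounded[OF bounded_bilinear_matrix_mult] by blast
  have *: "norm (mat_pow A k) \<le> norm (mat 1 :: real^3^3) * (norm A * K) ^ k" for k
  proof (induction k)
    case (Suc k)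
    have "norm (mat_pow A (Suc k)) \<le> norm A * norm (mat_pow A k) * K"
      using K by (simp add: mat_pow_Suc)
    also have "\<dots> \<le> norm A * (norm (mat 1 :: real^3^3) * (norm A * K) ^ k) * K"
      using Suc K by (intro mult_right_mono mult_left_mono) auto
    finally show ?case by (simp add: mult_ac)
  qed simp
  show ?thesis
  proof (rule summable_comparison_test)
    show "summable (\<lambda>k. norm (mat 1 :: real^3^3) * (inverse (fact k) * (norm A * K) ^ k))"
      by (intro summable_mult summable_exp)
    show "\<exists>N. \<forall>k\<ge>N. norm ((1 / fact k) *\<^sub>R mat_pow A k)
       \<le> norm (mat 1 :: real^3^3) * (inverse (fact k) * (norm A * K) ^ k)"
      using * by (auto simp: divide_simps mult_ac)
  qed
qed

lemma mat_exp_eq: "mat_exp A = (\<Sum>k. (1 / fact k) *\<^sub>R mat_pow A k)"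
  by (simp add: mat_exp_def mat_pow_def)

lemma mat_exp_0 [simp]: "mat_exp 0 = mat 1"
proof -
  have "mat_pow 0 k = (if k = 0 then mat 1 else 0)" for k
    by (cases k) (simp_all add: mat_pow_Suc)
  then have "mat_exp 0 = (\<Sum>k. if k = 0 then mat 1 else 0)"
    unfolding mat_exp_eq by (intro suminf_cong) auto
  also have "\<dots> = (\<Sum>k\<in>{0::nat}. if k = 0 then mat 1 else 0)"
    by (intro suminf_finite) auto
  finally show ?thesis by simp
qed

lemma mat_exp_commute: "mat_exp A ** A = A ** mat_exp A"
proof -
  note bl = bounded_bilinear.bounded_linear_left[OF bounded_bilinear_matrix_mult, of A]
    and br = bounded_bilinear.bounded_linear_right[OF bounded_bilinear_matrix_mult, of A]
  show ?thesis
    unfolding mat_exp_eq bounded_linear.suminf[OF bl summable_mat_exp]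
      bounded_linear.suminf[OF br summable_mat_exp]
    by (simp add: matrix_mult_scaleR mat_pow_commute)
qed

lemma mat_exp_entry:
  "mat_exp (t *\<^sub>R A) $ i $ j = (\<Sum>k. (mat_pow A k $ i $ j / fact k) * t ^ k)"
  unfolding mat_exp_eq bounded_linear.suminf[OF bounded_linear_entry summable_mat_exp]
  by (simp add: mat_pow_scaleR mult.commute)

text \<open>Each entry is a real power series in \<open>t\<close> that converges everywhere, so it
  may be differentiated termwise; the factor \<open>A\<close> comes from the shift of the
  index.\<close>

lemma mat_exp_vderiv:
  "((\<lambda>t. mat_exp (t *\<^sub>R A)) has_vector_derivative A ** mat_exp (t *\<^sub>R A)) (at t)"
proof -
  have summ: "summable (\<lambda>k. (mat_pow A k $ i $ j / fact k) * t ^ k)" for t i j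
    using bounded_linear.summable[OF bounded_linear_entry summable_mat_exp[of "t *\<^sub>R A"], of i j]
    by (simp add: mat_pow_scaleR mult.commute)
  have *: "((\<lambda>t. mat_exp (t *\<^sub>R A) $ i $ j) has_real_derivative (A ** mat_exp (t *\<^sub>R A)) $ i $ j) (at t)"
    for i j
  proof -
    have d: "diffs (\<lambda>k. mat_pow A k $ i $ j / fact k) n =
      (\<Sum>m\<in>UNIV. A $ i $ m * (mat_pow A n $ m $ j / fact n))" for n
      unfolding diffs_def mat_pow_Suc
      by (simp add: matrix_matrix_mult_def divide_simps flip: sum_divide_distrib)
    have "(\<Sum>n. diffs (\<lambda>k. mat_pow A k $ i $ j / fact k) n * t ^ n) =
       (\<Sum>n. \<Sum>m\<in>UNIV. A $ i $ m * (mat_pow A n $ m $ j / fact n * t ^ n))"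
      unfolding d by (simp only: sum_distrib_right mult.assoc)
    also have "\<dots> = (\<Sum>m\<in>UNIV. \<Sum>n. A $ i $ m * (mat_pow A n $ m $ j / fact n * t ^ n))"
      by (intro suminf_sum summable_mult summ)
    also have "\<dots> = (A ** mat_exp (t *\<^sub>R A)) $ i $ j"
      by (simp only: matrix_matrix_mult_def mat_exp_entry suminf_mult[OF summ] vec_lambda_beta)
    finally show ?thesis
      unfolding mat_exp_entry using termdiffs_strong_converges_everywhere[OF summ, of i j t] by simp
  qed
  have **: "((\<lambda>t. mat_exp (t *\<^sub>R A) $ i $ j) has_derivative
    (\<lambda>x. x * (A ** mat_exp (t *\<^sub>R A)) $ i $ j)) (at t)" for i j
    by (rule has_derivative_eq_rhs[OF *[unfolded has_field_derivative_def]])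
      (simp add: fun_eq_iff mult.commute)
  show ?thesis
    unfolding has_vector_derivative_def
    by (subst has_derivative_componentwise_within)
      (auto simp: Basis_vec_def inner_axis **)
qed

lemma mat_exp_vderiv_0: "((\<lambda>t. mat_exp (t *\<^sub>R A)) has_vector_derivative A) (at 0)"
  using mat_exp_vderiv[of A 0] by simp

section \<open>Curves of rotation matrices\<close>

lemma continuous_on_det: "continuous_on S (\<lambda>t. det (B t :: real^3^3))"
  if "continuous_on S B" for B :: "'a::topological_space \<Rightarrow> real^3^3"
  unfolding det_3 using that by (intro continuous_intros)

text \<open>On orthogonal matrices the determinant is 1 or -1, so along a connected set it cannot
  change sign without passing through 0.\<close>

lemma continuous_orthogonal_rotation:
  fixes B :: "real \<Rightarrow> real^3^3"
  assumes "connected S" "continuous_on S B" "a \<in> S" "rotation_matrix (B a)"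
    and "\<And>t. t \<in> S \<Longrightarrow> orthogonal_matrix (B t)" and "t \<in> S"
  shows "rotation_matrix (B t)"
proof (rule ccontr)
  assume "\<not> rotation_matrix (B t)"
  then have "det (B t) = -1"
    using assms det_orthogonal_matrix unfolding rotation_matrix_def by blast
  moreover have "det (B a) = 1"
    using assms by (simp add: rotation_matrix_def)
  ultimately have "-1 \<in> (\<lambda>t. det (B t)) ` S" "1 \<in> (\<lambda>t. det (B t)) ` S"
    using assms(3,6) by (metis imageI)+
  moreover have "connected ((\<lambda>t. det (B t)) ` S)"
    by (intro connected_continuous_image continuous_on_det assms)
  ultimately have "0 \<in> (\<lambda>t. det (B t)) ` S"
    using connectedD_interval[of "(\<lambda>t. det (B t)) ` S" "-1" 1 0] by simp
  then show False
    using assms(5) det_orthogonal_matrix by fastforce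
qed

text \<open>\<open>B t ** transpose (B t)\<close> is constant because \<open>hat\<close> takes skew
  values. The set \<open>S\<close> is general so that the lemma covers the exponential on the whole
  line as well as a segment of a solution known only up to some time.\<close>

lemma skew_flow_orthogonal:
  fixes B :: "real \<Rightarrow> real^3^3"
  assumes "connected S" "a \<in> S" "orthogonal_matrix (B a)" "t \<in> S"
    and "\<And>t. t \<in> S \<Longrightarrow> (B has_vector_derivative B t ** hat (w t)) (at t)"
  shows "orthogonal_matrix (B t)"
proof -
  have *: "((\<lambda>t. B t ** transpose (B t)) has_vector_derivative 0) (at t)" if "t \<in> S" for t
  proof -
    have "((\<lambda>t. B t ** transpose (B t)) has_vector_derivative
       B t ** transpose (B t ** hat (w t)) + (B t ** hat (w t)) ** transpose (B t)) (at t)"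
      using assms(5)[OF that]
      by (intro matrix_vderiv bounded_linear.has_vector_derivative[OF bounded_linear_transpose])
    also have "B t ** transpose (B t ** hat (w t)) + (B t ** hat (w t)) ** transpose (B t) = 0"
      by (simp add: matrix_transpose_mul transpose_hat matrix_mult_minus matrix_mul_assoc)
    finally show ?thesis .
  qed
  have "convex S"
    using assms(1) is_interval_convex_1[of S] is_interval_connected_1[of S] by simp
  then obtain c where "\<And>s. s \<in> S \<Longrightarrow> B s ** transpose (B s) = c"
    using has_vector_derivative_zero_constant[of S "\<lambda>t. B t ** transpose (B t)"] *
    by (metis (no_types, lifting) has_vector_derivative_at_within)
  then have "B t ** transpose (B t) = mat 1"
    using assms(2-4) unfolding orthogonal_matrix_def by metis
  then show ?thesis
    unfolding orthogonal_matrix_def using matrix_left_right_inverse[of "B t" "transpose (B t)"] by simp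
qed

lemma rotation_mat_exp: "rotation_matrix (mat_exp (t *\<^sub>R hat w))"
proof -
  have d: "((\<lambda>t. mat_exp (t *\<^sub>R hat w)) has_vector_derivative mat_exp (t *\<^sub>R hat w) ** hat w) (at t)" for t
    using mat_exp_vderiv[of "hat w" t] mat_exp_commute[of "t *\<^sub>R hat w"]
    by (cases "t = 0") (auto simp: matrix_mult_scaleR)
  have o: "orthogonal_matrix (mat_exp (t *\<^sub>R hat w))" for t
    by (rule skew_flow_orthogonal[of UNIV 0 "\<lambda>t. mat_exp (t *\<^sub>R hat w)" t "\<lambda>_. w"])
      (use d in \<open>auto simp: orthogonal_matrix_id\<close>)
  show ?thesis
    by (rule continuous_orthogonal_rotation[of UNIV "\<lambda>t. mat_exp (t *\<^sub>R hat w)" 0 t])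
      (use o d in \<open>auto simp: rotation_matrix_def orthogonal_matrix_id
        intro!: continuous_at_imp_continuous_on has_vector_derivative_continuous\<close>)
qed

text \<open>\<open>hat w\<close> annihilates \<open>w\<close> and commutes with its exponential, so
  the curve has zero derivative.\<close>

lemma mat_exp_hat_fixes: "mat_exp (t *\<^sub>R hat w) *v w = w"
proof -
  have "((\<lambda>t. mat_exp (t *\<^sub>R hat w) *v w) has_vector_derivative 0) (at t)" for t
  proof -
    have "((\<lambda>t. mat_exp (t *\<^sub>R hat w) *v w) has_vector_derivative
      mat_exp (t *\<^sub>R hat w) *v 0 + (hat w ** mat_exp (t *\<^sub>R hat w)) *v w) (at t)"
      by (intro matrix_vector_vderiv mat_exp_vderiv) simp
    moreover have "hat w ** mat_exp (t *\<^sub>R hat w) = mat_exp (t *\<^sub>R hat w) ** hat w"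
      using mat_exp_commute[of "t *\<^sub>R hat w"]
      by (cases "t = 0") (auto simp: matrix_mult_scaleR)
    ultimately show ?thesis
      by (simp flip: matrix_vector_mul_assoc)
  qed
  then obtain c where "\<And>t. mat_exp (t *\<^sub>R hat w) *v w = c"
    using has_vector_derivative_zero_constant[of UNIV "\<lambda>t. mat_exp (t *\<^sub>R hat w) *v w"]
    by auto
  then have "mat_exp (t *\<^sub>R hat w) *v w = mat_exp (0 *\<^sub>R hat w) *v w"
    by metis
  then show ?thesis by simp
qed

section \<open>The Hamiltonian system in coordinates\<close>

lemma rotation_matrix_mult:
  fixes A B :: "real^3^3"
  shows
  "rotation_matrix A \<Longrightarrow> rotation_matrix B \<Longrightarrow> rotation_matrix (A ** B)"
  by (simp add: rotation_matrix_def orthogonal_matrix_mul det_mul)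

lemma rotation_matrix_transpose:
  fixes A :: "real^3^3"
  shows "rotation_matrix A \<Longrightarrow> rotation_matrix (transpose A)"
  by (auto simp: rotation_matrix_def det_transpose orthogonal_matrix_transpose)

lemma e1_nth [simp]: "e1 $ 1 = 1" "e1 $ 2 = 0" "e1 $ 3 = 0"
  by (simp_all add: e1_def axis_def)

lemma inner_e1 [simp]: "v \<bullet> e1 = v $ 1" "e1 \<bullet> v = v $ 1"
  by (simp_all add: inner_vec_def sum_3)

lemmas vec3_simps = vec_eq_iff forall_3 cross3_def inner_vec_def sum_3

section \<open>Inertia, potential, Legendre transform and momentum\<close>

lemma axi_inertia_mult:
  "axi_inertia I1 I2 *v w = I2 *\<^sub>R w + ((I1 - I2) * w $ 1) *\<^sub>R e1"
  by (simp add: axi_inertia_def matrix_vector_mult_def vec3_simps algebra_simps)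

text \<open>The inverse of \<open>axi_inertia I1 I2\<close> for nonzero moments, split into a
  multiple of the identity and a part along the symmetry axis.\<close>

definition inv_inertia :: "real \<Rightarrow> real \<Rightarrow> real^3 \<Rightarrow> real^3" where
  "inv_inertia I1 I2 m = (1 / I2) *\<^sub>R m + ((1 / I1 - 1 / I2) * m $ 1) *\<^sub>R e1"

lemma bounded_linear_inv_inertia: "bounded_linear (inv_inertia I1 I2)"
  unfolding linear_conv_bounded_linear [symmetric]
  by (auto simp: linear_iff inv_inertia_def algebra_simps vec_eq_iff)

lemma inv_inertia_sym: "inv_inertia I1 I2 m \<bullet> m' = m \<bullet> inv_inertia I1 I2 m'"
  by (simp add: inv_inertia_def algebra_simps)

lemma inv_inertia_inverse:
  assumes "I1 \<noteq> 0" "I2 \<noteq> 0"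
  shows "axi_inertia I1 I2 *v inv_inertia I1 I2 m = m"
    "inv_inertia I1 I2 (axi_inertia I1 I2 *v w) = w"
  using assms by (simp_all add: axi_inertia_mult inv_inertia_def vec3_simps field_simps)

text \<open>By the Legendre transform the covector is \<open>(I \<Omega> + r \<times> P, P)\<close>,
  so subtracting the orbital part \<open>r \<times> P\<close> leaves the spin angular momentum
  \<open>I \<Omega>\<close>.\<close>

definition body_velocity :: "real \<Rightarrow> real \<Rightarrow> phase \<Rightarrow> real^3" where
  "body_velocity I1 I2 z = inv_inertia I1 I2 (fst (snd z) - snd (fst z) \<times> snd (snd z))"

text \<open>The gradient of the potential at \<open>r\<close> is \<open>force I1 I2 (1 / norm r) r\<close>; it is polynomial in
  \<open>i = 1 / norm r\<close> and \<open>r\<close>, so that a truncation of the singularity only concerns \<open>i\<close>.\<close>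

definition force :: "real \<Rightarrow> real \<Rightarrow> real \<Rightarrow> real^3 \<Rightarrow> real^3" where
  "force I1 I2 i r =
     (i ^ 3 - 3 / 2 * (3 * I2 - 1) * i ^ 5 - 15 / 2 * (I1 - I2) * (r $ 1)\<^sup>2 * i ^ 7) *\<^sub>R r
     + (3 * (I1 - I2) * (r $ 1) * i ^ 5) *\<^sub>R e1"

text \<open>The inertia form is \<open>I2\<close> times the squared norm plus
  \<open>(I1 - I2)\<close> times the squared axial coordinate; its spherical part merges with the
  inverse cube, whence \<open>3 * I2 - 1\<close>.\<close>

lemma potential2_eq:
  assumes "r \<noteq> 0"
  shows "potential2 I1 I2 r = - (1 / norm r) + (3 * I2 - 1) / 2 * (1 / norm r) ^ 3
    + 3 / 2 * (I1 - I2) * (r $ 1)\<^sup>2 * (1 / norm r) ^ 5"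
proof -
  have "r \<bullet> (axi_inertia I1 I2 *v r) = I2 * (norm r)\<^sup>2 + (I1 - I2) * (r $ 1)\<^sup>2"
    by (simp add: axi_inertia_mult algebra_simps power2_eq_square flip: power2_norm_eq_inner)
  then show ?thesis
    using assms unfolding potential2_def
    by (simp add: divide_simps) (simp add: algebra_simps eval_nat_numeral)
qed

lemma inverse_norm_deriv:
  fixes r :: "real \<Rightarrow> real^3"
  assumes "(r has_vector_derivative r') (at t)" "r t \<noteq> 0"
  shows "((\<lambda>t. 1 / norm (r t)) has_real_derivative - (r t \<bullet> r') * (1 / norm (r t)) ^ 3) (at t)"
proof -
  have pos: "0 < r t \<bullet> r t" and np: "\<not> r t \<bullet> r t < 0"
    using assms(2) by (simp_all add: not_less)
  have "((\<lambda>t. r t \<bullet> r t) has_real_derivative (r t \<bullet> r' + r' \<bullet> r t)) (at t)"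
    using bounded_bilinear.has_vector_derivative[OF bounded_bilinear_inner assms(1) assms(1)]
    by (simp add: has_real_derivative_iff_has_vector_derivative)
  then have "((\<lambda>t. 1 / sqrt (r t \<bullet> r t)) has_real_derivative
     - (r t \<bullet> r') * (1 / sqrt (r t \<bullet> r t)) ^ 3) (at t)"
    using pos
    by (auto intro!: derivative_eq_intros
        simp: np inner_commute power3_eq_cube divide_simps)
  then show ?thesis by (simp add: norm_eq_sqrt_inner)
qed

lemma vec_nth_deriv:
  fixes r :: "real \<Rightarrow> real^3"
  assumes "(r has_vector_derivative r') F"
  shows "((\<lambda>t. r t $ k) has_real_derivative r' $ k) F"
  using bounded_linear.has_vector_derivative[OF bounded_linear_vec_nth assms]
  by (simp add: has_real_derivative_iff_has_vector_derivative)

lemma potential2_deriv: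
  fixes r :: "real \<Rightarrow> real^3"
  assumes r: "(r has_vector_derivative r') (at t)" "r t \<noteq> 0"
  shows "((\<lambda>t. potential2 I1 I2 (r t)) has_real_derivative
     force I1 I2 (1 / norm (r t)) (r t) \<bullet> r') (at t)"
proof -
  have "((\<lambda>t. - (1 / norm (r t)) + (3 * I2 - 1) / 2 * (1 / norm (r t)) ^ 3
    + 3 / 2 * (I1 - I2) * (r t $ 1)\<^sup>2 * (1 / norm (r t)) ^ 5) has_real_derivative
     force I1 I2 (1 / norm (r t)) (r t) \<bullet> r') (at t)"
  proof -
    define i where "i = (\<lambda>t. 1 / norm (r t))"
    define q where "q = (\<lambda>t. r t $ 1)"
    have i: "(i has_real_derivative - (r t \<bullet> r') * i t ^ 3) (at t)"
      and q: "(q has_real_derivative r' $ 1) (at t)"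
      using inverse_norm_deriv[OF r] vec_nth_deriv[OF r(1)] by (auto simp: i_def q_def)
    have "((\<lambda>t. - i t + (3 * I2 - 1) / 2 * i t ^ 3 + 3 / 2 * (I1 - I2) * (q t)\<^sup>2 * i t ^ 5)
      has_real_derivative (i t ^ 3 - 3 / 2 * (3 * I2 - 1) * i t ^ 5 - 15 / 2 * (I1 - I2) * (q t)\<^sup>2 * i t ^ 7)
         * (r t \<bullet> r') + (3 * (I1 - I2) * q t * i t ^ 5) * r' $ 1) (at t)"
      by (rule derivative_eq_intros i q refl)+ (simp add: field_simps eval_nat_numeral)
    then show ?thesis
      by (simp add: i_def q_def force_def inner_add_left)
  qed
  moreover have "\<forall>\<^sub>F s in nhds t. r s \<noteq> 0"
    using tendsto_imp_eventually_ne[of r "r t" "nhds t" 0] has_vector_derivative_continuous[OF r(1)] r(2)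
    by (simp add: continuous_at tendsto_at_iff_tendsto_nhds)
  ultimately show ?thesis
    by (subst DERIV_cong_ev[OF refl _ refl]) (auto elim!: eventually_mono simp: potential2_eq)
qed

lemma gderiv_kinetic:
  "GDERIV (kinetic I1 I2 (B, r)) (\<Omega>, v) :>
     (axi_inertia I1 I2 *v \<Omega> + r \<times> (v + \<Omega> \<times> r), v + \<Omega> \<times> r)"
proof -
  let ?A = "axi_inertia I1 I2"
  have k: "kinetic I1 I2 (B, r) = (\<lambda>w. (fst w \<bullet> (?A *v fst w) +
      (snd w + fst w \<times> r) \<bullet> (snd w + fst w \<times> r)) / 2)"
    by (auto simp: kinetic_def fun_eq_iff power2_norm_eq_inner)
  have 1: "((\<lambda>w::tangent. ?A *v fst w) has_derivative (\<lambda>h. ?A *v fst h)) (at x)" for x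
    by (intro bounded_linear.has_derivative[OF matrix_vector_mul_bounded_linear]
        bounded_linear_imp_has_derivative bounded_linear_fst)
  have 2: "((\<lambda>w::tangent. fst w \<times> r) has_derivative (\<lambda>h. fst h \<times> r)) (at x)" for x
    by (intro bounded_linear.has_derivative[OF bounded_bilinear.bounded_linear_left[OF bounded_bilinear_cross3]]
        bounded_linear_imp_has_derivative bounded_linear_fst)
  show ?thesis
    unfolding gderiv_def k
    apply (rule derivative_eq_intros 1 2 refl)+
     apply simp
    apply (rule ext)
    subgoal for h
      by (cases h) (simp add: axi_inertia_mult vec3_simps field_simps)
    done
qed

lemma legendre_eq:
  "legendre I1 I2 (B, r) (\<Omega>, v) =
     (axi_inertia I1 I2 *v \<Omega> + r \<times> (v + \<Omega> \<times> r), v + \<Omega> \<times> r)"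
  unfolding legendre_def
proof (rule the_equality)
  show "GDERIV (kinetic I1 I2 (B, r)) (\<Omega>, v) :>
     (axi_inertia I1 I2 *v \<Omega> + r \<times> (v + \<Omega> \<times> r), v + \<Omega> \<times> r)"
    by (rule gderiv_kinetic)
  fix \<alpha> assume "GDERIV (kinetic I1 I2 (B, r)) (\<Omega>, v) :> \<alpha>"
  then have "(\<lambda>h. h \<bullet> \<alpha>) = (\<lambda>h. h \<bullet> (axi_inertia I1 I2 *v \<Omega> + r \<times> (v + \<Omega> \<times> r), v + \<Omega> \<times> r))"
    using gderiv_kinetic unfolding gderiv_def by (rule has_derivative_unique)
  then show "\<alpha> = (axi_inertia I1 I2 *v \<Omega> + r \<times> (v + \<Omega> \<times> r), v + \<Omega> \<times> r)"
    by (metis vector_eq_ldot)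
qed

lemma inv_legendre_eq:
  assumes "I1 \<noteq> 0" "I2 \<noteq> 0"
  shows "inv (legendre I1 I2 (B, r)) (\<Lambda>, P) =
    (inv_inertia I1 I2 (\<Lambda> - r \<times> P), P - inv_inertia I1 I2 (\<Lambda> - r \<times> P) \<times> r)"
proof (rule inv_f_eq)
  show "inj (legendre I1 I2 (B, r))"
  proof (rule injI)
    fix x y assume eq: "legendre I1 I2 (B, r) x = legendre I1 I2 (B, r) y"
    obtain a b where x: "x = (a, b)" by fastforce
    obtain c d where y: "y = (c, d)" by fastforce
    have 1: "b + a \<times> r = d + c \<times> r"
      using eq by (simp add: x y legendre_eq)
    then have "axi_inertia I1 I2 *v a = axi_inertia I1 I2 *v c"
      using eq by (auto simp: x y legendre_eq)
    then have "a = c"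
      using inv_inertia_inverse(2)[OF assms] by metis
    with 1 show "x = y" by (simp add: x y)
  qed
  show "legendre I1 I2 (B, r)
      (inv_inertia I1 I2 (\<Lambda> - r \<times> P), P - inv_inertia I1 I2 (\<Lambda> - r \<times> P) \<times> r) = (\<Lambda>, P)"
    by (simp add: legendre_eq inv_inertia_inverse[OF assms])
qed

lemma hamiltonian2_eq:
  assumes "I1 \<noteq> 0" "I2 \<noteq> 0"
  shows "hamiltonian2 I1 I2 ((B, r), (\<Lambda>, P)) =
    ((\<Lambda> - r \<times> P) \<bullet> inv_inertia I1 I2 (\<Lambda> - r \<times> P) + P \<bullet> P) / 2 + potential2 I1 I2 r"
  by (simp add: hamiltonian2_def inv_legendre_eq[OF assms] kinetic_def
      inv_inertia_inverse[OF assms] inner_commute power2_norm_eq_inner)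

lemma hamiltonian2_deriv:
  assumes "I1 \<noteq> 0" "I2 \<noteq> 0"
    and "(r has_vector_derivative r') (at t)" "(\<Lambda> has_vector_derivative \<Lambda>') (at t)"
    and "(P has_vector_derivative P') (at t)" "r t \<noteq> 0"
  shows "((\<lambda>t. hamiltonian2 I1 I2 ((B t, r t), (\<Lambda> t, P t))) has_real_derivative
    inv_inertia I1 I2 (\<Lambda> t - r t \<times> P t) \<bullet> (\<Lambda>' - (r t \<times> P' + r' \<times> P t)) + P t \<bullet> P'
    + force I1 I2 (1 / norm (r t)) (r t) \<bullet> r') (at t)"
proof -
  let ?m = "\<lambda>t. \<Lambda> t - r t \<times> P t" and ?m' = "\<Lambda>' - (r t \<times> P' + r' \<times> P t)"
  have m: "(?m has_vector_derivative ?m') (at t)"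
    by (intro has_vector_derivative_diff cross_vderiv assms)
  have "((\<lambda>t. ?m t \<bullet> inv_inertia I1 I2 (?m t)) has_real_derivative
      ?m t \<bullet> inv_inertia I1 I2 ?m' + ?m' \<bullet> inv_inertia I1 I2 (?m t)) (at t)"
    unfolding has_real_derivative_iff_has_vector_derivative
    by (intro bounded_bilinear.has_vector_derivative[OF bounded_bilinear_inner]
        bounded_linear.has_vector_derivative[OF bounded_linear_inv_inertia] m)
  moreover have "((\<lambda>t. P t \<bullet> P t) has_real_derivative P t \<bullet> P' + P' \<bullet> P t) (at t)"
    unfolding has_real_derivative_iff_has_vector_derivative
    by (intro bounded_bilinear.has_vector_derivative[OF bounded_bilinear_inner] assms)
  moreover have "?m t \<bullet> inv_inertia I1 I2 ?m' = ?m' \<bullet> inv_inertia I1 I2 (?m t)"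
    by (metis inv_inertia_sym inner_commute)
  moreover note potential2_deriv[OF assms(3,6), of I1 I2]
  ultimately show ?thesis
    unfolding hamiltonian2_eq[OF assms(1,2)]
    by - (rule DERIV_cong[OF DERIV_add[OF DERIV_cdivide[OF DERIV_add]]], assumption+,
      simp add: inner_commute)
qed

lemma momentum_eq: "momentum ((B, r), (\<Lambda>, P)) = (B *v \<Lambda>, (r \<times> P - \<Lambda>) $ 1)"
  unfolding momentum_def prod.case
proof (rule the_equality)
  have *: "(B *v \<Lambda>, (r \<times> P - \<Lambda>) $ 1) \<bullet> \<zeta> = (\<Lambda>, P) \<bullet> generator_Q \<zeta> (B, r)" for \<zeta>
  proof -
    have "(B *v \<Lambda>) \<bullet> \<xi> = \<Lambda> \<bullet> (transpose B *v \<xi>)" for \<xi>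
      by (metis dot_lmul_matrix inner_commute transpose_matrix_vector)
    then show ?thesis
      by (cases \<zeta>) (simp add: generator_Q_def vec3_simps algebra_simps)
  qed
  then show "\<forall>\<zeta>. (B *v \<Lambda>, (r \<times> P - \<Lambda>) $ 1) \<bullet> \<zeta> = (\<Lambda>, P) \<bullet> generator_Q \<zeta> (B, r)"
    by blast
  fix m assume "\<forall>\<zeta>. m \<bullet> \<zeta> = (\<Lambda>, P) \<bullet> generator_Q \<zeta> (B, r)"
  then show "m = (B *v \<Lambda>, (r \<times> P - \<Lambda>) $ 1)"
    using * by (metis vector_eq_rdot)
qed

section \<open>Hamiltonian vector fields in left trivialized coordinates\<close>

lemma phase_curve_eq:
  "phase_curve ((B, r), (\<Lambda>, P)) ((v, w), (\<pi>, \<rho>)) t =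
    ((B ** mat_exp (t *\<^sub>R hat v), r + t *\<^sub>R w), (\<Lambda> + t *\<^sub>R \<pi>, P + t *\<^sub>R \<rho>))"
  by (simp add: phase_curve_def config_curve_def)

lemma line_deriv: "((\<lambda>t. a + t *\<^sub>R v) has_vector_derivative v) (at t)"
  by (auto intro!: derivative_eq_intros)

text \<open>Nondegeneracy of the form, by testing against one of the four kinds of direction at a
  time. The term \<open>\<Lambda> \<times> c\<close> compensates the bracket term of the left
  trivialization.\<close>

lemma hamiltonian_field_eq:
  assumes "\<And>v w \<pi> \<rho>. deriv_along F (q, (\<Lambda>, P)) ((v, w), (\<pi>, \<rho>)) =
     a \<bullet> v + b \<bullet> w + c \<bullet> \<pi> + d \<bullet> \<rho>"
  shows "hamiltonian_field F (q, (\<Lambda>, P)) = ((c, d), (\<Lambda> \<times> c - a, - b))"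
proof -
  have *: "symplectic_form (q, (\<Lambda>, P)) ((c, d), (\<Lambda> \<times> c - a, - b)) w =
      deriv_along F (q, (\<Lambda>, P)) w" for w
  proof -
    obtain v w' \<pi> \<rho> where "w = ((v, w'), (\<pi>, \<rho>))"
      by (metis surj_pair)
    then show ?thesis
      by (simp add: symplectic_form_def assms vec3_simps algebra_simps)
  qed
  show ?thesis
    unfolding hamiltonian_field_def
  proof (rule the_equality)
    fix X assume X: "\<forall>w. symplectic_form (q, (\<Lambda>, P)) X w = deriv_along F (q, (\<Lambda>, P)) w"
    obtain c' d' a' b' where Xeq: "X = ((c', d'), (a', b'))"
      by (metis surj_pair)
    have e: "symplectic_form (q, (\<Lambda>, P)) X w =
       symplectic_form (q, (\<Lambda>, P)) ((c, d), (\<Lambda> \<times> c - a, - b)) w" for w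
      by (rule trans[OF X[rule_format] *[symmetric]])
    have "c' \<bullet> \<pi> = c \<bullet> \<pi>" for \<pi>
      using e[of "((0, 0), (\<pi>, 0))"] by (simp add: Xeq symplectic_form_def inner_commute)
    then have c: "c' = c" by (metis vector_eq_rdot)
    have "d' \<bullet> \<pi> = d \<bullet> \<pi>" for \<pi>
      using e[of "((0, 0), (0, \<pi>))"] by (simp add: Xeq symplectic_form_def inner_commute)
    then have d: "d' = d" by (metis vector_eq_rdot)
    have "b' \<bullet> \<pi> = (- b) \<bullet> \<pi>" for \<pi>
      using e[of "((0, \<pi>), (0, 0))"] by (simp add: Xeq symplectic_form_def inner_commute)
    then have b: "b' = - b" by (metis vector_eq_rdot)
    have "a' \<bullet> \<pi> = (\<Lambda> \<times> c - a) \<bullet> \<pi>" for \<pi>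
      using e[of "((\<pi>, 0), (0, 0))"] by (simp add: Xeq symplectic_form_def inner_commute c)
    then have a: "a' = \<Lambda> \<times> c - a" by (metis vector_eq_rdot)
    show "X = ((c, d), (\<Lambda> \<times> c - a, - b))"
      by (simp add: Xeq a b c d)
  qed (use * in blast)
qed

lemma momentum_deriv:
  assumes "(B has_vector_derivative B') (at t)"
    and "(r has_vector_derivative r') (at t)" "(\<Lambda> has_vector_derivative \<Lambda>') (at t)"
    and "(P has_vector_derivative P') (at t)"
  shows "((\<lambda>t. momentum ((B t, r t), (\<Lambda> t, P t))) has_vector_derivative
     (B t *v \<Lambda>' + B' *v \<Lambda> t, (r t \<times> P' + r' \<times> P t - \<Lambda>') $ 1)) (at t)"
  unfolding momentum_eq
  by (intro has_vector_derivative_Pair matrix_vector_vderiv assms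
      bounded_linear.has_vector_derivative[OF bounded_linear_vec_nth]
      has_vector_derivative_diff cross_vderiv)

text \<open>Velocity 0 gives the equations of motion, and the general case gives the field whose
  derivative at a relative equilibrium is the linearization.\<close>

lemma augmented_hamiltonian_field:
  fixes r \<Lambda> P \<xi> :: "real^3" and B :: "real^3^3"
  assumes "I1 \<noteq> 0" "I2 \<noteq> 0" "r \<noteq> 0"
  defines "\<Omega> \<equiv> body_velocity I1 I2 ((B, r), (\<Lambda>, P))"
  shows "hamiltonian_field (\<lambda>z. hamiltonian2 I1 I2 z - momentum z \<bullet> (\<xi>, \<eta>)) ((B, r), (\<Lambda>, P)) =
    ((\<Omega> - transpose B *v \<xi> + \<eta> *\<^sub>R e1, P + r \<times> \<Omega> - \<eta> *\<^sub>R (e1 \<times> r)),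
     (\<Lambda> \<times> (\<Omega> + \<eta> *\<^sub>R e1), P \<times> (\<Omega> + \<eta> *\<^sub>R e1) - force I1 I2 (1 / norm r) r))"
proof -
  have \<Omega>: "\<Omega> = inv_inertia I1 I2 (\<Lambda> - r \<times> P)"
    by (simp add: \<Omega>_def body_velocity_def)
  define g where "g = force I1 I2 (1 / norm r) r"
  have d: "deriv_along (\<lambda>z. hamiltonian2 I1 I2 z - momentum z \<bullet> (\<xi>, \<eta>)) ((B, r), (\<Lambda>, P)) ((v, w), (\<pi>, \<rho>))
    = (- (\<Lambda> \<times> (transpose B *v \<xi>))) \<bullet> v + (g - P \<times> \<Omega> - \<eta> *\<^sub>R (P \<times> e1)) \<bullet> w
      + (\<Omega> - transpose B *v \<xi> + \<eta> *\<^sub>R e1) \<bullet> \<pi> + (P + r \<times> \<Omega> - \<eta> *\<^sub>R (e1 \<times> r)) \<bullet> \<rho>"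
    (is "_ = ?rhs")
    for v w \<pi> \<rho>
  proof -
    have B: "((\<lambda>t. B ** mat_exp (t *\<^sub>R hat v)) has_vector_derivative B ** hat v) (at 0)"
      by (intro bounded_linear.has_vector_derivative[OF
          bounded_bilinear.bounded_linear_right[OF bounded_bilinear_matrix_mult]] mat_exp_vderiv_0)
    have H: "((\<lambda>t. hamiltonian2 I1 I2 (phase_curve ((B, r), (\<Lambda>, P)) ((v, w), (\<pi>, \<rho>)) t))
      has_vector_derivative \<Omega> \<bullet> (\<pi> - (r \<times> \<rho> + w \<times> P)) + P \<bullet> \<rho> + g \<bullet> w) (at 0)"
      using hamiltonian2_deriv[OF assms(1,2) line_deriv[of r w] line_deriv[of \<Lambda> \<pi>] line_deriv[of P \<rho>],
          of 0 "\<lambda>t. B ** mat_exp (t *\<^sub>R hat v)"] assms(3)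
      by (simp add: phase_curve_eq \<Omega> g_def has_real_derivative_iff_has_vector_derivative)
    have J: "((\<lambda>t. momentum (phase_curve ((B, r), (\<Lambda>, P)) ((v, w), (\<pi>, \<rho>)) t))
      has_vector_derivative (B *v \<pi> + (B ** hat v) *v \<Lambda>, (r \<times> \<rho> + w \<times> P - \<pi>) $ 1)) (at 0)"
      using momentum_deriv[OF B line_deriv[of r w] line_deriv[of \<Lambda> \<pi>] line_deriv[of P \<rho>]]
      by (simp add: phase_curve_eq)
    have "((\<lambda>t. momentum (phase_curve ((B, r), (\<Lambda>, P)) ((v, w), (\<pi>, \<rho>)) t) \<bullet> (\<xi>, \<eta>))
      has_vector_derivative (B *v \<pi> + (B ** hat v) *v \<Lambda>, (r \<times> \<rho> + w \<times> P - \<pi>) $ 1) \<bullet> (\<xi>, \<eta>)) (at 0)"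
      by (rule bounded_linear.has_vector_derivative[OF bounded_linear_inner_left J])
    from has_vector_derivative_diff[OF H this]
    have "deriv_along (\<lambda>z. hamiltonian2 I1 I2 z - momentum z \<bullet> (\<xi>, \<eta>)) ((B, r), (\<Lambda>, P)) ((v, w), (\<pi>, \<rho>))
      = \<Omega> \<bullet> (\<pi> - (r \<times> \<rho> + w \<times> P)) + P \<bullet> \<rho> + g \<bullet> w
        - (B *v \<pi> + (B ** hat v) *v \<Lambda>, (r \<times> \<rho> + w \<times> P - \<pi>) $ 1) \<bullet> (\<xi>, \<eta>)"
      unfolding deriv_along_def by (rule vector_derivative_at)
    also have "\<dots> = \<Omega> \<bullet> (\<pi> - (r \<times> \<rho> + w \<times> P)) + P \<bullet> \<rho> + g \<bullet> w
        - ((\<pi> + v \<times> \<Lambda>) \<bullet> (transpose B *v \<xi>) + (r \<times> \<rho> + w \<times> P - \<pi>) $ 1 * \<eta>)"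
    proof -
      have "(B *v x) \<bullet> \<xi> = x \<bullet> (transpose B *v \<xi>)" for x
        by (metis dot_lmul_matrix inner_commute transpose_matrix_vector)
      then show ?thesis
        by (simp add: matrix_vector_right_distrib[symmetric] flip: matrix_vector_mul_assoc)
    qed
    also have "\<dots> = ?rhs"
      by (simp add: vec3_simps algebra_simps)
    finally show ?thesis .
  qed
  have "\<Lambda> \<times> (\<Omega> - transpose B *v \<xi> + \<eta> *\<^sub>R e1) - - (\<Lambda> \<times> (transpose B *v \<xi>)) = \<Lambda> \<times> (\<Omega> + \<eta> *\<^sub>R e1)"
    "- (g - P \<times> \<Omega> - \<eta> *\<^sub>R (P \<times> e1)) = P \<times> (\<Omega> + \<eta> *\<^sub>R e1) - g"
    by (simp_all add: vec3_simps algebra_simps)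
  then show ?thesis
    using hamiltonian_field_eq[OF d] by (simp add: g_def)
qed

lemma hamiltonian2_field:
  fixes r \<Lambda> P :: "real^3" and B :: "real^3^3"
  assumes "I1 \<noteq> 0" "I2 \<noteq> 0" "r \<noteq> 0"
  defines "\<Omega> \<equiv> body_velocity I1 I2 ((B, r), (\<Lambda>, P))"
  shows "hamiltonian_field (hamiltonian2 I1 I2) ((B, r), (\<Lambda>, P)) =
    ((\<Omega>, P + r \<times> \<Omega>), (\<Lambda> \<times> \<Omega>, P \<times> \<Omega> - force I1 I2 (1 / norm r) r))"
  using augmented_hamiltonian_field[OF assms(1-3), of 0 0 B \<Lambda> P]
  by (simp add: \<Omega>_def flip: zero_prod_def)

section \<open>The lifted action\<close>

text \<open>The attitude is invertible and \<open>hat\<close> is injective. This gives the definite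
  descriptions behind lifts and generators a unique value.\<close>

lemma config_velocity_unique:
  assumes "config_velocity c v t" "config_velocity c w t" "orthogonal_matrix (fst (c t))"
  shows "v = w"
proof (rule prod_eqI)
  have "fst (c t) ** hat (fst v) = fst (c t) ** hat (fst w)"
    using assms(1,2) unfolding config_velocity_def by (metis vector_derivative_at)
  then have "transpose (fst (c t)) ** (fst (c t) ** hat (fst v)) =
     transpose (fst (c t)) ** (fst (c t) ** hat (fst w))"
    by simp
  then have "hat (fst v) = hat (fst w)"
    using assms(3) by (simp add: matrix_mul_assoc orthogonal_matrix_def)
  then show "fst v = fst w" by (rule hat_inject)
  show "snd v = snd w"
    using assms(1,2) unfolding config_velocity_def by (metis vector_derivative_at)
qed

lemma phase_velocity_unique:
  assumes "phase_velocity c v t" "phase_velocity c w t" "orthogonal_matrix (fst (fst (c t)))"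
  shows "v = w"
proof (rule prod_eqI)
  show "fst v = fst w"
    using assms config_velocity_unique[of "\<lambda>s. fst (c s)"] unfolding phase_velocity_def by blast
  show "snd v = snd w"
    using assms(1,2) unfolding phase_velocity_def by (metis vector_derivative_at)
qed

lemma tangent_lift_eq:
  assumes "orthogonal_matrix M" "orthogonal_matrix N" "orthogonal_matrix B"
  shows "tangent_lift (M, N) (B, r) (v, w) = (det N *\<^sub>R (N *v v), N *v w)"
  unfolding tangent_lift_def
proof (rule the_equality)
  let ?c = "\<lambda>t. act (M, N) (config_curve (B, r) (v, w) t)"
  have dN: "det N * det N = 1"
    using det_orthogonal_matrix[OF assms(2)] by auto
  have "((\<lambda>t. det N *\<^sub>R (M ** (B ** mat_exp (t *\<^sub>R hat v)) ** transpose N)) has_vector_derivative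
     det N *\<^sub>R (M ** (B ** hat v) ** transpose N)) (at 0)"
    by (intro bounded_linear.has_vector_derivative[OF bounded_linear_scaleR_right]
        bounded_linear.has_vector_derivative[OF bounded_bilinear.bounded_linear_left[OF bounded_bilinear_matrix_mult]]
        bounded_linear.has_vector_derivative[OF bounded_bilinear.bounded_linear_right[OF bounded_bilinear_matrix_mult]]
        mat_exp_vderiv_0)
  \<comment> \<open>Inserting \<open>transpose N ** N\<close> in front of \<open>hat v\<close>
    produces the new attitude as left factor and a conjugated \<open>hat\<close> as right factor,
    which is the left trivialized form.\<close>
  also have "M ** (B ** hat v) ** transpose N = M ** B ** transpose N ** (N ** hat v ** transpose N)"
    using assms(2) by (simp add: matrix_mul_assoc orthogonal_matrix_def flip: matrix_mul_assoc[of _ "transpose N" N])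
  also have "\<dots> = M ** B ** transpose N ** hat (det N *\<^sub>R (N *v v))"
    using linear_scale[OF bounded_linear.linear[OF bounded_linear_hat]]
    by (simp add: hat_conjugate[OF assms(2)])
  finally have 1: "((\<lambda>t. det N *\<^sub>R (M ** (B ** mat_exp (t *\<^sub>R hat v)) ** transpose N)) has_vector_derivative
     (det N *\<^sub>R (M ** B ** transpose N)) ** hat (det N *\<^sub>R (N *v v))) (at 0)"
    by (simp add: matrix_mult_scaleR)
  have 2: "((\<lambda>t. N *v (r + t *\<^sub>R w)) has_vector_derivative N *v w) (at 0)"
    by (intro bounded_linear.has_vector_derivative[OF matrix_vector_mul_bounded_linear] line_deriv)
  show c: "config_velocity ?c (det N *\<^sub>R (N *v v), N *v w) 0"
    using 1 2 by (simp add: config_velocity_def act_def config_curve_def)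
  have "orthogonal_matrix (M ** B ** transpose N)"
    by (intro orthogonal_matrix_mul) (simp_all add: assms orthogonal_matrix_transpose)
  then have "orthogonal_matrix (det N *\<^sub>R (M ** B ** transpose N))"
    using dN by (simp add: orthogonal_matrix matrix_mult_scaleR
        linear_scale[OF bounded_linear.linear[OF bounded_linear_transpose]])
  then show "v' = (det N *\<^sub>R (N *v v), N *v w)" if "config_velocity ?c v' 0" for v'
    using config_velocity_unique[OF that c] by (simp add: act_def config_curve_def)
qed

text \<open>The tangent lift preserves the inner product of the two factors, so its inverse
  transpose is given by the same formula.\<close>

lemma cotangent_lift_eq:
  assumes "orthogonal_matrix M" "orthogonal_matrix N" "orthogonal_matrix B"
  shows "cotangent_lift (M, N) ((B, r), (\<Lambda>, P)) =
    ((det N *\<^sub>R (M ** B ** transpose N), N *v r), (det N *\<^sub>R (N *v \<Lambda>), N *v P))"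
proof -
  have dN: "det N * det N = 1"
    using det_orthogonal_matrix[OF assms(2)] by auto
  have "(THE \<alpha>'. \<forall>v. \<alpha>' \<bullet> tangent_lift (M, N) (B, r) v = (\<Lambda>, P) \<bullet> v) =
     (det N *\<^sub>R (N *v \<Lambda>), N *v P)"
  proof (rule the_equality)
    have "(det N *\<^sub>R (N *v \<Lambda>), N *v P) \<bullet> tangent_lift (M, N) (B, r) (v, w) = (\<Lambda>, P) \<bullet> (v, w)" for v w
      using dN by (simp add: tangent_lift_eq[OF assms] orthogonal_matrix_inner[OF assms(2)]
          flip: mult.assoc)
    then show "\<forall>v. (det N *\<^sub>R (N *v \<Lambda>), N *v P) \<bullet> tangent_lift (M, N) (B, r) v = (\<Lambda>, P) \<bullet> v"
      by auto
    fix \<alpha> assume \<alpha>: "\<forall>v. \<alpha> \<bullet> tangent_lift (M, N) (B, r) v = (\<Lambda>, P) \<bullet> v"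
    have "\<alpha> \<bullet> u = (det N *\<^sub>R (N *v \<Lambda>), N *v P) \<bullet> u" for u
    proof -
      obtain a b where u: "u = (a, b)" by fastforce
      have "tangent_lift (M, N) (B, r) (det N *\<^sub>R (transpose N *v a), transpose N *v b) = u"
        using dN by (simp add: tangent_lift_eq[OF assms] u matrix_vector_scaleR
            orthogonal_matrix_vec_inverse[OF assms(2)])
      then show ?thesis
        using \<alpha> \<open>\<forall>v. (det N *\<^sub>R (N *v \<Lambda>), N *v P) \<bullet> tangent_lift (M, N) (B, r) v = (\<Lambda>, P) \<bullet> v\<close>
        by metis
    qed
    then show "\<alpha> = (det N *\<^sub>R (N *v \<Lambda>), N *v P)"
      by (metis vector_eq_rdot)
  qed
  then show ?thesis
    by (simp add: cotangent_lift_def act_def)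
qed

text \<open>The velocity is computed at every time, not only at 0: comparison with the Hamiltonian
  field along the whole orbit is what shows that the orbit is a solution.\<close>

lemma one_param_curve:
  fixes \<xi> r \<Lambda> P :: "real^3" and \<eta> :: real
  assumes "rotation_matrix B"
  defines "c \<equiv> \<lambda>t. cotangent_lift (one_param (\<xi>, \<eta>) t) ((B, r), (\<Lambda>, P))"
  defines "F \<equiv> \<lambda>t. mat_exp ((t * \<eta>) *\<^sub>R hat e1)" and "E \<equiv> \<lambda>t. mat_exp (t *\<^sub>R hat \<xi>)"
  shows "c t = ((E t ** B ** transpose (F t), F t *v r), (F t *v \<Lambda>, F t *v P))"
    and "rotation_matrix (F t)" "rotation_matrix (E t)" "rotation_matrix (E t ** B ** transpose (F t))"
    and "phase_velocity c ((transpose (E t ** B ** transpose (F t)) *v \<xi> - \<eta> *\<^sub>R e1,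
         \<eta> *\<^sub>R (e1 \<times> (F t *v r))), (\<eta> *\<^sub>R (e1 \<times> (F t *v \<Lambda>)), \<eta> *\<^sub>R (e1 \<times> (F t *v P)))) t"
proof -
  show F: "rotation_matrix (F t)" and E: "rotation_matrix (E t)" for t
    by (simp_all add: F_def E_def rotation_mat_exp)
  show rot: "rotation_matrix (E t ** B ** transpose (F t))" for t
    by (intro rotation_matrix_mult rotation_matrix_transpose E F assms)
  show c: "c t = ((E t ** B ** transpose (F t), F t *v r), (F t *v \<Lambda>, F t *v P))" for t
    using cotangent_lift_eq[of "E t" "F t" B r \<Lambda> P] E[of t] F[of t] assms(1)
    by (simp add: c_def one_param_def F_def E_def rotation_matrix_def)
  have F': "(F has_vector_derivative (\<eta> *\<^sub>R hat e1) ** F t) (at t)" for t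
    using mat_exp_vderiv[of "\<eta> *\<^sub>R hat e1" t] by (simp add: F_def)
  have E': "(E has_vector_derivative hat \<xi> ** E t) (at t)" for t
    using mat_exp_vderiv[of "hat \<xi>" t] by (simp add: E_def)
  let ?B = "E t ** B ** transpose (F t)"
  have d: "((\<lambda>t. E t ** B ** transpose (F t)) has_vector_derivative
     E t ** B ** transpose ((\<eta> *\<^sub>R hat e1) ** F t) + (hat \<xi> ** E t ** B) ** transpose (F t)) (at t)"
    by (intro matrix_vderiv bounded_linear.has_vector_derivative[OF bounded_linear_transpose] F'
        bounded_linear.has_vector_derivative[OF bounded_bilinear.bounded_linear_left[OF bounded_bilinear_matrix_mult]] E')
  \<comment> \<open>A spatial angular velocity \<xi> multiplies the attitude from the left;
    conjugation by the attitude moves it to the right, where it reads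
    \<open>transpose B *v \<xi>\<close>.\<close>
  have e2: "(hat \<xi> ** E t ** B) ** transpose (F t) = ?B ** hat (transpose ?B *v \<xi>)"
  proof -
    have "transpose ?B ** hat \<xi> ** transpose (transpose ?B) = hat (transpose ?B *v \<xi>)"
      using hat_conjugate[of "transpose ?B" \<xi>] rotation_matrix_transpose[OF rot[of t]]
      by (simp add: rotation_matrix_def)
    then have "?B ** hat (transpose ?B *v \<xi>) = ?B ** (transpose ?B ** hat \<xi> ** ?B)"
      by (simp only: transpose_transpose)
    also have "\<dots> = (?B ** transpose ?B) ** hat \<xi> ** ?B"
      by (simp only: matrix_mul_assoc)
    also have "\<dots> = hat \<xi> ** ?B"
      using rot[of t] by (simp add: rotation_matrix_def orthogonal_matrix_def)
    finally show ?thesis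
      by (simp only: matrix_mul_assoc)
  qed
  have e1: "E t ** B ** transpose ((\<eta> *\<^sub>R hat e1) ** F t) = ?B ** hat (- \<eta> *\<^sub>R e1)"
    by (simp add: matrix_transpose_mul transpose_hat matrix_mult_minus matrix_mult_scaleR
        linear_scale[OF bounded_linear.linear[OF bounded_linear_transpose]]
        linear_scale[OF bounded_linear.linear[OF bounded_linear_hat]]
        linear_neg[OF bounded_linear.linear[OF bounded_linear_hat]] matrix_mul_assoc)
  have e3: "?B ** hat (- \<eta> *\<^sub>R e1) + ?B ** hat (transpose ?B *v \<xi>) =
     ?B ** hat (transpose ?B *v \<xi> - \<eta> *\<^sub>R e1)"
    by (simp add: linear_diff[OF bounded_linear.linear[OF bounded_linear_hat]]
        linear_neg[OF bounded_linear.linear[OF bounded_linear_hat]] matrix_mult_minus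
        bounded_bilinear.diff_right[OF bounded_bilinear_matrix_mult])
  have 1: "((\<lambda>t. E t ** B ** transpose (F t)) has_vector_derivative
     ?B ** hat (transpose ?B *v \<xi> - \<eta> *\<^sub>R e1)) (at t)"
    using d unfolding e1 e2 e3 .
  have 2: "((\<lambda>t. F t *v x) has_vector_derivative \<eta> *\<^sub>R (e1 \<times> (F t *v x))) (at t)" for x
    using matrix_vector_vderiv[OF F' has_vector_derivative_const[of x], of t]
    by (simp add: matrix_vector_scaleR matrix_mult_scaleR flip: matrix_vector_mul_assoc)
  show "phase_velocity c ((transpose ?B *v \<xi> - \<eta> *\<^sub>R e1,
         \<eta> *\<^sub>R (e1 \<times> (F t *v r))), (\<eta> *\<^sub>R (e1 \<times> (F t *v \<Lambda>)), \<eta> *\<^sub>R (e1 \<times> (F t *v P)))) t"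
    unfolding phase_velocity_def config_velocity_def c
    using 1 by (auto intro!: has_vector_derivative_Pair 2)
qed

lemma generator_TQ_eq:
  assumes "rotation_matrix B"
  shows "generator_TQ (\<xi>, \<eta>) ((B, r), (\<Lambda>, P)) =
    ((transpose B *v \<xi> - \<eta> *\<^sub>R e1, \<eta> *\<^sub>R (e1 \<times> r)), (\<eta> *\<^sub>R (e1 \<times> \<Lambda>), \<eta> *\<^sub>R (e1 \<times> P)))"
  unfolding generator_TQ_def
proof (rule the_equality)
  show v: "phase_velocity (\<lambda>t. cotangent_lift (one_param (\<xi>, \<eta>) t) ((B, r), (\<Lambda>, P)))
    ((transpose B *v \<xi> - \<eta> *\<^sub>R e1, \<eta> *\<^sub>R (e1 \<times> r)), (\<eta> *\<^sub>R (e1 \<times> \<Lambda>), \<eta> *\<^sub>R (e1 \<times> P))) 0"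
    using one_param_curve(5)[OF assms, where t = 0, of \<xi> \<eta> r \<Lambda> P] by simp
  show "w = ((transpose B *v \<xi> - \<eta> *\<^sub>R e1, \<eta> *\<^sub>R (e1 \<times> r)), (\<eta> *\<^sub>R (e1 \<times> \<Lambda>), \<eta> *\<^sub>R (e1 \<times> P)))"
    if "phase_velocity (\<lambda>t. cotangent_lift (one_param (\<xi>, \<eta>) t) ((B, r), (\<Lambda>, P))) w 0" for w
    using phase_velocity_unique[OF that v] assms one_param_curve(1)[OF assms, where t = 0, of \<xi> \<eta> r \<Lambda> P]
    by (simp add: rotation_matrix_def)
qed

section \<open>Hyperbolic relative equilibria\<close>

lemma cross_cross_orthogonal:
  fixes r \<xi> :: "real^3"
  assumes "r \<bullet> \<xi> = 0"
  shows "r \<times> (\<xi> \<times> r) = (r \<bullet> r) *\<^sub>R \<xi>" "(\<xi> \<times> r) \<times> \<xi> = (\<xi> \<bullet> \<xi>) *\<^sub>R r"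
  using assms by (simp_all add: Lagrange inner_commute cross_skew[of "\<xi> \<times> r"])

text \<open>The spin momentum is \<open>I2 *\<^sub>R \<xi>\<close>, and \<eta> is the value for
  which it belongs to the angular velocity \<open>\<xi> - \<eta> *\<^sub>R e1\<close>. The value of
  \<open>\<xi> \<bullet> \<xi>\<close> balances attraction and centrifugal force. The right-hand
  side is the generator of the action wherever \<open>transpose B\<close> fixes the relation between
  body and spatial \<xi>; here \<xi> is the body vector.\<close>

lemma hamiltonian2_field_equilibrium:
  fixes r \<xi> :: "real^3"
  assumes "I1 > 0" "I2 > 0" "r \<noteq> 0" "r \<bullet> \<xi> = 0" "r $ 1 = 0"
    and k: "\<xi> \<bullet> \<xi> = (1 / norm r) ^ 3 - 3 / 2 * (3 * I2 - 1) * (1 / norm r) ^ 5"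
    and \<eta>: "\<eta> = - ((I2 - I1) / I1) * \<xi> $ 1"
  defines "\<Lambda> \<equiv> (I2 + r \<bullet> r) *\<^sub>R \<xi>" and "P \<equiv> \<xi> \<times> r"
  shows "hamiltonian_field (hamiltonian2 I1 I2) ((B, r), (\<Lambda>, P)) =
    ((\<xi> - \<eta> *\<^sub>R e1, \<eta> *\<^sub>R (e1 \<times> r)), (\<eta> *\<^sub>R (e1 \<times> \<Lambda>), \<eta> *\<^sub>R (e1 \<times> P)))"
proof -
  have "\<Lambda> - r \<times> P = I2 *\<^sub>R \<xi>"
    by (simp add: \<Lambda>_def P_def cross_cross_orthogonal assms algebra_simps)
  then have "body_velocity I1 I2 ((B, r), (\<Lambda>, P)) = inv_inertia I1 I2 (I2 *\<^sub>R \<xi>)"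
    by (simp only: body_velocity_def fst_conv snd_conv)
  also have "\<dots> = \<xi> - \<eta> *\<^sub>R e1"
    using assms(1,2) by (simp add: inv_inertia_def vec3_simps \<eta> field_simps)
  finally have \<Omega>: "body_velocity I1 I2 ((B, r), (\<Lambda>, P)) = \<xi> - \<eta> *\<^sub>R e1" .
  have "P + r \<times> (\<xi> - \<eta> *\<^sub>R e1) = \<eta> *\<^sub>R (e1 \<times> r)"
    "\<Lambda> \<times> (\<xi> - \<eta> *\<^sub>R e1) = \<eta> *\<^sub>R (e1 \<times> \<Lambda>)"
    by (simp_all add: P_def \<Lambda>_def vec3_simps algebra_simps)
  moreover have "P \<times> (\<xi> - \<eta> *\<^sub>R e1) - force I1 I2 (1 / norm r) r = \<eta> *\<^sub>R (e1 \<times> P)"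
  proof -
    have "P \<times> (\<xi> - \<eta> *\<^sub>R e1) = (\<xi> \<bullet> \<xi>) *\<^sub>R r + \<eta> *\<^sub>R (e1 \<times> P)"
      using cross_cross_orthogonal(2)[OF assms(4)]
      by (simp add: P_def Cross3.right_diff_distrib cross_mult_right cross_skew[of _ e1])
    moreover have "force I1 I2 (1 / norm r) r = (\<xi> \<bullet> \<xi>) *\<^sub>R r"
      by (simp add: force_def k assms(5))
    ultimately show ?thesis by simp
  qed
  ultimately show ?thesis
    using assms(1-3) by (simp add: hamiltonian2_field \<Omega>)
qed

lemma point_of_eq:
  fixes r \<xi> :: "real^3"
  assumes "I1 > 0" "r \<bullet> \<xi> = 0" "\<eta> = - ((I2 - I1) / I1) * \<xi> $ 1"
  shows "point_of I1 I2 (mat 1, r) (\<xi>, \<eta>) = ((mat 1, r), ((I2 + r \<bullet> r) *\<^sub>R \<xi>, \<xi> \<times> r))"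
proof -
  have "\<eta> *\<^sub>R (e1 \<times> r) + (\<xi> - \<eta> *\<^sub>R e1) \<times> r = \<xi> \<times> r"
    by (simp add: Cross3.left_diff_distrib cross_mult_left)
  moreover have "axi_inertia I1 I2 *v (\<xi> - \<eta> *\<^sub>R e1) = I2 *\<^sub>R \<xi>"
    using assms(1) by (simp add: axi_inertia_mult vec3_simps assms(3) field_simps)
  ultimately show ?thesis
    by (simp add: point_of_def generator_Q_def legendre_eq transpose_mat
        cross_cross_orthogonal[OF assms(2)] algebra_simps)
qed

text \<open>Along the orbit the body vectors are turned by \<open>F t\<close>, a rotation about
  \<open>e1\<close>. It preserves inner products and axial coordinates, hence all hypotheses of the
  pointwise computation, which therefore applies at each time.\<close>

lemma relative_equilibrium_hyperbolic:
  fixes r \<xi> :: "real^3"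
  assumes "I1 > 0" "I2 > 0" "r \<noteq> 0" "r \<bullet> \<xi> = 0" "r $ 1 = 0"
    and k: "\<xi> \<bullet> \<xi> = (1 / norm r) ^ 3 - 3 / 2 * (3 * I2 - 1) * (1 / norm r) ^ 5"
    and \<eta>: "\<eta> = - ((I2 - I1) / I1) * \<xi> $ 1"
  shows "relative_equilibrium I1 I2 ((mat 1, r), ((I2 + r \<bullet> r) *\<^sub>R \<xi>, \<xi> \<times> r)) (\<xi>, \<eta>)"
proof -
  define E where "E = (\<lambda>t. mat_exp (t *\<^sub>R hat \<xi>))"
  define F where "F = (\<lambda>t. mat_exp ((t * \<eta>) *\<^sub>R hat e1))"
  let ?p = "((mat 1, r), ((I2 + r \<bullet> r) *\<^sub>R \<xi>, \<xi> \<times> r)) :: phase"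
  let ?c = "\<lambda>t. cotangent_lift (one_param (\<xi>, \<eta>) t) ?p"
  have rot1: "rotation_matrix (mat 1 :: real^3^3)"
    by (simp add: rotation_matrix_def orthogonal_matrix_id)
  have E_eq: "mat_exp (t *\<^sub>R hat \<xi>) = E t" and F_eq: "mat_exp ((t * \<eta>) *\<^sub>R hat e1) = F t" for t
    by (simp_all add: E_def F_def)
  note cu = one_param_curve(1,5)[OF rot1, where \<xi> = \<xi> and \<eta> = \<eta> and r = r
      and \<Lambda> = "(I2 + r \<bullet> r) *\<^sub>R \<xi>" and P = "\<xi> \<times> r", unfolded E_eq F_eq]
  have "?c t \<in> phase_space \<and> phase_velocity ?c (hamiltonian_field (hamiltonian2 I1 I2) (?c t)) t" for t
  proof
    define B where "B = E t ** mat 1 ** transpose (F t)"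
    have F: "rotation_matrix (F t)" and E: "rotation_matrix (E t)" and B: "rotation_matrix B"
      unfolding B_def E_def F_def
      by (intro rotation_matrix_mult rotation_matrix_transpose rotation_mat_exp rot1)+
    have oF: "orthogonal_matrix (F t)" and oE: "orthogonal_matrix (E t)"
      using F E by (simp_all add: rotation_matrix_def)
    have c: "?c t = ((B, F t *v r), ((I2 + r \<bullet> r) *\<^sub>R (F t *v \<xi>), (F t *v \<xi>) \<times> (F t *v r)))"
      using cu(1)[of t] by (simp add: B_def matrix_vector_scaleR cross_rotation_matrix[OF F])
    have inner: "(F t *v x) \<bullet> (F t *v y) = x \<bullet> y" for x y
      by (rule orthogonal_matrix_inner[OF oF])
    have n: "norm (F t *v r) = norm r"
      by (simp add: norm_eq_sqrt_inner inner)
    have first: "(F t *v x) $ 1 = x $ 1" for x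
      using inner[of e1 x] mat_exp_hat_fixes[of "t * \<eta>" e1] by (simp add: F_def)
    have "transpose (E t) *v \<xi> = \<xi>"
      using orthogonal_matrix_vec_inverse(2)[OF oE, of \<xi>] mat_exp_hat_fixes[of t \<xi>] by (simp add: E_def)
    then have B\<xi>: "transpose B *v \<xi> = F t *v \<xi>"
      by (simp add: B_def matrix_transpose_mul flip: matrix_vector_mul_assoc)
    have r0: "F t *v r \<noteq> 0"
      using n assms(3) by auto
    then show "?c t \<in> phase_space"
      using B by (simp add: c phase_space_def config_space_def)
    have "hamiltonian_field (hamiltonian2 I1 I2) (?c t) =
      ((F t *v \<xi> - \<eta> *\<^sub>R e1, \<eta> *\<^sub>R (e1 \<times> (F t *v r))), (\<eta> *\<^sub>R (e1 \<times> ((I2 + r \<bullet> r) *\<^sub>R (F t *v \<xi>))),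
        \<eta> *\<^sub>R (e1 \<times> ((F t *v \<xi>) \<times> (F t *v r)))))"
      unfolding c
      by (rule hamiltonian2_field_equilibrium[OF assms(1,2) r0, of "F t *v \<xi>" \<eta> B,
          unfolded inner first n, OF assms(4-7)])
    then show "phase_velocity ?c (hamiltonian_field (hamiltonian2 I1 I2) (?c t)) t"
      using cu(2)[of t] B\<xi> by (simp add: B_def matrix_vector_scaleR cross_rotation_matrix[OF F])
  qed
  then show ?thesis
    unfolding relative_equilibrium_def evolution_def
    using rot1 assms(3) by (auto simp: phase_space_def config_space_def)
qed

section \<open>Linear instability\<close>

lemma inverse_norm_line_deriv:
  fixes r :: "real^3"
  assumes "r \<noteq> 0"
  shows "((\<lambda>t. 1 / norm (r + t *\<^sub>R \<rho>)) has_real_derivative - (r \<bullet> \<rho>) * (1 / norm r) ^ 3) (at 0)"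
  using inverse_norm_deriv[OF line_deriv[of r \<rho> 0]] assms by simp

text \<open>This is the Hessian of the potential at a point of the equatorial plane. There the term
  with the squared axial coordinate vanishes to second order and leaves no trace.\<close>

lemma force_line_deriv:
  fixes r :: "real^3"
  assumes "r \<noteq> 0" "r $ 1 = 0"
  defines "i \<equiv> 1 / norm r"
  shows "((\<lambda>t. force I1 I2 (1 / norm (r + t *\<^sub>R \<rho>)) (r + t *\<^sub>R \<rho>)) has_vector_derivative
    (i ^ 3 - 3 / 2 * (3 * I2 - 1) * i ^ 5) *\<^sub>R \<rho>
    + ((15 / 2 * (3 * I2 - 1) * i ^ 7 - 3 * i ^ 5) * (r \<bullet> \<rho>)) *\<^sub>R r
    + (3 * (I1 - I2) * i ^ 5 * \<rho> $ 1) *\<^sub>R e1) (at 0)"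
proof -
  define f where "f = (\<lambda>t. 1 / norm (r + t *\<^sub>R \<rho>))"
  have f: "(f has_real_derivative - (r \<bullet> \<rho>) * i ^ 3) (at 0)" and f0: "f 0 = i"
    using inverse_norm_line_deriv[OF assms(1), of \<rho>] by (simp_all add: f_def i_def)
  have 1: "((\<lambda>t. f t ^ 3 - 3 / 2 * (3 * I2 - 1) * f t ^ 5
      - 15 / 2 * (I1 - I2) * (t * \<rho> $ 1)\<^sup>2 * f t ^ 7) has_real_derivative
      (15 / 2 * (3 * I2 - 1) * i ^ 7 - 3 * i ^ 5) * (r \<bullet> \<rho>)) (at 0)"
    by (rule derivative_eq_intros f refl)+ (simp add: f0 algebra_simps eval_nat_numeral)
  have 2: "((\<lambda>t. 3 * (I1 - I2) * (t * \<rho> $ 1) * f t ^ 5) has_real_derivative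
      3 * (I1 - I2) * i ^ 5 * \<rho> $ 1) (at 0)"
    by (rule derivative_eq_intros f refl)+ (simp add: f0 algebra_simps eval_nat_numeral)
  have "((\<lambda>t. (f t ^ 3 - 3 / 2 * (3 * I2 - 1) * f t ^ 5
      - 15 / 2 * (I1 - I2) * (t * \<rho> $ 1)\<^sup>2 * f t ^ 7) *\<^sub>R (r + t *\<^sub>R \<rho>)
      + (3 * (I1 - I2) * (t * \<rho> $ 1) * f t ^ 5) *\<^sub>R e1) has_vector_derivative
    ((f 0 ^ 3 - 3 / 2 * (3 * I2 - 1) * f 0 ^ 5
      - 15 / 2 * (I1 - I2) * (0 * \<rho> $ 1)\<^sup>2 * f 0 ^ 7) *\<^sub>R \<rho>
     + ((15 / 2 * (3 * I2 - 1) * i ^ 7 - 3 * i ^ 5) * (r \<bullet> \<rho>)) *\<^sub>R (r + 0 *\<^sub>R \<rho>))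
    + ((3 * (I1 - I2) * (0 * \<rho> $ 1) * f 0 ^ 5) *\<^sub>R 0 + (3 * (I1 - I2) * i ^ 5 * \<rho> $ 1) *\<^sub>R e1)) (at 0)"
    by (intro has_vector_derivative_add has_vector_derivative_scaleR 1 2 line_deriv has_vector_derivative_const)
  then show ?thesis
    by (simp add: force_def f_def assms(2) i_def)
qed

text \<open>\<open>\<omega>\<close> is the variation of the body velocity and \<open>b\<close> that
  of the attitude. The vectors added to \<open>\<phi>\<close> and subtracted at the end are the
  orbital coupling and the Hessian of the potential.\<close>

lemma linearization_eq:
  fixes r \<Lambda> P \<xi> :: "real^3"
  assumes "I1 \<noteq> 0" "I2 \<noteq> 0" "r \<noteq> 0" "r $ 1 = 0"
  defines "i \<equiv> 1 / norm r" and "\<Omega> \<equiv> inv_inertia I1 I2 (\<Lambda> - r \<times> P)"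
  defines "\<omega> \<equiv> \<lambda>\<rho> \<pi> \<phi>. inv_inertia I1 I2 (\<pi> - (r \<times> \<phi> + \<rho> \<times> P))"
  shows "linearization I1 I2 (\<xi>, \<eta>) ((mat 1, r), (\<Lambda>, P)) ((b, \<rho>), (\<pi>, \<phi>)) =
   ((\<omega> \<rho> \<pi> \<phi> + b \<times> \<xi>, \<phi> + (r \<times> \<omega> \<rho> \<pi> \<phi> + \<rho> \<times> \<Omega>) - \<eta> *\<^sub>R (e1 \<times> \<rho>)),
    (\<Lambda> \<times> \<omega> \<rho> \<pi> \<phi> + \<pi> \<times> (\<Omega> + \<eta> *\<^sub>R e1), P \<times> \<omega> \<rho> \<pi> \<phi> + \<phi> \<times> (\<Omega> + \<eta> *\<^sub>R e1)
     - ((i ^ 3 - 3 / 2 * (3 * I2 - 1) * i ^ 5) *\<^sub>R \<rho>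
       + ((15 / 2 * (3 * I2 - 1) * i ^ 7 - 3 * i ^ 5) * (r \<bullet> \<rho>)) *\<^sub>R r
       + (3 * (I1 - I2) * i ^ 5 * \<rho> $ 1) *\<^sub>R e1)))"
proof -
  let ?F = "hamiltonian_field (\<lambda>z. hamiltonian2 I1 I2 z - momentum z \<bullet> (\<xi>, \<eta>))"
  let ?c = "phase_curve ((mat 1, r), (\<Lambda>, P)) ((b, \<rho>), (\<pi>, \<phi>))"
  define W where "W = (\<lambda>t. inv_inertia I1 I2 (\<Lambda> + t *\<^sub>R \<pi> - (r + t *\<^sub>R \<rho>) \<times> (P + t *\<^sub>R \<phi>)))"
  define G where "G = (\<lambda>t.
    ((W t - transpose (mat_exp (t *\<^sub>R hat b)) *v \<xi> + \<eta> *\<^sub>R e1,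
      P + t *\<^sub>R \<phi> + (r + t *\<^sub>R \<rho>) \<times> W t - \<eta> *\<^sub>R (e1 \<times> (r + t *\<^sub>R \<rho>))),
     ((\<Lambda> + t *\<^sub>R \<pi>) \<times> (W t + \<eta> *\<^sub>R e1), (P + t *\<^sub>R \<phi>) \<times> (W t + \<eta> *\<^sub>R e1)
       - force I1 I2 (1 / norm (r + t *\<^sub>R \<rho>)) (r + t *\<^sub>R \<rho>))))"
  \<comment> \<open>The closed form of the field holds off collisions, so it describes the curve
    only for small \<open>t\<close>; this is enough for a derivative at 0.\<close>
  have ev: "\<forall>\<^sub>F t in nhds 0. ?F (?c t) = G t"
  proof -
    have "isCont (\<lambda>t. r + t *\<^sub>R \<rho>) 0"
      by (intro continuous_intros)
    then have "((\<lambda>t. r + t *\<^sub>R \<rho>) \<longlongrightarrow> r + 0 *\<^sub>R \<rho>) (nhds 0)"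
      using tendsto_at_iff_tendsto_nhds[of "\<lambda>t. r + t *\<^sub>R \<rho>" 0] unfolding continuous_at by blast
    then have "\<forall>\<^sub>F t in nhds 0. r + t *\<^sub>R \<rho> \<noteq> 0"
      using assms(3) by (intro tendsto_imp_eventually_ne) auto
    then show ?thesis
      by (rule eventually_mono)
        (simp add: phase_curve_eq augmented_hamiltonian_field[OF assms(1,2)] G_def W_def body_velocity_def)
  qed
  have W: "(W has_vector_derivative \<omega> \<rho> \<pi> \<phi>) (at 0)"
  proof -
    have "((\<lambda>t. \<Lambda> + t *\<^sub>R \<pi> - (r + t *\<^sub>R \<rho>) \<times> (P + t *\<^sub>R \<phi>)) has_vector_derivative
      \<pi> - ((r + 0 *\<^sub>R \<rho>) \<times> \<phi> + \<rho> \<times> (P + 0 *\<^sub>R \<phi>))) (at 0)"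
      by (intro has_vector_derivative_diff cross_vderiv line_deriv)
    from bounded_linear.has_vector_derivative[OF bounded_linear_inv_inertia this]
    show ?thesis by (simp add: W_def \<omega>_def)
  qed
  have W0: "W 0 = \<Omega>" by (simp add: W_def \<Omega>_def)
  have T: "((\<lambda>t. transpose (mat_exp (t *\<^sub>R hat b)) *v \<xi>) has_vector_derivative - (b \<times> \<xi>)) (at 0)"
  proof -
    have "((\<lambda>t. transpose (mat_exp (t *\<^sub>R hat b)) *v \<xi>) has_vector_derivative
        transpose (mat_exp (0 *\<^sub>R hat b)) *v 0 + transpose (hat b) *v \<xi>) (at 0)"
      by (intro matrix_vector_vderiv has_vector_derivative_const mat_exp_vderiv_0
          bounded_linear.has_vector_derivative[OF bounded_linear_transpose])
    moreover have "(- hat b) *v \<xi> = - (b \<times> \<xi>)"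
      using bounded_bilinear.minus_left[OF bounded_bilinear_matrix_vector, of "hat b" \<xi>] by simp
    ultimately show ?thesis
      by (simp add: transpose_hat)
  qed
  have WE: "((\<lambda>t. W t + \<eta> *\<^sub>R e1) has_vector_derivative \<omega> \<rho> \<pi> \<phi>) (at 0)"
    using has_vector_derivative_add[OF W has_vector_derivative_const] by simp
  have C: "((\<lambda>t. \<eta> *\<^sub>R (e1 \<times> (r + t *\<^sub>R \<rho>))) has_vector_derivative \<eta> *\<^sub>R (e1 \<times> \<rho>)) (at 0)"
    by (intro bounded_linear.has_vector_derivative[OF bounded_linear_scaleR_right]
        bounded_linear.has_vector_derivative[OF bounded_bilinear.bounded_linear_right[OF bounded_bilinear_cross3]]
        line_deriv)
  have "(G has_vector_derivative
    ((\<omega> \<rho> \<pi> \<phi> - - (b \<times> \<xi>) + 0,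
      \<phi> + ((r + 0 *\<^sub>R \<rho>) \<times> \<omega> \<rho> \<pi> \<phi> + \<rho> \<times> W 0) - \<eta> *\<^sub>R (e1 \<times> \<rho>)),
     ((\<Lambda> + 0 *\<^sub>R \<pi>) \<times> \<omega> \<rho> \<pi> \<phi> + \<pi> \<times> (W 0 + \<eta> *\<^sub>R e1),
      (P + 0 *\<^sub>R \<phi>) \<times> \<omega> \<rho> \<pi> \<phi> + \<phi> \<times> (W 0 + \<eta> *\<^sub>R e1)
     - ((i ^ 3 - 3 / 2 * (3 * I2 - 1) * i ^ 5) *\<^sub>R \<rho>
       + ((15 / 2 * (3 * I2 - 1) * i ^ 7 - 3 * i ^ 5) * (r \<bullet> \<rho>)) *\<^sub>R r
       + (3 * (I1 - I2) * i ^ 5 * \<rho> $ 1) *\<^sub>R e1)))) (at 0)"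
    unfolding G_def i_def
    by (intro has_vector_derivative_Pair has_vector_derivative_add has_vector_derivative_diff
        has_vector_derivative_const cross_vderiv line_deriv W WE T C force_line_deriv assms(3,4))
  then have d: "(G has_vector_derivative
   ((\<omega> \<rho> \<pi> \<phi> + b \<times> \<xi>, \<phi> + (r \<times> \<omega> \<rho> \<pi> \<phi> + \<rho> \<times> \<Omega>) - \<eta> *\<^sub>R (e1 \<times> \<rho>)),
    (\<Lambda> \<times> \<omega> \<rho> \<pi> \<phi> + \<pi> \<times> (\<Omega> + \<eta> *\<^sub>R e1), P \<times> \<omega> \<rho> \<pi> \<phi> + \<phi> \<times> (\<Omega> + \<eta> *\<^sub>R e1)
     - ((i ^ 3 - 3 / 2 * (3 * I2 - 1) * i ^ 5) *\<^sub>R \<rho>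
       + ((15 / 2 * (3 * I2 - 1) * i ^ 7 - 3 * i ^ 5) * (r \<bullet> \<rho>)) *\<^sub>R r
       + (3 * (I1 - I2) * i ^ 5 * \<rho> $ 1) *\<^sub>R e1)))) (at 0)"
    by (simp add: W0)
  have "((\<lambda>t. ?F (?c t)) has_vector_derivative
   ((\<omega> \<rho> \<pi> \<phi> + b \<times> \<xi>, \<phi> + (r \<times> \<omega> \<rho> \<pi> \<phi> + \<rho> \<times> \<Omega>) - \<eta> *\<^sub>R (e1 \<times> \<rho>)),
    (\<Lambda> \<times> \<omega> \<rho> \<pi> \<phi> + \<pi> \<times> (\<Omega> + \<eta> *\<^sub>R e1), P \<times> \<omega> \<rho> \<pi> \<phi> + \<phi> \<times> (\<Omega> + \<eta> *\<^sub>R e1)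
     - ((i ^ 3 - 3 / 2 * (3 * I2 - 1) * i ^ 5) *\<^sub>R \<rho>
       + ((15 / 2 * (3 * I2 - 1) * i ^ 7 - 3 * i ^ 5) * (r \<bullet> \<rho>)) *\<^sub>R r
       + (3 * (I1 - I2) * i ^ 5 * \<rho> $ 1) *\<^sub>R e1)))) (at 0)"
    unfolding has_vector_derivative_def
    by (rule has_derivative_transform_eventually[OF d[unfolded has_vector_derivative_def]])
      (use ev eventually_nhds_x_imp_x[OF ev] in \<open>auto simp: eventually_at_filter elim: eventually_mono\<close>)
  then show ?thesis
    unfolding linearization_def deriv_along_def by (rule vector_derivative_at)
qed

text \<open>The root \<open>z\<close> is the square of an eigenvalue: in a frame rotating with \<open>\<xi>\<close> the linearized
  equations on the symplectic slice reduce to one equation for the variation of \<open>R \<bullet> e1\<close>,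
  with \<open>k = norm \<xi>\<close>, \<open>g\<close> and \<open>h\<close> the coefficients of the Hessian of the potential, and
  \<open>N = 1 + R\<^sup>2 / I2\<close>.\<close>

lemma characteristic_root:
  fixes k s c g h N :: real
  assumes sc: "s\<^sup>2 + c\<^sup>2 = 1" and "c \<noteq> 0" "g < 0" "N > 0" and W: "N * (h + 4 * k\<^sup>2) > 4 * k\<^sup>2"
  obtains z where "z > 0" "z + z * (N * s\<^sup>2 * g) / (z + k\<^sup>2) + N * g * c\<^sup>2
     - 4 * k\<^sup>2 * g * c\<^sup>2 / (z + h + 4 * k\<^sup>2) = 0" "h + 4 * k\<^sup>2 > 0"
proof -
  have H: "h + 4 * k\<^sup>2 > 0"
    using W assms(4) by (smt (verit) mult_nonneg_nonpos zero_le_power2)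
  define f where "f = (\<lambda>z. z + z * (N * s\<^sup>2 * g) / (z + k\<^sup>2) + N * g * c\<^sup>2
     - 4 * k\<^sup>2 * g * c\<^sup>2 / (z + h + 4 * k\<^sup>2))"
  have "\<exists>z>0. f z = 0"
  \<comment> \<open>For \<open>k = 0\<close> the first fraction jumps at \<open>z = 0\<close>, where
    it is 0 by the convention on division. Continuity fails there, but for positive \<open>z\<close>
    the equation is linear with root \<open>- N * g\<close>.\<close>
  proof (cases "k = 0")
    case True
    then have "f (- N * g) = - N * g + N * g * (s\<^sup>2 + c\<^sup>2)"
      using assms(3,4) by (simp add: f_def algebra_simps)
    then show ?thesis
      using sc assms(3,4) by (intro exI[of _ "- N * g"]) (simp add: mult_pos_neg)
  next
    case False
    \<comment> \<open>Here the second variation decides: with \<open>g < 0\<close> and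
      \<open>c\<close> nonzero, the hypothesis on \<open>N * (h + 4 * k^2)\<close> makes this value
      negative.\<close>
    have "f 0 = g * c\<^sup>2 * (N * (h + 4 * k\<^sup>2) - 4 * k\<^sup>2) / (h + 4 * k\<^sup>2)"
      using H by (simp add: f_def field_simps)
    moreover have "g * c\<^sup>2 * (N * (h + 4 * k\<^sup>2) - 4 * k\<^sup>2) < 0"
      using assms(2,3) W by (intro mult_neg_pos) (simp_all add: mult_neg_pos)
    ultimately have f0: "f 0 < 0"
      using H by (simp add: divide_neg_pos)
    \<comment> \<open>For nonnegative \<open>z\<close> the value \<open>f z\<close> is at least
      \<open>z + N * g\<close>, because \<open>g < 0\<close>; so it is at least 1 at this
      point.\<close>
    define Z where "Z = 1 - N * g"
    have Z: "Z > 0" using mult_pos_neg[OF assms(4,3)] by (simp add: Z_def)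
    have "Z * (N * s\<^sup>2 * g) / (Z + k\<^sup>2) \<ge> N * s\<^sup>2 * g"
    proof -
      have "N * s\<^sup>2 * g \<le> 0"
        using assms(3,4) by (simp add: mult_nonneg_nonpos)
      moreover have "Z / (Z + k\<^sup>2) \<le> 1" "Z / (Z + k\<^sup>2) \<ge> 0"
        using Z by (simp_all add: divide_le_eq_1 add_pos_nonneg)
      ultimately have "1 * (N * s\<^sup>2 * g) \<le> Z / (Z + k\<^sup>2) * (N * s\<^sup>2 * g)"
        by (intro mult_right_mono_neg)
      then show ?thesis by simp
    qed
    moreover have "4 * k\<^sup>2 * g * c\<^sup>2 / (Z + h + 4 * k\<^sup>2) \<le> 0"
      using assms(3) H Z by (intro divide_nonpos_pos) (simp_all add: mult_nonneg_nonpos mult_nonpos_nonneg)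
    ultimately have "f Z \<ge> Z + N * g * (s\<^sup>2 + c\<^sup>2)"
      by (simp add: f_def algebra_simps)
    then have "f Z > 0" using sc by (simp add: Z_def)
    moreover have "continuous_on {0..Z} f"
      unfolding f_def using False H by (intro continuous_intros) (auto simp: add_nonneg_eq_0_iff)
    ultimately obtain z where "0 \<le> z" "z \<le> Z" "f z = 0"
      using IVT'[of f 0 0 Z] f0 Z by auto
    then show ?thesis using f0 by (intro exI[of _ z]) (auto simp: less_le)
  qed
  then show ?thesis using that H by (auto simp: f_def)
qed

text \<open>\<open>u\<close> is the variation of the spatial position in the rotating frame. The
  first three equations are the components of the orbital equation with its Coriolis and centripetal
  terms, normalised so that the variation of the axial coordinate in the body is 1; the fourth is an
  angular momentum balance. In the plane of \<xi> and \<open>e1\<close> write \<open>w\<close> for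
  the component of \<open>u\<close> along \<xi> and \<open>v\<close> for the transverse one:
  \<open>w\<close> obeys a scalar equation, while \<open>v\<close> and \<open>u2\<close> are coupled
  by the Coriolis terms alone.\<close>

lemma slice_eigenvector:
  fixes k s c g h N :: real
  assumes sc: "s\<^sup>2 + c\<^sup>2 = 1" and "c \<noteq> 0" "g < 0" "N > 0" and W: "N * (h + 4 * k\<^sup>2) > 4 * k\<^sup>2"
  obtains l u1 u2 u3 where "l > 0"
    "2 * l * (k * c) * u2 - (k * s) * (k * s * u1 + k * c * u3) - l\<^sup>2 * u1 - g = 0"
    "- 2 * l * (k * c * u1 - k * s * u3) - (l\<^sup>2 + h) * u2 = 0"
    "- 2 * l * (k * s) * u2 - (k * c) * (k * s * u1 + k * c * u3) - l\<^sup>2 * u3 = 0"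
    "l = N * l * u1 - 2 * (N - 1) * (k * c) * u2"
proof -
  obtain z where z: "z > 0" and H: "h + 4 * k\<^sup>2 > 0"
    and f: "z + z * (N * s\<^sup>2 * g) / (z + k\<^sup>2) + N * g * c\<^sup>2 - 4 * k\<^sup>2 * g * c\<^sup>2 / (z + h + 4 * k\<^sup>2) = 0"
    by (rule characteristic_root[OF assms])
  define l where "l = sqrt z"
  define w where "w = - g * s / (z + k\<^sup>2)"
  define u2 where "u2 = 2 * k * g * c / (l * (z + h + 4 * k\<^sup>2))"
  define v where "v = (g * c / l - 2 * k * u2) / l"
  define u1 where "u1 = s * w - c * v"
  define u3 where "u3 = c * w + s * v"
  have l: "l > 0" "l\<^sup>2 = z" using z by (simp_all add: l_def)
  have zk: "z + k\<^sup>2 > 0" using z by (simp add: add_pos_nonneg)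
  have a: "(l\<^sup>2 + k\<^sup>2) * w = - g * s" using zk l by (simp add: w_def)
  have lu2: "l * u2 * (z + h + 4 * k\<^sup>2) = 2 * k * g * c" using l H z by (simp add: u2_def)
  have cc: "l\<^sup>2 * v + 2 * k * l * u2 = g * c"
  proof -
    have lv: "l * v = g * c / l - 2 * k * u2"
      using l(1) by (simp add: v_def)
    have "l * (l * v) = g * c - 2 * k * l * u2"
      using l(1) lv by (simp only: right_diff_distrib) simp
    then show ?thesis by (simp add: power2_eq_square)
  qed
  have "l * ((l\<^sup>2 + h) * u2) = l * (2 * k * (l * v))"
    using lu2 cc l(2) by algebra
  then have b: "(l\<^sup>2 + h) * u2 = 2 * k * (l * v)" using l by simp
  have ksc: "s * u1 + c * u3 = w" "s * u3 - c * u1 = v"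
    using sc unfolding u1_def u3_def by algebra+
  have e1: "2 * l * (k * c) * u2 - (k * s) * (k * s * u1 + k * c * u3) - l\<^sup>2 * u1 - g = 0"
    using a cc sc ksc unfolding u1_def by algebra
  have e2: "- 2 * l * (k * c * u1 - k * s * u3) - (l\<^sup>2 + h) * u2 = 0"
    using b ksc by algebra
  have e3: "- 2 * l * (k * s) * u2 - (k * c) * (k * s * u1 + k * c * u3) - l\<^sup>2 * u3 = 0"
    using a cc sc ksc unfolding u3_def by algebra
  \<comment> \<open>After multiplication by \<open>l\<close> the angular momentum balance is the
    characteristic equation for \<open>z\<close>, once \<open>w\<close> and \<open>u2\<close> are
    replaced by their quotients.\<close>
  have "l * l = l * (N * l * u1 - 2 * (N - 1) * (k * c) * u2)"
  proof -
    have w': "s * w * z = - (z * (s\<^sup>2 * g) / (z + k\<^sup>2))"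
      by (simp add: w_def power2_eq_square)
    have u': "2 * k * c * (l * u2) = 4 * k\<^sup>2 * g * c\<^sup>2 / (z + h + 4 * k\<^sup>2)"
      using H z l by (simp add: u2_def power2_eq_square)
    have "l * (N * l * u1 - 2 * (N - 1) * (k * c) * u2)
      = N * (s * w * z) - N * g * c\<^sup>2 + 2 * k * c * (l * u2)"
      using cc l(2) unfolding u1_def by algebra
    also have "\<dots> = z"
      unfolding w' u' using f by (simp add: algebra_simps)
    finally show ?thesis using l(2) by (simp add: power2_eq_square)
  qed
  then have "l = N * l * u1 - 2 * (N - 1) * (k * c) * u2" using l by simp
  then show ?thesis using that l(1) e1 e2 e3 by blast
qed

section \<open>The unstable eigenvector on the symplectic slice\<close>

lemma momentum_deriv_along:
  "deriv_along momentum ((mat 1, r), (\<Lambda>, P)) ((b, \<rho>), (\<pi>, \<phi>)) =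
    (\<pi> + b \<times> \<Lambda>, (r \<times> \<phi> + \<rho> \<times> P - \<pi>) $ 1)"
  unfolding deriv_along_def phase_curve_eq
  by (rule vector_derivative_at)
    (use momentum_deriv[OF mat_exp_vderiv_0 line_deriv line_deriv line_deriv, of "hat b" r \<rho> \<Lambda> \<pi> P \<phi>] in simp)

lemma inv_inertia_equilibrium:
  fixes r \<xi> :: "real^3"
  assumes "I1 > 0" "I2 > 0" "r \<bullet> \<xi> = 0" "\<eta> = - ((I2 - I1) / I1) * \<xi> $ 1"
  shows "inv_inertia I1 I2 ((I2 + r \<bullet> r) *\<^sub>R \<xi> - r \<times> (\<xi> \<times> r)) = \<xi> - \<eta> *\<^sub>R e1"
proof -
  have "(I2 + r \<bullet> r) *\<^sub>R \<xi> - r \<times> (\<xi> \<times> r) = I2 *\<^sub>R \<xi>"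
    by (simp add: cross_cross_orthogonal assms algebra_simps)
  moreover have "inv_inertia I1 I2 (I2 *\<^sub>R \<xi>) = \<xi> - \<eta> *\<^sub>R e1"
    using assms(1,2) by (simp add: inv_inertia_def vec3_simps assms(4) field_simps)
  ultimately show ?thesis by (simp only:)
qed

lemma linearly_unstable_hyperbolic:
  fixes r \<xi> :: "real^3"
  assumes I: "I1 > 0" "I2 > 0" "I1 < I2" and R: "R > 0" and r: "r = vector [0, R, 0]"
    and \<xi>: "\<xi> = k *\<^sub>R vector [s, 0, c]" and sc: "s\<^sup>2 + c\<^sup>2 = 1" and c: "c \<noteq> 0"
    and k: "k\<^sup>2 = (2 * R\<^sup>2 + 3 - 9 * I2) / (2 * R ^ 5)"
    and W: "2 * (R\<^sup>2)\<^sup>2 - 3 * (1 - I2) * R\<^sup>2 - 15 * (1 - 3 * I2) * I2 > 0"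
    and \<eta>: "\<eta> = - ((I2 - I1) / I1) * \<xi> $ 1"
  shows "linearly_unstable I1 I2 ((mat 1, r), ((I2 + r \<bullet> r) *\<^sub>R \<xi>, \<xi> \<times> r)) (\<xi>, \<eta>)"
proof -
  define N where "N = (I2 + R\<^sup>2) / I2"
  define g where "g = 3 * (I1 - I2) / R ^ 5"
  define h where "h = 15 / 2 * (3 * I2 - 1) / R ^ 5 - 3 / R ^ 3"
  define \<Lambda> where "\<Lambda> = (I2 + r \<bullet> r) *\<^sub>R \<xi>"
  define P where "P = \<xi> \<times> r"
  have N: "N > 0" using I by (simp add: N_def add_pos_nonneg)
  have g: "g < 0" using I R by (simp add: g_def divide_neg_pos)
  \<comment> \<open>The numerator is a positive multiple of W'' at the radius \<open>R\<close>,
    which translates \<open>W\<close> into the hypothesis on the coefficients of the slice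
    equations.\<close>
  have Weq: "N * (h + 4 * k\<^sup>2) - 4 * k\<^sup>2 =
     (2 * (R\<^sup>2)\<^sup>2 - 3 * (1 - I2) * R\<^sup>2 - 15 * (1 - 3 * I2) * I2) / (2 * R ^ 5 * I2)"
    unfolding N_def h_def k using R I
    by (simp add: divide_simps) (simp add: algebra_simps eval_nat_numeral)
  have "N * (h + 4 * k\<^sup>2) > 4 * k\<^sup>2"
  proof -
    have "(2 * (R\<^sup>2)\<^sup>2 - 3 * (1 - I2) * R\<^sup>2 - 15 * (1 - 3 * I2) * I2) / (2 * R ^ 5 * I2) > 0"
      using W R I by simp
    then show ?thesis using Weq by linarith
  qed
  from slice_eigenvector[OF sc c g N this]
  obtain l u1 u2 u3 where l: "l > 0"
    and q1: "2 * l * (k * c) * u2 - (k * s) * (k * s * u1 + k * c * u3) - l\<^sup>2 * u1 - g = 0"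
    and q2: "- 2 * l * (k * c * u1 - k * s * u3) - (l\<^sup>2 + h) * u2 = 0"
    and q3: "- 2 * l * (k * s) * u2 - (k * c) * (k * s * u1 + k * c * u3) - l\<^sup>2 * u3 = 0"
    and q4: "l = N * l * u1 - 2 * (N - 1) * (k * c) * u2"
    by metis
  define x where "x = k * s"
  define y where "y = k * c"
  have kxy: "k\<^sup>2 = x\<^sup>2 + y\<^sup>2"
    using sc unfolding x_def y_def by algebra
  \<comment> \<open>The attitude part is forced: \<open>b2\<close> solves the second component of
    the balance \<open>m\<close> below, \<open>b1\<close> makes the axial component of
    \<open>\<omega>\<close> vanish, and \<open>b3\<close> normalises \<open>\<rho> $ 1\<close> to 1.
    The facts \<open>m1\<close> and \<open>m3\<close> are the other two components of
    \<open>m\<close>.\<close>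
  define b2 where "b2 = R * (x * u1 + y * u3) / (I2 * l)"
  define b1 where "b1 = y * b2 / l"
  define b3 where "b3 = (1 - u1) / R"
  have b2: "I2 * l * b2 = R * (x * u1 + y * u3)" using l I by (simp add: b2_def)
  have b1: "l * b1 = y * b2" using l by (simp add: b1_def)
  have b3: "R * b3 = 1 - u1" using R by (simp add: b3_def)
  have l0: "l \<noteq> 0" and R0: "R \<noteq> 0" using l R by simp_all
  have m1: "- I2 * y * b2 = R * (2 * x * u2 + l * u3)"
  proof -
    have "l * (- I2 * y * b2) = l * (R * (2 * x * u2 + l * u3))"
      using b2 q3 unfolding x_def[symmetric] y_def[symmetric] by algebra
    then show ?thesis using iffD1[OF mult_left_cancel[OF l0]] by blast
  qed
  have m3: "I2 * l * b3 = R * (l * u1 - 2 * y * u2)"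
  proof -
    have IN: "I2 * N = I2 + R\<^sup>2" using I by (simp add: N_def)
    have "R * (I2 * l * b3) = R * (R * (l * u1 - 2 * y * u2))"
      using b3 q4 IN unfolding y_def[symmetric] by algebra
    then show ?thesis using iffD1[OF mult_left_cancel[OF R0]] by blast
  qed
  have rn: "norm r = R" "r \<bullet> r = R\<^sup>2"
    using R by (simp_all add: r norm_eq_sqrt_inner inner_vec_def sum_3 power2_eq_square)
  have \<xi>v: "\<xi> = vector [x, 0, y]"
    by (simp add: \<xi> x_def y_def vec_eq_iff forall_3)
  have orth: "r \<bullet> \<xi> = 0" by (simp add: r \<xi>v inner_vec_def sum_3)
  have r0: "r \<noteq> 0" using rn R by auto
  define b where "b = (vector [b1, b2, b3] :: real^3)"
  define \<rho> where "\<rho> = (vector [1, u2, u3 - R * b1] :: real^3)"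
  define \<omega> where "\<omega> = l *\<^sub>R b - b \<times> \<xi>"
  define u where "u = (vector [u1, u2, u3] :: real^3)"
  \<comment> \<open>The spatial momentum is the spatial velocity, since the mass is 1. In the
    rotating frame its variation is \<open>l *\<^sub>R u + \<xi> \<times> u\<close>, and
    \<open>b \<times> P\<close> is the share due to the varied attitude.\<close>
  define \<phi> where "\<phi> = l *\<^sub>R u + \<xi> \<times> u - b \<times> P"
  \<comment> \<open>With this choice the variation \<open>\<pi> + b \<times> \<Lambda>\<close> of
    the spatial angular momentum is 0.\<close>
  define \<pi> where "\<pi> = \<Lambda> \<times> b"
  have u\<rho>: "\<rho> = u - b \<times> r"
    using b3 by (simp add: \<rho>_def u_def b_def r vec3_simps algebra_simps)
  have m: "\<pi> - (r \<times> \<phi> + \<rho> \<times> P) = I2 *\<^sub>R \<omega>"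
    unfolding \<pi>_def \<phi>_def \<rho>_def \<omega>_def \<Lambda>_def P_def rn(2) b_def u_def r \<xi>v
    using m1 b2 m3 b3 b1
    by (simp add: vec3_simps) (intro conjI; algebra)
  have \<omega>1: "\<omega> $ 1 = 0"
    using b1 by (simp add: \<omega>_def b_def \<xi>v cross_components)
  have inv: "inv_inertia I1 I2 (\<pi> - (r \<times> \<phi> + \<rho> \<times> P)) = \<omega>"
    unfolding m using I \<omega>1 by (simp add: inv_inertia_def)
  have \<Omega>: "inv_inertia I1 I2 (\<Lambda> - r \<times> P) = \<xi> - \<eta> *\<^sub>R e1"
    unfolding \<Lambda>_def P_def by (rule inv_inertia_equilibrium[OF I(1,2) orth \<eta>])
  let ?w = "((b, \<rho>), (\<pi>, \<phi>)) :: phase_tangent"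
  let ?p = "((mat 1, r), (\<Lambda>, P)) :: phase"
  let ?A = "linearization I1 I2 (\<xi>, \<eta>) ?p"
  have lin: "?A ((b', \<rho>'), (\<pi>', \<phi>')) =
   ((inv_inertia I1 I2 (\<pi>' - (r \<times> \<phi>' + \<rho>' \<times> P)) + b' \<times> \<xi>,
     \<phi>' + r \<times> inv_inertia I1 I2 (\<pi>' - (r \<times> \<phi>' + \<rho>' \<times> P)) + \<rho>' \<times> \<xi>),
    (\<Lambda> \<times> inv_inertia I1 I2 (\<pi>' - (r \<times> \<phi>' + \<rho>' \<times> P)) + \<pi>' \<times> \<xi>,
     P \<times> inv_inertia I1 I2 (\<pi>' - (r \<times> \<phi>' + \<rho>' \<times> P)) + \<phi>' \<times> \<xi>
     - (k\<^sup>2 *\<^sub>R \<rho>' + (h / R * \<rho>' $ 2) *\<^sub>R r + (g * \<rho>' $ 1) *\<^sub>R e1)))" for b' \<rho>' \<pi>' \<phi>'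
  proof -
    have k': "(1 / R) ^ 3 - 3 / 2 * (3 * I2 - 1) * (1 / R) ^ 5 = k\<^sup>2"
      unfolding k using R by (simp add: divide_simps) (simp add: algebra_simps eval_nat_numeral)
    have h': "(15 / 2 * (3 * I2 - 1) * (1 / R) ^ 7 - 3 * (1 / R) ^ 5) * (r \<bullet> \<rho>') = h / R * \<rho>' $ 2"
      unfolding h_def r using R
      by (simp add: inner_vec_def sum_3 divide_simps) (simp add: algebra_simps eval_nat_numeral)
    have g': "3 * (I1 - I2) * (1 / R) ^ 5 * \<rho>' $ 1 = g * \<rho>' $ 1"
      by (simp add: g_def power_one_over)
    have r1: "r $ 1 = 0" by (simp add: r)
    have "\<rho>' \<times> (\<xi> - \<eta> *\<^sub>R e1) - \<eta> *\<^sub>R e1 \<times> \<rho>' = \<rho>' \<times> \<xi>"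
      by (simp add: vec3_simps algebra_simps)
    then have pe: "\<phi>' + (r \<times> v + \<rho>' \<times> (\<xi> - \<eta> *\<^sub>R e1)) - \<eta> *\<^sub>R e1 \<times> \<rho>' = \<phi>' + r \<times> v + \<rho>' \<times> \<xi>" for v
      by (simp add: algebra_simps)
    have "I1 \<noteq> 0" "I2 \<noteq> 0" using I by simp_all
    note L = linearization_eq[OF this r0 r1, of \<xi> \<eta> \<Lambda> P b' \<rho>' \<pi>' \<phi>', unfolded rn(1) k' h' g' \<Omega>]
    show ?thesis
      by (simp only: L pe diff_add_cancel)
  qed
  have E1: "\<omega> + b \<times> \<xi> = l *\<^sub>R b" by (simp add: \<omega>_def)
  have E2: "\<phi> + r \<times> \<omega> + \<rho> \<times> \<xi> = l *\<^sub>R \<rho>"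
    unfolding \<phi>_def \<omega>_def u\<rho> P_def by (simp add: vec3_simps) (intro conjI; algebra)
  have E3: "\<Lambda> \<times> \<omega> + \<pi> \<times> \<xi> = l *\<^sub>R \<pi>"
    unfolding \<pi>_def \<omega>_def \<Lambda>_def by (simp add: vec3_simps) (intro conjI; algebra)
  have E4: "P \<times> \<omega> + \<phi> \<times> \<xi> - (k\<^sup>2 *\<^sub>R \<rho> + (h / R * \<rho> $ 2) *\<^sub>R r + (g * \<rho> $ 1) *\<^sub>R e1) = l *\<^sub>R \<phi>"
  proof -
    have hr: "(h / R * \<rho> $ 2) *\<^sub>R r = vector [0, h * u2, 0]"
      using R by (simp add: r \<rho>_def vec_eq_iff forall_3)
    have hu: "h * u2 = - 2 * l * (y * u1 - x * u3) - l\<^sup>2 * u2"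
      and gu: "g = 2 * l * y * u2 - x * (x * u1 + y * u3) - l\<^sup>2 * u1"
      and u3: "l\<^sup>2 * u3 = - 2 * l * x * u2 - y * (x * u1 + y * u3)"
      and u1: "u1 = 1 - R * b3"
      using q1 q2 q3 b3 unfolding x_def[symmetric] y_def[symmetric] by algebra+
    show ?thesis
      unfolding hr unfolding kxy \<phi>_def \<omega>_def P_def \<rho>_def b_def u_def r \<xi>v hu
      unfolding gu
      using u3 unfolding u1
      by (simp add: vec3_simps) (simp add: algebra_simps power2_eq_square)
  qed
  have Aw: "?A ?w = l *\<^sub>R ?w"
    unfolding lin inv E1 E2 E3 E4 by simp
  have A0: "?A 0 = 0"
    unfolding zero_prod_def lin by (simp add: inv_inertia_def zero_prod_def)
  have rot1: "rotation_matrix (mat 1 :: real^3^3)"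
    by (simp add: rotation_matrix_def orthogonal_matrix_id)
  define K where "K = {w. deriv_along momentum ?p w = 0}"
  define W' where "W' = (\<lambda>\<zeta>'. generator_TQ \<zeta>' ?p) ` stabilizer_algebra (momentum ?p)"
  have "?w \<in> K"
  proof -
    have "(r \<times> \<phi> + \<rho> \<times> P - \<pi>) $ 1 = - (\<pi> - (r \<times> \<phi> + \<rho> \<times> P)) $ 1"
      by simp
    also have "\<dots> = 0"
      unfolding m using \<omega>1 by simp
    finally show ?thesis
      by (simp add: K_def momentum_deriv_along \<pi>_def cross_skew[of b] zero_prod_def)
  qed
  moreover have "0 \<in> K"
    by (simp add: K_def zero_prod_def momentum_deriv_along)
  \<comment> \<open>Generators move the position by a multiple of \<open>e1 \<times> r\<close>,
    which has no axial component, whereas \<open>\<rho> $ 1\<close> is 1; so the class in the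
    quotient is nonzero.\<close>
  moreover have "?w \<notin> W'"
  proof
    assume "?w \<in> W'"
    then obtain \<xi>' \<eta>' where "?w = generator_TQ (\<xi>', \<eta>') ?p"
      by (auto simp: W'_def)
    then have "\<rho> = \<eta>' *\<^sub>R (e1 \<times> r)"
      by (simp add: generator_TQ_eq[OF rot1])
    then have "\<rho> $ 1 = 0" by (simp add: cross_components)
    then show False by (simp add: \<rho>_def)
  qed
  moreover have "0 \<in> W'"
  proof -
    have "(0, 0) \<in> stabilizer_algebra (momentum ?p)"
    proof -
      have "one_param (0, 0) t = (mat 1, mat 1)" for t
        by (simp add: one_param_def)
      moreover have "(mat 1, mat 1) \<in> G_axi"
      proof -
        have md: "mat 1 = block_diag 1 (mat 1)"
          by (simp add: block_diag_def mat_def vec_eq_iff forall_3)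
        have "mat 1 \<in> Gamma_axi"
          unfolding Gamma_axi_def mem_Collect_eq
          by (intro exI[of _ 1] exI[of _ "mat 1"]) (simp add: md[symmetric] orthogonal_matrix_id)
        then show ?thesis using rot1 by (simp add: G_axi_def)
      qed
      moreover have "coadjoint (mat 1, mat 1) z = z" for z
      proof -
        have "chi_axi (mat 1) = 1" by (simp add: chi_axi_def det_2 mat_def)
        then show ?thesis by (cases z) (simp add: coadjoint_def)
      qed
      ultimately show ?thesis
        by (simp add: stabilizer_algebra_def stabilizer_axi_def)
    qed
    moreover have "generator_TQ (0, 0) ?p = 0"
      by (simp add: generator_TQ_eq[OF rot1] zero_prod_def)
    ultimately show ?thesis
      unfolding W'_def by (metis image_eqI)
  qed
  ultimately have "quotient_eigenvalue ?A K W' (complex_of_real l)"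
    unfolding quotient_eigenvalue_def
    by (intro bexI[of _ ?w] bexI[of _ 0]) (use Aw A0 in auto)
  then show ?thesis
    unfolding linearly_unstable_def K_def W'_def \<Lambda>_def P_def using l
    by (intro exI[of _ "complex_of_real l"]) auto
qed

text \<open>Completing the square turns the claim into \<open>(4 * x - 3 * (1 - I2))^2\<close>
  exceeding the number under the root. If that number is negative there is nothing to show, and the
  hypothesis is conditional accordingly.\<close>

lemma second_variation_pos:
  fixes I2 x :: real
  assumes "0 \<le> 9 + 102 * I2 - 351 * I2\<^sup>2 \<Longrightarrow>
      x > 1/4 * (3 * (1 - I2) + sqrt (9 + 102 * I2 - 351 * I2\<^sup>2))"
  shows "2 * x\<^sup>2 - 3 * (1 - I2) * x - 15 * (1 - 3 * I2) * I2 > 0"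
proof -
  let ?D = "9 + 102 * I2 - 351 * I2\<^sup>2"
  have eq: "8 * (2 * x\<^sup>2 - 3 * (1 - I2) * x - 15 * (1 - 3 * I2) * I2) = (4 * x - 3 * (1 - I2))\<^sup>2 - ?D"
    by algebra
  have "(4 * x - 3 * (1 - I2))\<^sup>2 > ?D"
  proof (cases "0 \<le> ?D")
    case True
    then have "sqrt ?D < 4 * x - 3 * (1 - I2)" "sqrt ?D \<ge> 0"
      using assms by simp_all
    then have "(sqrt ?D)\<^sup>2 < (4 * x - 3 * (1 - I2))\<^sup>2"
      by (intro power_strict_mono) auto
    then show ?thesis using True by simp
  next
    case False
    then show ?thesis
      using zero_le_power2[of "4 * x - 3 * (1 - I2)"] by linarith
  qed
  then have "0 < 8 * (2 * x\<^sup>2 - 3 * (1 - I2) * x - 15 * (1 - 3 * I2) * I2)"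
    unfolding eq by simp
  then show ?thesis
    by (simp only: zero_less_mult_iff) simp
qed

section \<open>Global solutions of bounded Lipschitz differential equations\<close>

lemma has_integral_scaled_exp:
  fixes L s t :: real
  assumes "L > 0" "s \<le> t"
  shows "((\<lambda>u. L * exp (L * u)) has_integral (exp (L * t) - exp (L * s))) {s..t}"
proof (rule fundamental_theorem_of_calculus[OF assms(2)])
  fix x assume "x \<in> {s..t}"
  have "((\<lambda>u. exp (L * u)) has_real_derivative L * exp (L * x)) (at x within {s..t})"
    by (auto intro!: derivative_eq_intros)
  then show "((\<lambda>u. exp (L * u)) has_vector_derivative L * exp (L * x)) (at x within {s..t})"
    by (simp add: has_real_derivative_iff_has_vector_derivative)
qed

text \<open>Picard iteration on the whole half-line at once: with the unknown written as
  \<open>x0 + exp (2 * L * t) * u t\<close>, the integral operator halves the sup-norm distance of bounded \<open>u\<close>.\<close>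

lemma lipschitz_ode_forward:
  fixes f :: "'a::euclidean_space \<Rightarrow> 'a"
  assumes lip: "\<And>x y. norm (f x - f y) \<le> L * norm (x - y)" and bdd: "\<And>x. norm (f x) \<le> C" and L: "L > 0"
  obtains x where "x 0 = x0" "\<And>t. t \<ge> 0 \<Longrightarrow> (x has_vector_derivative f (x t)) (at t within {0..})"
proof -
  have C: "C \<ge> 0" using bdd[of x0] norm_ge_zero[of "f x0"] by linarith
  have fcont: "continuous_on S f" for S
    by (rule lipschitz_on_continuous_on[where L = L])
      (use lip L in \<open>auto simp: lipschitz_on_def dist_norm\<close>)
  \<comment> \<open>Bounded continuous functions are taken on the whole line, so time is clamped at
    0.\<close>
  let ?m = "\<lambda>t::real. max 0 t"
  define X where "X = (\<lambda>(u :: real \<Rightarrow>\<^sub>C 'a) t. x0 + exp (2 * L * ?m t) *\<^sub>R apply_bcontfun u t)"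
  define T where "T = (\<lambda>u t. exp (- 2 * L * ?m t) *\<^sub>R integral {0..?m t} (\<lambda>s. f (X u s)))"
  have Xcont: "continuous_on S (X u)" for u S
    unfolding X_def
    by (intro continuous_intros continuous_on_apply_bcontfun)
  have fXcont: "continuous_on S (\<lambda>s. f (X u s))" for u S
    by (rule continuous_on_compose2[OF fcont[of UNIV] Xcont]) auto
  have fXint: "(\<lambda>s. f (X u s)) integrable_on {a..b}" for u a b
    by (intro integrable_continuous_interval fXcont)
  have deriv: "((\<lambda>t. integral {0..t} (\<lambda>s. f (X u s))) has_vector_derivative f (X u t)) (at t within {0..})"
    if "t \<ge> 0" for u t
  proof -
    have "((\<lambda>t. integral {0..t} (\<lambda>s. f (X u s))) has_vector_derivative f (X u t)) (at t within {0..t+1})"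
      by (rule integral_has_vector_derivative[OF fXcont]) (use that in auto)
    moreover have "at t within {0..t+1} = at t within {0..}"
      by (rule at_within_nhd[of _ "{t-1<..<t+1}"]) auto
    ultimately show ?thesis by simp
  qed
  have Tcont: "continuous_on UNIV (T u)" for u
  proof -
    have "continuous_on {0..} (\<lambda>t. integral {0..t} (\<lambda>s. f (X u s)))"
      unfolding continuous_on_eq_continuous_within
      by (auto intro!: has_vector_derivative_continuous deriv)
    then have "continuous_on UNIV (\<lambda>t. integral {0..?m t} (\<lambda>s. f (X u s)))"
      by (rule continuous_on_compose2) (auto intro!: continuous_intros)
    then show ?thesis unfolding T_def by (intro continuous_intros)
  qed
  have Tbdd: "norm (T u t) \<le> C / (2 * L)" for u t
  proof -
    let ?s = "?m t"
    have "norm (integral {0..?s} (\<lambda>s. f (X u s))) \<le> C * ?s"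
      using integral_bound[of 0 ?s "\<lambda>s. f (X u s)" C] fXcont bdd by simp
    then have "norm (T u t) \<le> exp (- 2 * L * ?s) * (C * ?s)"
      unfolding T_def by (simp add: mult_left_mono)
    also have "\<dots> = C / (2 * L) * ((2 * L * ?s) * exp (- (2 * L * ?s)))"
      using L by simp
    also have "\<dots> \<le> C / (2 * L) * 1"
    proof (intro mult_left_mono)
      have "2 * L * ?s \<le> exp (2 * L * ?s)"
        using exp_ge_add_one_self[of "2 * L * ?s"] by linarith
      then show "(2 * L * ?s) * exp (- (2 * L * ?s)) \<le> 1"
        by (simp add: exp_minus divide_simps)
    qed (use C L in auto)
    finally show ?thesis by simp
  qed
  have Tb: "T u \<in> bcontfun" for u
    unfolding bcontfun_def bounded_iff using Tcont Tbdd by blast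
  define TT where "TT = (\<lambda>u. Bcontfun (T u))"
  have TTa: "apply_bcontfun (TT u) = T u" for u
    unfolding TT_def by (rule Bcontfun_inverse[OF Tb])
  \<comment> \<open>The weight grows at twice the Lipschitz rate. Integrating it costs a factor
    \<open>1 / (2 * L)\<close> against the factor \<open>L\<close> from the field, which leaves one
    half.\<close>
  have contr: "dist (TT u) (TT v) \<le> 1/2 * dist u v" for u v
  proof (rule dist_bound)
    fix t
    let ?s = "?m t" and ?d = "dist u v"
    have "norm (integral {0..?s} (\<lambda>s. f (X u s) - f (X v s))) \<le> integral {0..?s} (\<lambda>s. ?d / 2 * (2 * L * exp (2 * L * s)))"
    proof (rule integral_norm_bound_integral)
      show "(\<lambda>s. f (X u s) - f (X v s)) integrable_on {0..?s}"
        by (intro integrable_diff fXint)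
      show "(\<lambda>s. ?d / 2 * (2 * L * exp (2 * L * s))) integrable_on {0..?s}"
        by (intro integrable_continuous_interval continuous_intros)
      fix s assume s: "s \<in> {0..?s}"
      have "X u s - X v s = exp (2 * L * s) *\<^sub>R (apply_bcontfun u s - apply_bcontfun v s)"
        using s by (simp add: X_def scaleR_diff_right)
      then have "norm (f (X u s) - f (X v s)) \<le> L * (exp (2 * L * s) * norm (apply_bcontfun u s - apply_bcontfun v s))"
        using lip[of "X u s" "X v s"] by simp
      also have "\<dots> \<le> L * (exp (2 * L * s) * ?d)"
        using dist_bounded[of u s v] L by (intro mult_left_mono) (auto simp: dist_norm)
      finally show "norm (f (X u s) - f (X v s)) \<le> ?d / 2 * (2 * L * exp (2 * L * s))"
        by (simp add: mult_ac)
    qed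
    also have "\<dots> = ?d / 2 * (exp (2 * L * ?s) - 1)"
      by (rule trans[OF integral_unique[OF has_integral_mult_right[OF has_integral_scaled_exp]]])
        (use L in auto)
    finally have i: "norm (integral {0..?s} (\<lambda>s. f (X u s) - f (X v s))) \<le> ?d / 2 * (exp (2 * L * ?s) - 1)" .
    have "dist (T u t) (T v t) = exp (- 2 * L * ?s) * norm (integral {0..?s} (\<lambda>s. f (X u s) - f (X v s)))"
      unfolding T_def dist_norm integral_diff[OF fXint fXint] by (simp flip: scaleR_diff_right)
    also have "\<dots> \<le> exp (- 2 * L * ?s) * (?d / 2 * (exp (2 * L * ?s) - 1))"
      by (intro mult_left_mono i) simp
    also have "\<dots> = ?d / 2 * (1 - exp (- 2 * L * ?s))"
      by (simp add: algebra_simps exp_minus)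
    also have "\<dots> \<le> ?d / 2 * 1"
      by (intro mult_left_mono) auto
    finally show "dist (apply_bcontfun (TT u) t) (apply_bcontfun (TT v) t) \<le> 1/2 * dist u v"
      by (simp add: TTa)
  qed
  have "\<exists>!u. TT u = u"
    using Banach_fix[OF complete_UNIV UNIV_not_empty, of "1/2" TT] contr by simp
  then obtain u where u: "TT u = u" by blast
  have Xu: "X u t = x0 + integral {0..t} (\<lambda>s. f (X u s))" if "t \<ge> 0" for t
  proof -
    have "apply_bcontfun u t = T u t" using TTa[of u] u by simp
    then show ?thesis
      using that by (simp add: X_def T_def flip: exp_add)
  qed
  show ?thesis
  proof
    show "X u 0 = x0" using Xu[of 0] by simp
    fix t :: real assume t: "t \<ge> 0"
    have "((\<lambda>t. x0 + integral {0..t} (\<lambda>s. f (X u s))) has_vector_derivative f (X u t)) (at t within {0..})"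
      using has_vector_derivative_add[OF has_vector_derivative_const deriv[OF t]] by simp
    then show "(X u has_vector_derivative f (X u t)) (at t within {0..})"
      by (rule has_vector_derivative_transform[rotated 2]) (use t Xu in auto)
  qed
qed

text \<open>A forward solution for \<open>f\<close> is glued at 0 to the time reversal of a forward
  solution for \<open>- f\<close>; the one-sided derivatives agree there.\<close>

lemma lipschitz_ode_global:
  fixes f :: "'a::euclidean_space \<Rightarrow> 'a"
  assumes lip: "\<And>x y. norm (f x - f y) \<le> L * norm (x - y)" and bdd: "\<And>x. norm (f x) \<le> C" and L: "L > 0"
  obtains x where "x 0 = x0" "\<And>t. (x has_vector_derivative f (x t)) (at t)"
proof -
  obtain x where x: "x 0 = x0" "\<And>t. t \<ge> 0 \<Longrightarrow> (x has_vector_derivative f (x t)) (at t within {0..})"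
    using lipschitz_ode_forward[OF assms] by metis
  obtain y where y: "y 0 = x0" "\<And>t. t \<ge> 0 \<Longrightarrow> (y has_vector_derivative - f (y t)) (at t within {0..})"
    using lipschitz_ode_forward[of "\<lambda>x. - f x" L C] lip bdd L by (metis minus_diff_minus norm_minus_cancel)
  define z where "z = (\<lambda>t. if t \<in> {0..} then x t else y (- t))"
  have y': "((\<lambda>t. y (- t)) has_vector_derivative f (y (- t))) (at t within {..0})" if "t \<le> 0" for t
  proof -
    have "(y has_vector_derivative - f (y (- t))) (at (- t) within uminus ` {..0})"
      using y(2)[of "- t"] that by simp
    from vector_diff_chain_within[OF _ this, of "-1"]
    show ?thesis
      by (simp add: o_def has_vector_derivative_minus has_vector_derivative_id has_vector_derivative_def)
  qed
  have "(z has_vector_derivative f (z t)) (at t within {0..} \<union> {..0})" for t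
  proof -
    have "((\<lambda>t. if t \<in> {0..} then x t else y (- t)) has_vector_derivative (if t \<in> {0..} then f (x t) else f (y (- t))))
      (at t within {0..} \<union> {..0})"
    proof (rule has_vector_derivative_If_within_closures[where f' = "\<lambda>t. f (x t)" and g' = "\<lambda>t. f (y (- t))"])
      have cl: "{0::real..} \<union> (closure {0..} \<inter> closure {..0}) = {0..}"
        "{..0::real} \<union> (closure {0..} \<inter> closure {..0}) = {..0}"
        by (auto simp: closure_closed)
      show "(x has_vector_derivative f (x t)) (at t within {0..} \<union> (closure {0..} \<inter> closure {..0}))"
        if "t \<in> {0..} \<union> (closure {0..} \<inter> closure {..0})"
        using that x(2) unfolding cl by simp
      show "((\<lambda>t. y (- t)) has_vector_derivative f (y (- t))) (at t within {..0} \<union> (closure {0..} \<inter> closure {..0}))"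
        if "t \<in> {..0} \<union> (closure {0..} \<inter> closure {..0})"
        using that y' unfolding cl by simp
    qed (auto simp: x(1) y(1) closure_closed dest: antisym)
    then show ?thesis
      by (simp add: z_def if_distrib)
  qed
  moreover have "{0..} \<union> {..0} = (UNIV :: real set)" by auto
  ultimately have "(z has_vector_derivative f (z t)) (at t)" for t by simp
  moreover have "z 0 = x0" by (simp add: z_def x)
  ultimately show ?thesis using that by blast
qed

section \<open>Bounded Lipschitz functions\<close>

text \<open>Both bounds are kept together because products of Lipschitz functions need bounded
  factors to be Lipschitz again. The class is thus closed under the polynomial operations that build
  the vector field.\<close>

definition bounded_lipschitz :: "('a::real_normed_vector \<Rightarrow> 'b::real_normed_vector) \<Rightarrow> bool" where
  "bounded_lipschitz f \<longleftrightarrow>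
     (\<exists>C. (\<forall>x. norm (f x) \<le> C) \<and> (\<forall>x y. norm (f x - f y) \<le> C * norm (x - y)))"

lemma bounded_lipschitzE:
  assumes "bounded_lipschitz f"
  obtains C where "C > 0" "\<And>x. norm (f x) \<le> C" "\<And>x y. norm (f x - f y) \<le> C * norm (x - y)"
proof -
  obtain C where C: "\<And>x. norm (f x) \<le> C" "\<And>x y. norm (f x - f y) \<le> C * norm (x - y)"
    using assms unfolding bounded_lipschitz_def by blast
  have "\<bar>C\<bar> + 1 > 0" "norm (f x) \<le> \<bar>C\<bar> + 1" for x
    using C(1)[of x] by linarith+
  moreover have "norm (f x - f y) \<le> (\<bar>C\<bar> + 1) * norm (x - y)" for x y
    using C(2)[of x y] mult_right_mono[of C "\<bar>C\<bar> + 1" "norm (x - y)"] by force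
  ultimately show ?thesis using that by blast
qed

lemma bounded_lipschitzI:
  assumes "\<And>x. norm (f x) \<le> C" "\<And>x y. norm (f x - f y) \<le> D * norm (x - y)"
  shows "bounded_lipschitz f"
  unfolding bounded_lipschitz_def
proof (intro exI[of _ "max C D"] conjI allI)
  show "norm (f x) \<le> max C D" for x using assms(1)[of x] by simp
  show "norm (f x - f y) \<le> max C D * norm (x - y)" for x y
    using assms(2)[of x y] mult_right_mono[of D "max C D" "norm (x - y)"] by force
qed

lemma bl_const: "bounded_lipschitz (\<lambda>_. c)"
  by (rule bounded_lipschitzI[of _ "norm c" 0]) auto

lemma bl_add:
  assumes "bounded_lipschitz f" "bounded_lipschitz g"
  shows "bounded_lipschitz (\<lambda>x. f x + g x)"
proof -
  obtain C where C: "\<And>x. norm (f x) \<le> C" "\<And>x y. norm (f x - f y) \<le> C * norm (x - y)"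
    using bounded_lipschitzE[OF assms(1)] by metis
  obtain D where D: "\<And>x. norm (g x) \<le> D" "\<And>x y. norm (g x - g y) \<le> D * norm (x - y)"
    using bounded_lipschitzE[OF assms(2)] by metis
  show ?thesis
  proof (rule bounded_lipschitzI)
    show "norm (f x + g x) \<le> C + D" for x
      by (rule norm_triangle_le[OF add_mono[OF C(1) D(1)]])
    show "norm (f x + g x - (f y + g y)) \<le> (C + D) * norm (x - y)" for x y
      using norm_triangle_le[OF add_mono[OF C(2)[of x y] D(2)[of x y]]]
      by (simp add: add_diff_add distrib_right)
  qed
qed

lemma bl_linear:
  assumes "bounded_linear h" "bounded_lipschitz f"
  shows "bounded_lipschitz (\<lambda>x. h (f x))"
proof -
  obtain C where C: "C > 0" "\<And>x. norm (f x) \<le> C" "\<And>x y. norm (f x - f y) \<le> C * norm (x - y)"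
    using bounded_lipschitzE[OF assms(2)] by metis
  obtain K where K: "K > 0" "\<And>x. norm (h x) \<le> norm x * K"
    using bounded_linear.pos_bounded[OF assms(1)] by blast
  show ?thesis
  proof (rule bounded_lipschitzI)
    show "norm (h (f x)) \<le> C * K" for x
      using K(2)[of "f x"] mult_right_mono[OF C(2)[of x], of K] K(1) by linarith
    show "norm (h (f x) - h (f y)) \<le> (C * K) * norm (x - y)" for x y
    proof -
      have "norm (h (f x) - h (f y)) \<le> norm (f x - f y) * K"
        using K(2)[of "f x - f y"] linear_diff[OF bounded_linear.linear[OF assms(1)], of "f x" "f y"] by simp
      also have "\<dots> \<le> C * norm (x - y) * K"
        using C(3)[of x y] K(1) by (intro mult_right_mono) auto
      finally show ?thesis by (simp add: mult_ac)
    qed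
  qed
qed

lemma bl_bilinear:
  assumes "bounded_bilinear h" "bounded_lipschitz f" "bounded_lipschitz g"
  shows "bounded_lipschitz (\<lambda>x. h (f x) (g x))"
proof -
  obtain C where C: "C > 0" "\<And>x. norm (f x) \<le> C" "\<And>x y. norm (f x - f y) \<le> C * norm (x - y)"
    using bounded_lipschitzE[OF assms(2)] by metis
  obtain D where D: "D > 0" "\<And>x. norm (g x) \<le> D" "\<And>x y. norm (g x - g y) \<le> D * norm (x - y)"
    using bounded_lipschitzE[OF assms(3)] by metis
  obtain K where K: "K > 0" "\<And>a b. norm (h a b) \<le> norm a * norm b * K"
    using bounded_bilinear.pos_bounded[OF assms(1)] by blast
  show ?thesis
  proof (rule bounded_lipschitzI)
    show "norm (h (f x) (g x)) \<le> C * D * K" for x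
      using K(2)[of "f x" "g x"] mult_right_mono[OF mult_mono[OF C(2)[of x] D(2)[of x]], of K] K(1) C(1)
      by (smt (verit) norm_ge_zero)
    show "norm (h (f x) (g x) - h (f y) (g y)) \<le> (2 * C * D * K) * norm (x - y)" for x y
    proof -
      have "h (f x) (g x) - h (f y) (g y) = h (f x) (g x - g y) + h (f x - f y) (g y)"
        by (simp add: bounded_bilinear.diff_left[OF assms(1)] bounded_bilinear.diff_right[OF assms(1)])
      also have "norm \<dots> \<le> norm (f x) * norm (g x - g y) * K + norm (f x - f y) * norm (g y) * K"
        by (intro norm_triangle_le add_mono K)
      also have "\<dots> \<le> C * (D * norm (x - y)) * K + (C * norm (x - y)) * D * K"
        using C D K(1) by (intro add_mono mult_right_mono mult_mono) auto
      finally show ?thesis by (simp add: mult_ac)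
    qed
  qed
qed

lemmas bl_scaleR = bl_bilinear[OF bounded_bilinear_scaleR]
lemmas bl_mult = bl_bilinear[OF bounded_bilinear_mult]
lemmas bl_cross = bl_bilinear[OF bounded_bilinear_cross3]
lemmas bl_matrix_mult = bl_bilinear[OF bounded_bilinear_matrix_mult]

lemma bl_power:
  fixes f :: "'a::real_normed_vector \<Rightarrow> real"
  assumes "bounded_lipschitz f"
  shows "bounded_lipschitz (\<lambda>x. f x ^ n)"
  by (induction n) (auto intro!: bl_mult bl_const assms)

lemma bl_diff:
  assumes "bounded_lipschitz f" "bounded_lipschitz g"
  shows "bounded_lipschitz (\<lambda>x. f x - g x)"
  using bl_add[OF assms(1) bl_linear[OF bounded_linear_minus[OF bounded_linear_ident] assms(2)]] by simp

lemma bl_Pair: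
  assumes "bounded_lipschitz f" "bounded_lipschitz g"
  shows "bounded_lipschitz (\<lambda>x. (f x, g x))"
proof -
  have "bounded_lipschitz (\<lambda>x. (f x, 0) + (0, g x))"
    by (intro bl_add bl_linear[OF _ assms(1)] bl_linear[OF _ assms(2)]
        bounded_linear_Pair bounded_linear_ident bounded_linear_zero)
  then show ?thesis by simp
qed

lemma bl_closest_point_cball:
  fixes a :: "'a::euclidean_space"
  assumes "K \<ge> 0"
  shows "bounded_lipschitz (closest_point (cball 0 K :: 'a set))"
proof (rule bounded_lipschitzI)
  have ne: "cball 0 K \<noteq> ({} :: 'a set)" using assms by simp
  show "norm (closest_point (cball 0 K) x :: 'a) \<le> K" for x
    using closest_point_in_set[OF closed_cball ne, of x] by simp
  show "norm (closest_point (cball 0 K) x - closest_point (cball 0 K) y :: 'a) \<le> 1 * norm (x - y)" for x y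
    using closest_point_lipschitz[OF convex_cball closed_cball ne, of x y] by (simp add: dist_norm)
qed

lemma bl_inverse_max_norm:
  assumes "bounded_lipschitz f" "d > 0"
  shows "bounded_lipschitz (\<lambda>x. 1 / max d (norm (f x)))"
proof -
  obtain C where C: "C > 0" "\<And>x y. norm (f x - f y) \<le> C * norm (x - y)"
    using bounded_lipschitzE[OF assms(1)] by metis
  show ?thesis
  proof (rule bounded_lipschitzI)
    show "norm (1 / max d (norm (f x))) \<le> 1 / d" for x
      using assms(2) by (simp add: frac_le)
    show "norm (1 / max d (norm (f x)) - 1 / max d (norm (f y))) \<le> (C / d\<^sup>2) * norm (x - y)" for x y
    proof -
      define a where "a = max d (norm (f x))"
      define b where "b = max d (norm (f y))"
      have ab: "a \<ge> d" "b \<ge> d" by (simp_all add: a_def b_def)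
      have "\<bar>b - a\<bar> \<le> \<bar>norm (f y) - norm (f x)\<bar>" by (simp add: a_def b_def max_def)
      also have "\<dots> \<le> norm (f x - f y)" using norm_triangle_ineq3[of "f y" "f x"] by (simp add: norm_minus_commute)
      also have "\<dots> \<le> C * norm (x - y)" by (rule C)
      finally have 1: "\<bar>b - a\<bar> \<le> C * norm (x - y)" .
      have "norm (1 / a - 1 / b) = \<bar>b - a\<bar> / (a * b)"
        using ab assms(2) by (simp add: field_simps abs_mult)
      also have "\<dots> \<le> C * norm (x - y) / (d * d)"
        using ab assms(2) 1 C(1) by (intro frac_le mult_mono mult_pos_pos) auto
      finally show ?thesis by (simp add: a_def b_def power2_eq_square)
    qed
  qed
qed

section \<open>Conserved quantities and trapping\<close>

text \<open>The equations of motion on the ambient vector space: the attitude moves by a matrix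
  derivative in place of its left trivialized form, and \<open>i\<close> stands for
  \<open>1 / norm r\<close> so that it can be truncated separately.\<close>

definition ham_vf :: "real \<Rightarrow> real \<Rightarrow> real \<Rightarrow> phase \<Rightarrow> phase" where
  "ham_vf I1 I2 i z =
    ((fst (fst z) ** hat (body_velocity I1 I2 z), snd (snd z) + snd (fst z) \<times> body_velocity I1 I2 z),
     (fst (snd z) \<times> body_velocity I1 I2 z,
      snd (snd z) \<times> body_velocity I1 I2 z - force I1 I2 i (snd (fst z))))"

lemma phase_space_iff: "z \<in> phase_space \<longleftrightarrow> rotation_matrix (fst (fst z)) \<and> snd (fst z) \<noteq> 0"
  by (auto simp: phase_space_def config_space_def split: prod.splits)

lemma evolution_iff:
  assumes "I1 \<noteq> 0" "I2 \<noteq> 0"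
  shows "evolution I1 I2 z \<longleftrightarrow> (\<forall>t. z t \<in> phase_space \<and>
    (z has_vector_derivative ham_vf I1 I2 (1 / norm (snd (fst (z t)))) (z t)) (at t))"
proof -
  have "phase_velocity z (hamiltonian_field (hamiltonian2 I1 I2) (z t)) t \<longleftrightarrow>
     (z has_vector_derivative ham_vf I1 I2 (1 / norm (snd (fst (z t)))) (z t)) (at t)"
    if "z t \<in> phase_space" for t
  proof -
    obtain B r \<Lambda> P where zt: "z t = ((B, r), (\<Lambda>, P))" by (metis surj_pair)
    have r: "r \<noteq> 0" using that by (simp add: phase_space_iff zt)
    define v where "v = ham_vf I1 I2 (1 / norm r) (z t)"
    have "phase_velocity z (hamiltonian_field (hamiltonian2 I1 I2) (z t)) t \<longleftrightarrow>
       ((\<lambda>s. fst (fst (z s))) has_vector_derivative fst (fst v)) (at t) \<and>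
       ((\<lambda>s. snd (fst (z s))) has_vector_derivative snd (fst v)) (at t) \<and>
       ((\<lambda>s. snd (z s)) has_vector_derivative snd v) (at t)"
      unfolding phase_velocity_def config_velocity_def zt hamiltonian2_field[OF assms r] v_def ham_vf_def
      by simp
    also have "\<dots> \<longleftrightarrow> (z has_vector_derivative v) (at t)"
    proof safe
      assume "((\<lambda>s. fst (fst (z s))) has_vector_derivative fst (fst v)) (at t)"
        "((\<lambda>s. snd (fst (z s))) has_vector_derivative snd (fst v)) (at t)"
        "((\<lambda>s. snd (z s)) has_vector_derivative snd v) (at t)"
      from has_vector_derivative_Pair[OF has_vector_derivative_Pair[OF this(1,2)] this(3)]
      show "(z has_vector_derivative v) (at t)" by simp
    next
      assume z: "(z has_vector_derivative v) (at t)"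
      note bf = bounded_linear.has_vector_derivative[OF bounded_linear_fst]
        and bs = bounded_linear.has_vector_derivative[OF bounded_linear_snd]
      show "((\<lambda>s. fst (fst (z s))) has_vector_derivative fst (fst v)) (at t)"
        "((\<lambda>s. snd (fst (z s))) has_vector_derivative snd (fst v)) (at t)"
        "((\<lambda>s. snd (z s)) has_vector_derivative snd v) (at t)"
        by (rule bf[OF bf[OF z]] bs[OF bf[OF z]] bs[OF z])+
    qed
    finally show ?thesis by (simp add: v_def zt)
  qed
  then show ?thesis unfolding evolution_def by blast
qed

definition conserved :: "real \<Rightarrow> real \<Rightarrow> phase \<Rightarrow> lie_elt \<times> real" where
  "conserved I1 I2 z = (momentum z, hamiltonian2 I1 I2 z)"

text \<open>Noether's theorem by direct computation. It is stated at a single time, since for the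
  truncated field the equation is known only while the curve stays in a region.\<close>

lemma conserved_deriv:
  assumes "I1 \<noteq> 0" "I2 \<noteq> 0" "snd (fst (z t)) \<noteq> 0"
    and z: "(z has_vector_derivative ham_vf I1 I2 (1 / norm (snd (fst (z t)))) (z t)) (at t)"
  shows "((\<lambda>t. conserved I1 I2 (z t)) has_vector_derivative 0) (at t)"
proof -
  define B where "B = (\<lambda>t. fst (fst (z t)))"
  define r where "r = (\<lambda>t. snd (fst (z t)))"
  define \<Lambda> where "\<Lambda> = (\<lambda>t. fst (snd (z t)))"
  define P where "P = (\<lambda>t. snd (snd (z t)))"
  define \<Omega> where "\<Omega> = inv_inertia I1 I2 (\<Lambda> t - r t \<times> P t)"
  define F where "F = force I1 I2 (1 / norm (r t)) (r t)"
  note bf = bounded_linear.has_vector_derivative[OF bounded_linear_fst]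
    and bs = bounded_linear.has_vector_derivative[OF bounded_linear_snd]
  have zt: "z t = ((B t, r t), (\<Lambda> t, P t))" for t
    by (simp add: B_def r_def \<Lambda>_def P_def)
  have \<Omega>: "body_velocity I1 I2 (z t) = \<Omega>"
    by (simp add: body_velocity_def \<Omega>_def \<Lambda>_def r_def P_def)
  have B': "(B has_vector_derivative B t ** hat \<Omega>) (at t)"
    using bf[OF bf[OF z]] by (simp add: B_def ham_vf_def \<Omega>)
  have r': "(r has_vector_derivative P t + r t \<times> \<Omega>) (at t)"
    using bs[OF bf[OF z]] by (simp add: r_def P_def ham_vf_def \<Omega>)
  have \<Lambda>': "(\<Lambda> has_vector_derivative \<Lambda> t \<times> \<Omega>) (at t)"
    using bf[OF bs[OF z]] by (simp add: \<Lambda>_def ham_vf_def \<Omega>)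
  have P': "(P has_vector_derivative P t \<times> \<Omega> - F) (at t)"
    using bs[OF bs[OF z]] by (simp add: P_def r_def ham_vf_def \<Omega> F_def)
  have L: "\<Lambda> t \<times> \<Omega> - (r t \<times> (P t \<times> \<Omega> - F) + (P t + r t \<times> \<Omega>) \<times> P t) =
      (\<Lambda> t - r t \<times> P t) \<times> \<Omega> + r t \<times> F"
    by (simp add: vec3_simps algebra_simps)
  have "B t *v (\<Lambda> t \<times> \<Omega>) + (B t ** hat \<Omega>) *v \<Lambda> t = 0"
    by (simp add: matrix_vector_right_distrib[symmetric] cross_skew[of \<Omega>] flip: matrix_vector_mul_assoc)
  moreover have "(r t \<times> (P t \<times> \<Omega> - F) + (P t + r t \<times> \<Omega>) \<times> P t - \<Lambda> t \<times> \<Omega>) $ 1 = 0"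
  proof -
    \<comment> \<open>Axial symmetry: the spin momentum and its angular velocity differ in direction
      only by a multiple of \<open>e1\<close>, and the torque is a multiple of
      \<open>r \<times> e1\<close>.\<close>
    have "((\<Lambda> t - r t \<times> P t) \<times> \<Omega> + r t \<times> F) $ 1 = 0"
      unfolding \<Omega>_def F_def force_def inv_inertia_def by (simp add: cross_components algebra_simps)
    then show ?thesis
      unfolding L[symmetric] by simp
  qed
  moreover have "r t \<noteq> 0" using assms(3) by (simp add: r_def)
  moreover have "\<Omega> \<bullet> (\<Lambda> t \<times> \<Omega> - (r t \<times> (P t \<times> \<Omega> - F) + (P t + r t \<times> \<Omega>) \<times> P t))
      + P t \<bullet> (P t \<times> \<Omega> - F) + F \<bullet> (P t + r t \<times> \<Omega>) = 0"
    unfolding L by (simp add: vec3_simps algebra_simps)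
  ultimately show ?thesis
    using has_vector_derivative_Pair[OF momentum_deriv[OF B' r' \<Lambda>' P']
        hamiltonian2_deriv[OF assms(1,2) r' \<Lambda>' P', where B = B, folded \<Omega>_def F_def,
          unfolded has_real_derivative_iff_has_vector_derivative]]
    by (simp add: conserved_def zt zero_prod_def)
qed

text \<open>At a first exit from \<open>D\<close> all earlier points lie in \<open>D\<close>, so
  \<open>step\<close> puts the exit point in \<open>A\<close>, inside \<open>D\<close>. Scaling time
  as \<open>v * t\<close> treats both directions of time at once.\<close>

lemma trapped:
  fixes z :: "real \<Rightarrow> 'a::topological_space"
  assumes "continuous_on UNIV z" "open D" "A \<subseteq> D"
    and step: "\<And>t. (\<And>v. 0 \<le> v \<Longrightarrow> v < 1 \<Longrightarrow> z (v * t) \<in> D) \<Longrightarrow> z t \<in> A"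
    and z0: "z 0 \<in> D"
  shows "z t \<in> A"
proof (rule step)
  fix v :: real assume v: "0 \<le> v" "v < 1"
  show "z (v * t) \<in> D"
  proof (rule ccontr)
    assume nD: "z (v * t) \<notin> D"
    define E where "E = {0..1} \<inter> (\<lambda>w. z (w * t)) -` (- D)"
    have "continuous_on {0..1} (\<lambda>w. z (w * t))"
      by (rule continuous_on_compose2[OF assms(1)]) (auto intro!: continuous_intros)
    then have "closed E"
      unfolding E_def using assms(2) by (intro continuous_closed_preimage) auto
    moreover have "bounded E" by (rule bounded_subset[of "{0..1}"]) (auto simp: E_def)
    ultimately have "compact E" by (simp add: compact_eq_bounded_closed)
    moreover have "v \<in> E" using v nD by (simp add: E_def)
    ultimately obtain w where w: "w \<in> E" "\<And>u. u \<in> E \<Longrightarrow> w \<le> u"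
      using compact_attains_inf[of E] by blast
    have "z (w * t) \<in> A"
    proof (rule step)
      fix u :: real assume u: "0 \<le> u" "u < 1"
      show "z (u * (w * t)) \<in> D"
      proof (cases "w = 0")
        case True then show ?thesis using z0 by simp
      next
        case False
        then have "w > 0" using w(1) by (auto simp: E_def)
        then have "u * w < w" using u by simp
        then have "u * w \<notin> E" using w(2)[of "u * w"] by auto
        moreover have "u * w \<in> {0..1}"
          using u w(1) by (auto simp: E_def mult_le_one)
        ultimately show ?thesis by (simp add: E_def mult.assoc)
      qed
    qed
    then show False using assms(3) w(1) by (auto simp: E_def)
  qed
qed

text \<open>On the compact set \<open>K - N\<close> the distance of \<open>f\<close> from
  \<open>a\<close> attains a minimum, which is positive as the level \<open>a\<close> does not meet
  that set.\<close>

lemma compact_level_neighbourhood: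
  fixes f :: "'a::topological_space \<Rightarrow> 'b::metric_space"
  assumes "compact K" "continuous_on K f" "open N" "\<And>x. x \<in> K \<Longrightarrow> f x = a \<Longrightarrow> x \<in> N"
  obtains e where "e > 0" "\<And>x. x \<in> K \<Longrightarrow> dist (f x) a < e \<Longrightarrow> x \<in> N"
proof (cases "K - N = {}")
  case True
  then show ?thesis using that[of 1] by auto
next
  case False
  have "compact (K - N)" using assms(1,3) by (simp add: compact_diff)
  moreover have "continuous_on (K - N) (\<lambda>x. dist (f x) a)"
    by (intro continuous_on_dist continuous_on_const continuous_on_subset[OF assms(2)]) auto
  ultimately obtain y where y: "y \<in> K - N" "\<And>x. x \<in> K - N \<Longrightarrow> dist (f y) a \<le> dist (f x) a"
    using continuous_attains_inf[OF _ False] by metis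
  have "dist (f y) a > 0" using y(1) assms(4) by auto
  then show ?thesis using that[of "dist (f y) a"] y(2) by (metis DiffI not_le)
qed

section \<open>The energy at fixed momentum\<close>

text \<open>\<open>m\<close> is the squared norm of the angular momentum and \<open>n\<close> the
  distance; the first summand is the energy of rigid rotation with moment of inertia
  \<open>n^2 + I2\<close>.\<close>

definition amended_potential :: "real \<Rightarrow> real \<Rightarrow> real \<Rightarrow> real" where
  "amended_potential I2 m n = m / (2 * (n\<^sup>2 + I2)) - 1 / n + (3 * I2 - 1) / (2 * n ^ 3)"

text \<open>Completing the square in \<open>P\<close>: the minimizer of the kinetic energy for given \<open>\<Lambda>\<close> and \<open>r\<close> is
  \<open>\<Lambda> \<times> r / (r \<bullet> r + I2)\<close>.\<close>

lemma energy_decomposition: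
  fixes r \<Lambda> P :: "real^3"
  assumes I: "I1 > 0" "I2 > 0" and r: "r \<noteq> 0"
  defines "Y \<equiv> P - (1 / (r \<bullet> r + I2)) *\<^sub>R (\<Lambda> \<times> r)"
  shows "hamiltonian2 I1 I2 ((B, r), (\<Lambda>, P)) =
     (1 / I1 - 1 / I2) * ((\<Lambda> - r \<times> P) $ 1)\<^sup>2 / 2 + amended_potential I2 (\<Lambda> \<bullet> \<Lambda>) (norm r)
     + (r \<bullet> \<Lambda>)\<^sup>2 / (2 * I2 * (r \<bullet> r + I2)) + (r \<times> Y) \<bullet> (r \<times> Y) / (2 * I2) + Y \<bullet> Y / 2
     + 3 / 2 * (I1 - I2) * (r $ 1)\<^sup>2 * (1 / norm r) ^ 5"
proof -
  define q where "q = 1 / (r \<bullet> r + I2)"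
  define s where "s = r \<bullet> \<Lambda>"
  have pos: "r \<bullet> r + I2 > 0" using I by (simp add: add_nonneg_pos)
  have q: "q * (r \<bullet> r) = 1 - q * I2" using pos by (simp add: q_def field_simps)
  have P: "P = Y + q *\<^sub>R (\<Lambda> \<times> r)" by (simp add: Y_def q_def)
  have rr: "r \<times> (\<Lambda> \<times> r) = (r \<bullet> r) *\<^sub>R \<Lambda> - s *\<^sub>R r" by (simp add: Lagrange s_def)
  have "\<Lambda> - r \<times> P = \<Lambda> - (q * (r \<bullet> r)) *\<^sub>R \<Lambda> + (q * s) *\<^sub>R r - r \<times> Y"
    by (simp add: P cross_add_right cross_mult_right rr scaleR_diff_right algebra_simps)
  then have L: "\<Lambda> - r \<times> P = (q * I2) *\<^sub>R \<Lambda> + (q * s) *\<^sub>R r - r \<times> Y"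
    by (simp add: q algebra_simps)
  have X: "\<Lambda> \<bullet> (r \<times> Y) = Y \<bullet> (\<Lambda> \<times> r)"
    by (simp add: vec3_simps algebra_simps)
  have LL: "(\<Lambda> - r \<times> P) \<bullet> (\<Lambda> - r \<times> P) = (q * I2)\<^sup>2 * (\<Lambda> \<bullet> \<Lambda>) + (q * s)\<^sup>2 * (r \<bullet> r) + (r \<times> Y) \<bullet> (r \<times> Y)
     + 2 * q\<^sup>2 * I2 * s\<^sup>2 - 2 * q * I2 * (Y \<bullet> (\<Lambda> \<times> r))"
  proof -
    define Z where "Z = r \<times> Y"
    have sq: "(a *\<^sub>R \<Lambda> + b *\<^sub>R r - Z) \<bullet> (a *\<^sub>R \<Lambda> + b *\<^sub>R r - Z) =
       a\<^sup>2 * (\<Lambda> \<bullet> \<Lambda>) + b\<^sup>2 * (r \<bullet> r) + Z \<bullet> Z + 2 * a * b * (r \<bullet> \<Lambda>) - 2 * a * (\<Lambda> \<bullet> Z) - 2 * b * (r \<bullet> Z)"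
      for a b
      by (simp add: inner_add_left inner_add_right inner_diff_left inner_diff_right inner_commute
          algebra_simps power2_eq_square)
    have "r \<bullet> Z = 0" by (simp add: Z_def dot_cross_self)
    then show ?thesis
      unfolding L Z_def[symmetric] sq X[folded Z_def] s_def[symmetric]
      by (simp add: power2_eq_square)
  qed
  have cc: "(\<Lambda> \<times> r) \<bullet> (\<Lambda> \<times> r) = (\<Lambda> \<bullet> \<Lambda>) * (r \<bullet> r) - s\<^sup>2"
    by (simp add: s_def vec3_simps algebra_simps power2_eq_square)
  have PP: "P \<bullet> P = Y \<bullet> Y + 2 * q * (Y \<bullet> (\<Lambda> \<times> r)) + q\<^sup>2 * ((\<Lambda> \<bullet> \<Lambda>) * (r \<bullet> r) - s\<^sup>2)"
    unfolding P cc[symmetric]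
    by (simp add: inner_add_left inner_add_right inner_commute[of "\<Lambda> \<times> r" Y] power2_eq_square
        algebra_simps)
  \<comment> \<open>The mixed terms \<open>Y \<bullet> (\<Lambda> \<times> r)\<close> of
    \<open>LL\<close> and \<open>PP\<close> cancel here; this is what the centre of \<open>Y\<close>
    is chosen for.\<close>
  have "((\<Lambda> - r \<times> P) \<bullet> (\<Lambda> - r \<times> P)) / I2 + P \<bullet> P =
      q * (\<Lambda> \<bullet> \<Lambda>) * (q * I2 + q * (r \<bullet> r)) + q * s\<^sup>2 * (q * (r \<bullet> r) + q * I2) / I2
      + (r \<times> Y) \<bullet> (r \<times> Y) / I2 + Y \<bullet> Y"
    unfolding LL PP using I(2) by (simp add: field_simps power2_eq_square)
  then have kin: "((\<Lambda> - r \<times> P) \<bullet> (\<Lambda> - r \<times> P)) / I2 + P \<bullet> P =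
      q * (\<Lambda> \<bullet> \<Lambda>) + q * s\<^sup>2 / I2 + (r \<times> Y) \<bullet> (r \<times> Y) / I2 + Y \<bullet> Y"
    by (simp add: q)
  have ii: "(\<Lambda> - r \<times> P) \<bullet> inv_inertia I1 I2 (\<Lambda> - r \<times> P) =
     ((\<Lambda> - r \<times> P) \<bullet> (\<Lambda> - r \<times> P)) / I2 + (1 / I1 - 1 / I2) * ((\<Lambda> - r \<times> P) $ 1)\<^sup>2"
    by (simp only: inv_inertia_def inner_add_right inner_scaleR_right inner_e1 power2_eq_square) simp
  have "I1 \<noteq> 0" "I2 \<noteq> 0" using I by simp_all
  note H = hamiltonian2_eq[OF this, of B r \<Lambda> P, unfolded ii potential2_eq[OF r]]
  have n: "(norm r)\<^sup>2 = r \<bullet> r" by (simp add: power2_norm_eq_inner)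
  have "(r \<bullet> \<Lambda>)\<^sup>2 / (2 * I2 * (r \<bullet> r + I2)) = q * s\<^sup>2 / I2 / 2"
    "\<Lambda> \<bullet> \<Lambda> / (2 * (r \<bullet> r + I2)) = q * (\<Lambda> \<bullet> \<Lambda>) / 2"
    using pos I(2) by (simp_all add: q_def s_def)
  moreover have "(3 * I2 - 1) / (2 * norm r ^ 3) = (3 * I2 - 1) / 2 * (1 / norm r) ^ 3"
    by (simp add: power_one_over)
  moreover have "(r \<times> Y) \<bullet> (r \<times> Y) / (2 * I2) = (r \<times> Y) \<bullet> (r \<times> Y) / I2 / 2"
    by simp
  moreover have gen: "(A + c + D) / 2 + (- i + b + v) = c / 2 + (q2 / 2 - i + b) + s2 / 2 + z / 2 + y / 2 + v"
    if "A + D = q2 + s2 + z + y" for A c D i b v q2 s2 z y :: real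
    using that by (simp add: field_simps)
  ultimately show ?thesis
    unfolding H amended_potential_def n using gen[OF kin] by (simp only:)
qed

text \<open>\<open>S\<close> is the difference quotient of the amended potential at
  \<open>R\<close>. It vanishes there since the formula for \<open>k\<close> is the condition for a
  critical point, and its derivative there is half of W''. So near \<open>R\<close> it has the sign
  of \<open>n - R\<close>, which needs one derivative only.\<close>

lemma amended_potential_strict_min:
  fixes R I2 k :: real
  defines "M \<equiv> I2 + R\<^sup>2"
  assumes I: "I2 > 0" and R: "R > 0"
    and k: "k\<^sup>2 = (2 * R\<^sup>2 + 3 - 9 * I2) / (2 * R ^ 5)"
    and W: "2 * (R\<^sup>2)\<^sup>2 - 3 * (1 - I2) * R\<^sup>2 - 15 * (1 - 3 * I2) * I2 > 0"
  obtains d where "0 < d" "d < R"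
    "\<And>n. \<lbrakk>R - d \<le> n; n \<le> R + d; amended_potential I2 (M\<^sup>2 * k\<^sup>2) n \<le> amended_potential I2 (M\<^sup>2 * k\<^sup>2) R\<rbrakk>
       \<Longrightarrow> n = R"
proof -
  define S where "S = (\<lambda>n. - (M * k\<^sup>2) * (R + n) / (2 * (n\<^sup>2 + I2)) + 1 / (n * R)
     - (3 * I2 - 1) / 2 * (n\<^sup>2 + n * R + R\<^sup>2) / (n ^ 3 * R ^ 3))"
  have M: "M > 0" using I by (simp add: M_def add_pos_nonneg)
  have nI: "n\<^sup>2 + I2 > 0" for n using I by (simp add: add_nonneg_pos)
  have diff: "amended_potential I2 (M\<^sup>2 * k\<^sup>2) n - amended_potential I2 (M\<^sup>2 * k\<^sup>2) R = (n - R) * S n"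
    if "n > 0" for n
  proof -
    have MR: "R\<^sup>2 + I2 = M" by (simp add: M_def)
    have "M\<^sup>2 * k\<^sup>2 / (2 * (n\<^sup>2 + I2)) - M\<^sup>2 * k\<^sup>2 / (2 * M) =
        (n - R) * (- (M * k\<^sup>2) * (R + n) / (2 * (n\<^sup>2 + I2)))"
    proof -
      have "M\<^sup>2 * k\<^sup>2 / (2 * (n\<^sup>2 + I2)) - M\<^sup>2 * k\<^sup>2 / (2 * M) = M * k\<^sup>2 * (M - (n\<^sup>2 + I2)) / (2 * (n\<^sup>2 + I2))"
        using M nI[of n] by (simp add: divide_simps) (simp add: algebra_simps power2_eq_square)
      then show ?thesis by (simp add: M_def algebra_simps power2_eq_square)
    qed
    moreover have "- 1 / n + 1 / R = (n - R) * (1 / (n * R))"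
      using that R by (simp add: field_simps)
    moreover have "(3 * I2 - 1) / (2 * n ^ 3) - (3 * I2 - 1) / (2 * R ^ 3) =
        (n - R) * (- ((3 * I2 - 1) / 2 * (n\<^sup>2 + n * R + R\<^sup>2) / (n ^ 3 * R ^ 3)))"
      using that R by (simp add: divide_simps) (simp add: algebra_simps eval_nat_numeral)
    ultimately show ?thesis
      unfolding amended_potential_def S_def MR by (simp add: algebra_simps)
  qed
  have S0: "S R = 0"
  proof -
    have MR: "R\<^sup>2 + I2 = M" by (simp add: M_def)
    have "S R = - (k\<^sup>2 * R) + 1 / (R * R) - (3 * I2 - 1) / 2 * (R\<^sup>2 + R * R + R\<^sup>2) / (R ^ 3 * R ^ 3)"
      unfolding S_def MR using M by simp
    also have "\<dots> = 0"
      unfolding k using R by (simp add: divide_simps) (simp add: algebra_simps eval_nat_numeral)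
    finally show ?thesis .
  qed
  have "(S has_real_derivative k\<^sup>2 * (3 * R\<^sup>2 - I2) / (2 * M) - 1 / R ^ 3 + 3 * (3 * I2 - 1) / R ^ 5) (at R)"
  proof -
    have 1: "((\<lambda>n. - (M * k\<^sup>2) * (R + n) / (2 * (n\<^sup>2 + I2))) has_real_derivative k\<^sup>2 * (3 * R\<^sup>2 - I2) / (2 * M)) (at R)"
    proof -
      have "((\<lambda>n. - (M * k\<^sup>2) * (R + n) / (2 * (n\<^sup>2 + I2))) has_real_derivative
         (- (M * k\<^sup>2) * (2 * (R\<^sup>2 + I2)) - - (M * k\<^sup>2) * (R + R) * (2 * (2 * R))) / ((2 * (R\<^sup>2 + I2)) * (2 * (R\<^sup>2 + I2)))) (at R)"
        by (rule DERIV_divide) (use nI[of R] in \<open>auto intro!: derivative_eq_intros\<close>)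
      moreover have "(- (M * k\<^sup>2) * (2 * (R\<^sup>2 + I2)) - - (M * k\<^sup>2) * (R + R) * (2 * (2 * R))) / ((2 * (R\<^sup>2 + I2)) * (2 * (R\<^sup>2 + I2)))
         = k\<^sup>2 * (3 * R\<^sup>2 - I2) / (2 * M)"
      proof -
        have "R\<^sup>2 + I2 = M" by (simp add: M_def)
        then show ?thesis
          using M by (simp add: divide_simps) (simp add: M_def algebra_simps power2_eq_square)
      qed
      ultimately show ?thesis by simp
    qed
    have 2: "((\<lambda>n. 1 / (n * R)) has_real_derivative - 1 / R ^ 3) (at R)"
      using R by (auto intro!: derivative_eq_intros simp: power3_eq_cube)
    have 3: "((\<lambda>n. (3 * I2 - 1) / 2 * (n\<^sup>2 + n * R + R\<^sup>2) / (n ^ 3 * R ^ 3)) has_real_derivative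
        - (3 * (3 * I2 - 1) / R ^ 5)) (at R)"
      using R by (auto intro!: derivative_eq_intros) (simp add: divide_simps; simp add: algebra_simps eval_nat_numeral)
    show ?thesis
      unfolding S_def using DERIV_diff[OF DERIV_add[OF 1 2] 3] by simp
  qed
  moreover have "k\<^sup>2 * (3 * R\<^sup>2 - I2) / (2 * M) - 1 / R ^ 3 + 3 * (3 * I2 - 1) / R ^ 5 =
    (2 * (R\<^sup>2)\<^sup>2 - 3 * (1 - I2) * R\<^sup>2 - 15 * (1 - 3 * I2) * I2) / (4 * R ^ 5 * M)"
    unfolding k using R M by (simp add: divide_simps) (simp add: M_def algebra_simps eval_nat_numeral)
  moreover have "(2 * (R\<^sup>2)\<^sup>2 - 3 * (1 - I2) * R\<^sup>2 - 15 * (1 - 3 * I2) * I2) / (4 * R ^ 5 * M) > 0"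
    using W R M by simp
  ultimately obtain l where l: "(S has_real_derivative l) (at R)" "l > 0" by metis
  obtain d1 where d1: "d1 > 0" "\<And>h. h > 0 \<Longrightarrow> h < d1 \<Longrightarrow> S R < S (R + h)"
    using DERIV_pos_inc_right[OF l] by blast
  obtain d2 where d2: "d2 > 0" "\<And>h. h > 0 \<Longrightarrow> h < d2 \<Longrightarrow> S (R - h) < S R"
    using DERIV_pos_inc_left[OF l] by blast
  define d where "d = min (min d1 d2) R / 2"
  have d: "d > 0" "d < d1" "d < d2" "d < R" using d1 d2 R by (auto simp: d_def)
  have "n = R" if n: "R - d \<le> n" "n \<le> R + d"
    and le: "amended_potential I2 (M\<^sup>2 * k\<^sup>2) n \<le> amended_potential I2 (M\<^sup>2 * k\<^sup>2) R" for n
  proof (rule ccontr)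
    assume "n \<noteq> R"
    moreover have "n > 0" using n d by linarith
    moreover have "S n > 0" if "n > R" using d1(2)[of "n - R"] that n d S0 by simp
    moreover have "S n < 0" if "n < R" using d2(2)[of "R - n"] that n d S0 by simp
    ultimately have "(n - R) * S n > 0"
      by (cases "n < R") (auto intro: mult_neg_neg mult_pos_pos)
    then show False using diff[OF \<open>n > 0\<close>] le by linarith
  qed
  then show ?thesis using that d by blast
qed

text \<open>The momentum fixes the norm of \<Lambda>, by orthogonality of \<open>B\<close>, and the
  axial spin momentum. In the energy balance there remain the amended potential and four nonnegative
  terms that are 0 at \<open>p\<close>; \<open>min\<close> fixes the radius, and then each term
  vanishes.\<close>

lemma energy_rigidity:
  fixes r \<Lambda> P \<xi> r0 :: "real^3"
  assumes I: "I1 > I2" "I2 > 0" and r: "r \<noteq> 0" and B: "orthogonal_matrix B"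
    and r0: "r0 \<noteq> 0" "r0 \<bullet> \<xi> = 0" "r0 $ 1 = 0"
  defines "p \<equiv> ((mat 1, r0), ((I2 + r0 \<bullet> r0) *\<^sub>R \<xi>, \<xi> \<times> r0)) :: phase"
  assumes cons: "conserved I1 I2 ((B, r), (\<Lambda>, P)) = conserved I1 I2 p"
    and min: "amended_potential I2 ((I2 + r0 \<bullet> r0)\<^sup>2 * (\<xi> \<bullet> \<xi>)) (norm r)
      \<le> amended_potential I2 ((I2 + r0 \<bullet> r0)\<^sup>2 * (\<xi> \<bullet> \<xi>)) (norm r0) \<longrightarrow> norm r = norm r0"
  shows "norm r = norm r0" "r \<bullet> \<Lambda> = 0" "r $ 1 = 0" "P = (1 / (I2 + r0 \<bullet> r0)) *\<^sub>R (\<Lambda> \<times> r)"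
    "\<Lambda> $ 1 = (I2 + r0 \<bullet> r0) * \<xi> $ 1" "B *v \<Lambda> = (I2 + r0 \<bullet> r0) *\<^sub>R \<xi>"
proof -
  define M where "M = I2 + r0 \<bullet> r0"
  have M: "M > 0" using I by (simp add: M_def add_pos_nonneg)
  have I1: "I1 > 0" using I by simp
  have L0: "M *\<^sub>R \<xi> - r0 \<times> (\<xi> \<times> r0) = I2 *\<^sub>R \<xi>"
    by (simp add: cross_cross_orthogonal r0 M_def algebra_simps)
  have c1: "B *v \<Lambda> = M *\<^sub>R \<xi>" and c2: "(\<Lambda> - r \<times> P) $ 1 = I2 * \<xi> $ 1"
    and c3: "hamiltonian2 I1 I2 ((B, r), (\<Lambda>, P)) = hamiltonian2 I1 I2 p"
  proof -
    have m: "momentum ((B, r), (\<Lambda>, P)) = momentum p" and h: "hamiltonian2 I1 I2 ((B, r), (\<Lambda>, P)) = hamiltonian2 I1 I2 p"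
      using cons by (simp_all add: conserved_def)
    show "hamiltonian2 I1 I2 ((B, r), (\<Lambda>, P)) = hamiltonian2 I1 I2 p" by (rule h)
    have "(B *v \<Lambda>, (r \<times> P - \<Lambda>) $ 1) = (mat 1 *v (M *\<^sub>R \<xi>), (r0 \<times> (\<xi> \<times> r0) - M *\<^sub>R \<xi>) $ 1)"
      using m unfolding p_def momentum_eq M_def by simp
    moreover have "(r0 \<times> (\<xi> \<times> r0) - M *\<^sub>R \<xi>) $ 1 = - (I2 * \<xi> $ 1)"
      using arg_cong[OF L0, of "\<lambda>v. v $ 1"] by simp
    ultimately show "B *v \<Lambda> = M *\<^sub>R \<xi>" "(\<Lambda> - r \<times> P) $ 1 = I2 * \<xi> $ 1" by auto
  qed
  have \<Lambda>\<Lambda>: "\<Lambda> \<bullet> \<Lambda> = M\<^sup>2 * (\<xi> \<bullet> \<xi>)"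
    using orthogonal_matrix_inner[OF B, of \<Lambda> \<Lambda>] by (simp add: c1 power2_eq_square)
  define Y where "Y = P - (1 / (r \<bullet> r + I2)) *\<^sub>R (\<Lambda> \<times> r)"
  have Y0: "\<xi> \<times> r0 - (1 / (r0 \<bullet> r0 + I2)) *\<^sub>R ((M *\<^sub>R \<xi>) \<times> r0) = 0"
    using M by (simp add: M_def cross_mult_left add.commute)
  have Hp: "hamiltonian2 I1 I2 p = (1 / I1 - 1 / I2) * (I2 * \<xi> $ 1)\<^sup>2 / 2
     + amended_potential I2 (M\<^sup>2 * (\<xi> \<bullet> \<xi>)) (norm r0)"
    unfolding p_def M_def[symmetric] energy_decomposition[OF I1 I(2) r0(1)] Y0 L0
    by (simp add: r0 power2_eq_square mult.assoc)
  define t1 where "t1 = (r \<bullet> \<Lambda>)\<^sup>2 / (2 * I2 * (r \<bullet> r + I2))"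
  define t2 where "t2 = (r \<times> Y) \<bullet> (r \<times> Y) / (2 * I2)"
  define t3 where "t3 = Y \<bullet> Y / 2"
  define t4 where "t4 = 3 / 2 * (I1 - I2) * (r $ 1)\<^sup>2 * (1 / norm r) ^ 5"
  have pos: "r \<bullet> r + I2 > 0" using I by (simp add: add_nonneg_pos)
  have t: "t1 \<ge> 0" "t2 \<ge> 0" "t3 \<ge> 0" "t4 \<ge> 0"
    using I pos by (simp_all add: t1_def t2_def t3_def t4_def)
  have "hamiltonian2 I1 I2 ((B, r), (\<Lambda>, P)) = (1 / I1 - 1 / I2) * (I2 * \<xi> $ 1)\<^sup>2 / 2
     + amended_potential I2 (M\<^sup>2 * (\<xi> \<bullet> \<xi>)) (norm r) + t1 + t2 + t3 + t4"
    unfolding energy_decomposition[OF I1 I(2) r] c2 \<Lambda>\<Lambda> t1_def t2_def t3_def t4_def Y_def by simp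
  then have sum: "amended_potential I2 (M\<^sup>2 * (\<xi> \<bullet> \<xi>)) (norm r) + t1 + t2 + t3 + t4
      = amended_potential I2 (M\<^sup>2 * (\<xi> \<bullet> \<xi>)) (norm r0)"
    using c3 Hp by linarith
  then show n: "norm r = norm r0"
    using min t unfolding M_def[symmetric] by linarith
  then have "t1 + t2 + t3 + t4 = 0" using sum by simp
  then have t0: "t1 = 0" "t3 = 0" "t4 = 0" using t by linarith+
  show s: "r \<bullet> \<Lambda> = 0" using t0(1) I pos by (simp add: t1_def)
  show "r $ 1 = 0" using t0(3) I r by (simp add: t4_def)
  have "Y = 0" using t0(2) by (simp add: t3_def)
  moreover have rr: "r \<bullet> r = r0 \<bullet> r0" using n by (simp add: norm_eq)
  ultimately show P: "P = (1 / (I2 + r0 \<bullet> r0)) *\<^sub>R (\<Lambda> \<times> r)"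
    by (simp add: Y_def add.commute)
  have "r \<times> (\<Lambda> \<times> r) = (r \<bullet> r) *\<^sub>R \<Lambda>" using s by (simp add: Lagrange)
  then have "\<Lambda> - r \<times> P = (I2 / M) *\<^sub>R \<Lambda>"
    using M unfolding P M_def[symmetric] rr
    by (simp add: cross_mult_right) (simp add: M_def vec_eq_iff field_simps)
  then have "I2 / M * \<Lambda> $ 1 = I2 * \<xi> $ 1" using c2 by simp
  then show "\<Lambda> $ 1 = (I2 + r0 \<bullet> r0) * \<xi> $ 1"
    using I(2) M by (simp add: M_def[symmetric] field_simps)
  show "B *v \<Lambda> = (I2 + r0 \<bullet> r0) *\<^sub>R \<xi>" using c1 by (simp add: M_def)
qed

section \<open>Nonlinear stability\<close>

text \<open>Both \<open>r\<close> and the equatorial part of \<Lambda> lie in the plane orthogonal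
  to \<open>e1\<close> and are orthogonal to each other, with prescribed lengths; only the sense is
  free, and \<open>sign\<close> fixes it. A rotation about \<open>e1\<close> then carries the body
  data of \<open>p\<close> to those of the point, and the spatial factor adjusts the
  attitude.\<close>

lemma rigid_orbit:
  fixes r \<Lambda> P \<xi> r0 :: "real^3"
  assumes I2: "I2 > 0" and R: "R > 0" and k: "k \<ge> 0" and sc: "s\<^sup>2 + c\<^sup>2 = 1"
    and r0: "r0 = vector [0, R, 0]" and \<xi>: "\<xi> = k *\<^sub>R vector [s, 0, c]"
  defines "M \<equiv> I2 + R\<^sup>2"
  assumes B: "rotation_matrix B" and nr: "norm r = R" and r\<Lambda>: "r \<bullet> \<Lambda> = 0" and r1: "r $ 1 = 0"
    and P: "P = (1 / M) *\<^sub>R (\<Lambda> \<times> r)" and \<Lambda>1: "\<Lambda> $ 1 = M * \<xi> $ 1" and B\<Lambda>: "B *v \<Lambda> = M *\<^sub>R \<xi>"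
    and sign: "c = 0 \<or> 0 \<le> c * (r \<times> \<Lambda>) $ 1"
  defines "p \<equiv> ((mat 1, r0), (M *\<^sub>R \<xi>, \<xi> \<times> r0)) :: phase"
  shows "(r \<times> \<Lambda>) $ 1 = R * M * k * c" "norm \<Lambda> = norm (M *\<^sub>R \<xi>)" "norm P = norm (\<xi> \<times> r0)"
    "\<exists>g\<in>stabilizer_axi (momentum p). cotangent_lift g p = ((B, r), (\<Lambda>, P))"
proof -
  have M: "M > 0" using I2 by (simp add: M_def add_pos_nonneg)
  define f where "f = M * k"
  define \<tau> where "\<tau> = (r \<times> \<Lambda>) $ 1"
  have f: "f \<ge> 0" using M k by (simp add: f_def)
  have rr: "(r $ 2)\<^sup>2 + (r $ 3)\<^sup>2 = R\<^sup>2"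
    using nr r1 by (simp add: norm_eq_sqrt_inner inner_vec_def sum_3 power2_eq_square real_sqrt_eq_iff)
      (metis abs_of_pos R power2_eq_square real_sqrt_abs real_sqrt_eq_iff)
  have s1: "\<Lambda> $ 1 = f * s" by (simp add: \<Lambda>1 \<xi> f_def)
  have ort: "r $ 2 * \<Lambda> $ 2 + r $ 3 * \<Lambda> $ 3 = 0"
    using r\<Lambda> r1 by (simp add: inner_vec_def sum_3)
  have oB: "orthogonal_matrix B" using B by (simp add: rotation_matrix_def)
  have M\<xi>: "(M *\<^sub>R \<xi>) \<bullet> (M *\<^sub>R \<xi>) = f\<^sup>2"
  proof -
    have "(M *\<^sub>R \<xi>) \<bullet> (M *\<^sub>R \<xi>) = f\<^sup>2 * (s\<^sup>2 + c\<^sup>2)"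
      by (simp add: \<xi> f_def inner_vec_def sum_3 algebra_simps power2_eq_square)
    then show ?thesis using sc by simp
  qed
  have \<Lambda>\<Lambda>: "\<Lambda> \<bullet> \<Lambda> = f\<^sup>2"
    using orthogonal_matrix_inner[OF oB, of \<Lambda> \<Lambda>] M\<xi> by (simp add: B\<Lambda>)
  then show n\<Lambda>: "norm \<Lambda> = norm (M *\<^sub>R \<xi>)"
    using M\<xi> by (simp only: norm_eq)
  have \<Lambda>23: "(\<Lambda> $ 2)\<^sup>2 + (\<Lambda> $ 3)\<^sup>2 = (f * c)\<^sup>2"
  proof -
    have "(\<Lambda> $ 1)\<^sup>2 + (\<Lambda> $ 2)\<^sup>2 + (\<Lambda> $ 3)\<^sup>2 = f\<^sup>2"
      using \<Lambda>\<Lambda> by (simp add: inner_vec_def sum_3 power2_eq_square)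
    then show ?thesis using sc unfolding s1 by algebra
  qed
  have \<tau>: "\<tau> = r $ 2 * \<Lambda> $ 3 - r $ 3 * \<Lambda> $ 2"
    by (simp add: \<tau>_def cross_components mult.commute)
  \<comment> \<open>For orthogonal vectors in the plane the square of the determinant is the product
    of the squared lengths.\<close>
  have \<tau>2: "\<tau>\<^sup>2 = (R * f * c)\<^sup>2"
    using rr ort \<Lambda>23 unfolding \<tau> by algebra
  have \<tau>eq: "\<tau> = R * f * c"
  proof (cases "c = 0")
    case True then show ?thesis using \<tau>2 by simp
  next
    case False
    then have "0 \<le> c * \<tau>" using sign by (simp add: \<tau>_def)
    have "\<tau> = R * f * c \<or> \<tau> = - (R * f * c)"
      using \<tau>2 by (simp only: power2_eq_iff)
    then show ?thesis
    proof
      assume neg: "\<tau> = - (R * f * c)"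
      then have "c * \<tau> = - (R * f * c\<^sup>2)" by (simp add: power2_eq_square)
      moreover have "R * f * c\<^sup>2 \<ge> 0" using R f by simp
      ultimately have "R * f * c\<^sup>2 = 0" using \<open>0 \<le> c * \<tau>\<close> by linarith
      then show ?thesis using neg False by simp
    qed
  qed
  then show "(r \<times> \<Lambda>) $ 1 = R * M * k * c" by (simp add: \<tau>_def f_def mult.assoc)
  have "R\<^sup>2 * \<Lambda> $ 2 = R\<^sup>2 * (- (r $ 3) / R * (f * c))" "R\<^sup>2 * \<Lambda> $ 3 = R\<^sup>2 * (r $ 2 / R * (f * c))"
  proof -
    have "R\<^sup>2 * \<Lambda> $ 2 = - (r $ 3) * \<tau>" "R\<^sup>2 * \<Lambda> $ 3 = r $ 2 * \<tau>"
      using rr ort unfolding \<tau> by algebra+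
    then show "R\<^sup>2 * \<Lambda> $ 2 = R\<^sup>2 * (- (r $ 3) / R * (f * c))" "R\<^sup>2 * \<Lambda> $ 3 = R\<^sup>2 * (r $ 2 / R * (f * c))"
      using R by (simp_all add: \<tau>eq power2_eq_square)
  qed
  moreover have "R\<^sup>2 \<noteq> 0" using R by simp
  ultimately have s23: "\<Lambda> $ 2 = - (r $ 3) / R * (f * c)" "\<Lambda> $ 3 = r $ 2 / R * (f * c)"
    using mult_left_cancel[of "R\<^sup>2"] by blast+
  \<comment> \<open>The rotation of the equatorial plane that takes the direction of
    \<open>r0\<close> to that of \<open>r\<close>.\<close>
  define A :: "real^2^2" where "A = vector [vector [r $ 2 / R, - (r $ 3) / R], vector [r $ 3 / R, r $ 2 / R]]"
  define N where "N = block_diag 1 A"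
  have AA: "(r $ 2 / R)\<^sup>2 + (r $ 3 / R)\<^sup>2 = 1"
    using rr R by (simp add: power_divide add_divide_distrib[symmetric])
  have oA: "orthogonal_matrix A"
    unfolding orthogonal_matrix using AA
    by (simp add: A_def matrix_matrix_mult_def transpose_def mat_def vec_eq_iff forall_2 sum_2 power2_eq_square mult.commute)
  have oN: "orthogonal_matrix N"
    unfolding orthogonal_matrix using AA
    by (simp add: N_def block_diag_def A_def matrix_matrix_mult_def transpose_def mat_def vec_eq_iff forall_3 sum_3
        power2_eq_square mult.commute)
  have dN: "det N = 1"
    using AA by (simp add: N_def block_diag_def A_def det_3 power2_eq_square)
  have rN: "rotation_matrix N" using oN dN by (simp add: rotation_matrix_def)
  have Nr: "N *v r0 = r"
    using R r1 by (simp add: N_def block_diag_def A_def r0 matrix_vector_mult_def vec_eq_iff forall_3 sum_3)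
  have N\<Lambda>: "N *v (M *\<^sub>R \<xi>) = \<Lambda>"
    using s1 s23 by (simp add: N_def block_diag_def A_def \<xi> f_def matrix_vector_mult_def vec_eq_iff forall_3 sum_3
        algebra_simps)
  have NP: "N *v (\<xi> \<times> r0) = P"
  proof -
    have "N *v (\<xi> \<times> r0) = (1 / M) *\<^sub>R ((N *v (M *\<^sub>R \<xi>)) \<times> (N *v r0))"
      unfolding cross_rotation_matrix[OF rN] using M by (simp add: cross_mult_left matrix_vector_scaleR)
    then show ?thesis by (simp only: N\<Lambda> Nr P)
  qed
  show "norm P = norm (\<xi> \<times> r0)"
    using orthogonal_matrix_inner[OF oN, of "\<xi> \<times> r0" "\<xi> \<times> r0"] unfolding NP by (simp only: norm_eq)
  have rBN: "rotation_matrix (B ** N)" by (rule rotation_matrix_mult[OF B rN])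
  have "(B ** N, N) \<in> G_axi"
    using rBN oA by (auto simp: G_axi_def Gamma_axi_def N_def)
  moreover have "chi_axi N = 1"
    using AA by (simp add: chi_axi_def N_def block_diag_def A_def det_2 power2_eq_square)
  moreover have "(B ** N) *v (M *\<^sub>R \<xi>) = M *\<^sub>R \<xi>"
    by (simp only: matrix_vector_mul_assoc[symmetric] N\<Lambda> B\<Lambda>)
  ultimately have "(B ** N, N) \<in> stabilizer_axi (momentum p)"
    by (simp add: stabilizer_axi_def coadjoint_def p_def momentum_eq)
  moreover have "cotangent_lift (B ** N, N) p = ((B, r), (\<Lambda>, P))"
  proof -
    have "B ** N ** transpose N = B"
      using oN by (simp add: orthogonal_matrix_def flip: matrix_mul_assoc)
    then show ?thesis
      using cotangent_lift_eq[of "B ** N" N "mat 1" r0 "M *\<^sub>R \<xi>" "\<xi> \<times> r0"] rBN oN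
      by (simp add: p_def dN Nr N\<Lambda> NP rotation_matrix_def orthogonal_matrix_id del: scaleR_scaleR)
  qed
  ultimately show "\<exists>g\<in>stabilizer_axi (momentum p). cotangent_lift g p = ((B, r), (\<Lambda>, P))" by blast
qed

text \<open>The vector field is made bounded and Lipschitz by projecting its argument to a ball and by
  cutting off \<open>1 / norm r\<close>.\<close>

lemma truncated_solution:
  assumes "d > 0" "K \<ge> 0"
  obtains z where "z 0 = z0" "continuous_on UNIV z"
    "\<And>t. norm (z t) \<le> K \<Longrightarrow> d \<le> norm (snd (fst (z t))) \<Longrightarrow>
       (z has_vector_derivative ham_vf I1 I2 (1 / norm (snd (fst (z t)))) (z t)) (at t)"
proof -
  define c where "c = (closest_point (cball 0 K) :: phase \<Rightarrow> phase)"
  define f where "f = (\<lambda>y. ham_vf I1 I2 (1 / max d (norm (snd (fst (c y))))) (c y))"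
  have c: "bounded_lipschitz c" unfolding c_def by (rule bl_closest_point_cball[OF assms(2)])
  note cf = bl_linear[OF bounded_linear_fst c] and cs = bl_linear[OF bounded_linear_snd c]
  note comps = bl_linear[OF bounded_linear_fst cf] bl_linear[OF bounded_linear_snd cf]
    bl_linear[OF bounded_linear_fst cs] bl_linear[OF bounded_linear_snd cs]
  have "bounded_lipschitz f"
    unfolding f_def ham_vf_def body_velocity_def force_def
    by (intro bl_Pair bl_matrix_mult bl_add bl_diff bl_cross bl_scaleR bl_mult bl_power bl_const comps
        bl_linear[OF bounded_linear_hat] bl_linear[OF bounded_linear_inv_inertia]
        bl_linear[OF bounded_linear_vec_nth] bl_inverse_max_norm assms(1))
  then obtain C where C: "C > 0" "\<And>x. norm (f x) \<le> C" "\<And>x y. norm (f x - f y) \<le> C * norm (x - y)"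
    using bounded_lipschitzE by metis
  obtain z where z: "z 0 = z0" "\<And>t. (z has_vector_derivative f (z t)) (at t)"
    using lipschitz_ode_global[OF C(3) C(2) C(1), of z0] by metis
  show ?thesis
  proof
    fix t assume "norm (z t) \<le> K" "d \<le> norm (snd (fst (z t)))"
    moreover from this have "c (z t) = z t"
      unfolding c_def by (intro closest_point_self) simp
    ultimately have "f (z t) = ham_vf I1 I2 (1 / norm (snd (fst (z t)))) (z t)"
      by (simp add: f_def max_def)
    then show "(z has_vector_derivative ham_vf I1 I2 (1 / norm (snd (fst (z t)))) (z t)) (at t)"
      using z(2)[of t] by simp
  next
    show "continuous_on UNIV z"
      using z(2) by (auto intro!: continuous_at_imp_continuous_on has_vector_derivative_continuous)
  qed (rule z(1))
qed

text \<open>The rows are unit vectors and there are three of them. A crude bound is enough, as only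
  boundedness of the attitude matters.\<close>

lemma norm_rotation_le:
  fixes B :: "real^3^3"
  assumes "orthogonal_matrix B"
  shows "norm B \<le> 3"
proof -
  have "norm (B $ i) = 1" for i
  proof -
    have "(B ** transpose B) $ i $ i = (mat 1 :: real^3^3) $ i $ i"
      using assms by (simp add: orthogonal_matrix_def)
    then have "B $ i \<bullet> B $ i = 1"
      by (simp add: matrix_matrix_mult_def transpose_def mat_def inner_vec_def)
    then show ?thesis by (simp add: norm_eq_sqrt_inner)
  qed
  moreover have "norm B \<le> (\<Sum>i\<in>UNIV. norm (B $ i))"
    unfolding norm_vec_def by (rule L2_set_le_sum) simp
  ultimately show ?thesis by (simp add: sum_3)
qed

lemma closed_rotations: "closed {z :: phase. rotation_matrix (fst (fst z))}"
proof -
  have "continuous_on UNIV (\<lambda>z::phase. transpose (fst (fst z)) ** fst (fst z))"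
    by (intro bounded_bilinear.continuous_on[OF bounded_bilinear_matrix_mult]
        bounded_linear.continuous_on[OF bounded_linear_transpose] continuous_intros)
  moreover have "continuous_on UNIV (\<lambda>z::phase. det (fst (fst z)))"
    by (intro continuous_on_det continuous_intros)
  ultimately show ?thesis
    unfolding rotation_matrix_def orthogonal_matrix
    by (intro closed_Collect_conj closed_Collect_eq) (auto intro: continuous_on_const)
qed

lemma continuous_on_conserved:
  assumes "I1 \<noteq> 0" "I2 \<noteq> 0" "\<And>z. z \<in> S \<Longrightarrow> snd (fst z) \<noteq> 0"
  shows "continuous_on S (conserved I1 I2)"
proof -
  have "conserved I1 I2 = (\<lambda>z. let L = fst (snd z) - snd (fst z) \<times> snd (snd z) in
     ((fst (fst z) *v fst (snd z), - (L $ 1)),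
      (L \<bullet> inv_inertia I1 I2 L + snd (snd z) \<bullet> snd (snd z)) / 2
       + potential2 I1 I2 (snd (fst z))))"
  proof (rule ext)
    fix z :: phase
    obtain B r \<Lambda> P where "z = ((B, r), (\<Lambda>, P))" by (metis surj_pair)
    then show "conserved I1 I2 z = (let L = fst (snd z) - snd (fst z) \<times> snd (snd z) in
     ((fst (fst z) *v fst (snd z), - (L $ 1)),
      (L \<bullet> inv_inertia I1 I2 L + snd (snd z) \<bullet> snd (snd z)) / 2
       + potential2 I1 I2 (snd (fst z))))"
      by (simp add: conserved_def momentum_eq hamiltonian2_eq[OF assms(1,2)] Let_def)
  qed
  then show ?thesis
    unfolding Let_def potential2_def using assms(3)
    by (auto intro!: continuous_intros continuous_on_cross
        bounded_bilinear.continuous_on[OF bounded_bilinear_matrix_vector]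
        bounded_linear.continuous_on[OF bounded_linear_inv_inertia])
qed

lemma Gmu_stable_hyperbolic:
  fixes r0 \<xi> :: "real^3"
  assumes I: "I1 > I2" "I2 > 0" and R: "R > 0" and k: "k > 0" and sc: "s\<^sup>2 + c\<^sup>2 = 1"
    and r0: "r0 = vector [0, R, 0]" and \<xi>: "\<xi> = k *\<^sub>R vector [s, 0, c]"
    and keq: "k\<^sup>2 = (2 * R\<^sup>2 + 3 - 9 * I2) / (2 * R ^ 5)"
    and W: "2 * (R\<^sup>2)\<^sup>2 - 3 * (1 - I2) * R\<^sup>2 - 15 * (1 - 3 * I2) * I2 > 0"
  shows "Gmu_stable I1 I2 ((mat 1, r0), ((I2 + r0 \<bullet> r0) *\<^sub>R \<xi>, \<xi> \<times> r0))"
proof -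
  define M where "M = I2 + R\<^sup>2"
  have M: "M > 0" using I by (simp add: M_def add_pos_nonneg)
  have I0: "I1 \<noteq> 0" "I2 \<noteq> 0" using I by auto
  have rr0: "r0 \<bullet> r0 = R\<^sup>2" "norm r0 = R" "r0 \<noteq> 0" "r0 $ 1 = 0" "r0 \<bullet> \<xi> = 0"
    using R by (auto simp: r0 \<xi> norm_eq_sqrt_inner inner_vec_def sum_3 power2_eq_square vec_eq_iff forall_3)
  have Meq: "I2 + r0 \<bullet> r0 = M" by (simp add: rr0 M_def)
  have \<xi>\<xi>: "\<xi> \<bullet> \<xi> = k\<^sup>2"
  proof -
    have "\<xi> \<bullet> \<xi> = k\<^sup>2 * (s\<^sup>2 + c\<^sup>2)"
      by (simp add: \<xi> inner_vec_def sum_3 algebra_simps power2_eq_square)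
    then show ?thesis using sc by simp
  qed
  define p :: phase where "p = ((mat 1, r0), (M *\<^sub>R \<xi>, \<xi> \<times> r0))"
  have rot1: "rotation_matrix (mat 1 :: real^3^3)"
    by (simp add: rotation_matrix_def orthogonal_matrix_id)
  obtain d where d: "0 < d" "d < R"
    and min: "\<And>n. \<lbrakk>R - d \<le> n; n \<le> R + d; amended_potential I2 (M\<^sup>2 * k\<^sup>2) n \<le> amended_potential I2 (M\<^sup>2 * k\<^sup>2) R\<rbrakk>
       \<Longrightarrow> n = R"
    using amended_potential_strict_min[OF I(2) R keq W, folded M_def] by metis
  \<comment> \<open>The constant 4 exceeds the bound 3 for rotations, and the other summands
    dominate the norms on the orbit, so that orbit points satisfy the bounds strictly.\<close>
  define K where "K = 4 + norm (M *\<^sub>R \<xi>) + norm (\<xi> \<times> r0)"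
  \<comment> \<open>If \<open>c = 0\<close> the constrained quantity is 0 throughout and -1 makes
    the condition void. Otherwise it equals \<open>R * M * k * c^2 > 0\<close> on the level set, and
    the threshold 0 excludes the opposite sense of \<Lambda>, so that rotations about
    \<open>e1\<close> suffice.\<close>
  define \<delta> where "\<delta> = (if c = 0 then -1 else 0 :: real)"
  define D where "D = {z :: phase. norm (fst (fst z)) < K \<and> R - d < norm (snd (fst z)) \<and> norm (snd (fst z)) < R + d \<and>
     norm (fst (snd z)) < K \<and> norm (snd (snd z)) < K \<and> \<delta> < c * (snd (fst z) \<times> fst (snd z)) $ 1}"
  define D' where "D' = {z :: phase. norm (fst (fst z)) \<le> K \<and> R - d \<le> norm (snd (fst z)) \<and> norm (snd (fst z)) \<le> R + d \<and>
     norm (fst (snd z)) \<le> K \<and> norm (snd (snd z)) \<le> K \<and> \<delta> \<le> c * (snd (fst z) \<times> fst (snd z)) $ 1}"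
  define S where "S = {z \<in> D'. rotation_matrix (fst (fst z))}"
  have openD: "open D"
    unfolding D_def by (intro open_Collect_conj open_Collect_less continuous_intros continuous_on_cross)
  have closedD': "closed D'"
    unfolding D'_def by (intro closed_Collect_conj closed_Collect_le continuous_intros continuous_on_cross)
  have DD': "D \<subseteq> D'" by (auto simp: D_def D'_def)
  have ne0: "snd (fst z) \<noteq> 0" if "z \<in> D'" for z
    using that d by (auto simp: D'_def)
  \<comment> \<open>This bounds the norm in the product space on all of \<open>D'\<close>; it is the
    radius of the ball to which the vector field is truncated.\<close>
  define K' where "K' = K + (R + d) + (K + K)"
  have normD': "norm z \<le> K'" if "z \<in> D'" for z
  proof -
    have "norm z \<le> (norm (fst (fst z)) + norm (snd (fst z))) + (norm (fst (snd z)) + norm (snd (snd z)))"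
      using norm_Pair_le[of "fst z" "snd z"] norm_Pair_le[of "fst (fst z)" "snd (fst z)"]
        norm_Pair_le[of "fst (snd z)" "snd (snd z)"] by simp
    then show ?thesis using that by (simp add: D'_def K'_def)
  qed
  have "compact S"
  proof -
    have "S = D' \<inter> {z. rotation_matrix (fst (fst z))}" by (auto simp: S_def)
    then have "closed S" using closedD' closed_rotations by (simp add: closed_Int)
    moreover have "bounded S"
      unfolding bounded_iff by (intro exI[of _ K'] ballI normD') (simp add: S_def)
    ultimately show ?thesis by (simp add: compact_eq_bounded_closed)
  qed
  \<comment> \<open>Points of the level set in the closed region lie strictly inside it. A curve on
    a nearby level can therefore not touch the boundary.\<close>
  have level: "z \<in> D \<and> (\<exists>g\<in>stabilizer_axi (momentum p). cotangent_lift g p = z)"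
    if "z \<in> S" "conserved I1 I2 z = conserved I1 I2 p" for z
  proof -
    obtain B r \<Lambda> P where z: "z = ((B, r), (\<Lambda>, P))" by (metis surj_pair)
    have B: "rotation_matrix B" and zD: "z \<in> D'" using that(1) by (simp_all add: S_def z)
    have oB: "orthogonal_matrix B" using B by (simp add: rotation_matrix_def)
    have r: "r \<noteq> 0" using ne0[OF zD] by (simp add: z)
    have min': "amended_potential I2 ((I2 + r0 \<bullet> r0)\<^sup>2 * (\<xi> \<bullet> \<xi>)) (norm r)
      \<le> amended_potential I2 ((I2 + r0 \<bullet> r0)\<^sup>2 * (\<xi> \<bullet> \<xi>)) (norm r0) \<longrightarrow> norm r = norm r0"
      using min[of "norm r"] zD unfolding Meq \<xi>\<xi> rr0(2) by (simp add: D'_def z)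
    have "conserved I1 I2 ((B, r), (\<Lambda>, P)) =
        conserved I1 I2 ((mat 1, r0), ((I2 + r0 \<bullet> r0) *\<^sub>R \<xi>, \<xi> \<times> r0))"
      using that(2) by (simp add: z p_def Meq)
    note rig = energy_rigidity[OF I r oB rr0(3) rr0(5) rr0(4) this min', unfolded Meq rr0(2)]
    have sign: "c = 0 \<or> 0 \<le> c * (r \<times> \<Lambda>) $ 1"
      using zD by (auto simp: D'_def z \<delta>_def split: if_splits)
    note orb = rigid_orbit[OF I(2) R less_imp_le[OF k] sc r0 \<xi> B rig(1) rig(2) rig(3) rig(4)[unfolded M_def]
        rig(5)[unfolded M_def] rig(6)[unfolded M_def] sign, folded M_def p_def]
    have "R * M * k * (c * c) > 0" if "c \<noteq> 0"
    proof (rule mult_pos_pos)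
      show "0 < R * M * k" using R M k by simp
      show "0 < c * c" using that by (metis not_real_square_gt_zero)
    qed
    then have "\<delta> < c * (r \<times> \<Lambda>) $ 1"
      unfolding orb(1) by (auto simp: \<delta>_def mult_ac)
    moreover have "norm B < K" "norm \<Lambda> < K" "norm P < K"
      using norm_rotation_le[OF oB] orb(2,3) norm_ge_zero[of "M *\<^sub>R \<xi>"] norm_ge_zero[of "\<xi> \<times> r0"]
      unfolding K_def by linarith+
    ultimately have "z \<in> D" using rig(1) d by (simp add: D_def z)
    then show ?thesis using orb(4) by (simp add: z p_def)
  qed
  have pS: "p \<in> S"
  proof -
    have "norm (mat 1 :: real^3^3) \<le> K"
      using norm_rotation_le[OF orthogonal_matrix_id] norm_ge_zero[of "M *\<^sub>R \<xi>"]
        norm_ge_zero[of "\<xi> \<times> r0"]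
      unfolding K_def by linarith
    moreover have "\<delta> \<le> c * (r0 \<times> (M *\<^sub>R \<xi>)) $ 1"
    proof -
      have "c * (r0 \<times> (M *\<^sub>R \<xi>)) $ 1 = R * M * k * (c * c)"
        by (simp add: r0 \<xi> cross_components mult_ac)
      moreover have "0 \<le> R * M * k * (c * c)" using R M k by simp
      ultimately show ?thesis by (simp only: \<delta>_def split: if_split) auto
    qed
    moreover have "norm (M *\<^sub>R \<xi>) \<le> K" "norm (\<xi> \<times> r0) \<le> K"
      using norm_ge_zero[of "M *\<^sub>R \<xi>"] norm_ge_zero[of "\<xi> \<times> r0"] unfolding K_def by linarith+
    ultimately show ?thesis
      using d rot1 rr0(2) by (simp add: S_def D'_def p_def)
  qed
  then have pD: "p \<in> D" using level by blast
  have pphase: "p \<in> phase_space" using rot1 rr0(3) by (simp add: phase_space_iff p_def)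
  have "Gmu_stable I1 I2 p"
    unfolding Gmu_stable_def
  proof (intro allI impI, elim conjE)
    fix U assume orbit: "(\<lambda>g. cotangent_lift g p) ` stabilizer_axi (momentum p)
             \<subseteq> (top_of_set phase_space) interior_of U"
    obtain O' where O': "open O'" "phase_space \<inter> O' = (top_of_set phase_space) interior_of U"
      using openin_interior_of[of "top_of_set phase_space" U] unfolding openin_open by metis
    have OU: "phase_space \<inter> O' \<subseteq> U" unfolding O'(2) by (rule interior_of_subset)
    define N where "N = O' \<inter> D"
    have N: "open N" "N \<subseteq> D" using O'(1) openD by (auto simp: N_def)
    obtain e where e: "e > 0"
      "\<And>x. x \<in> S \<Longrightarrow> dist (conserved I1 I2 x) (conserved I1 I2 p) < e \<Longrightarrow> x \<in> N"
    proof (rule compact_level_neighbourhood[OF \<open>compact S\<close> _ N(1)])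
      show "continuous_on S (conserved I1 I2)"
        by (rule continuous_on_conserved[OF I0]) (auto simp: S_def ne0)
      show "x \<in> N" if "x \<in> S" "conserved I1 I2 x = conserved I1 I2 p" for x
      proof -
        from level[OF that] have "x \<in> D" "x \<in> (top_of_set phase_space) interior_of U"
          using orbit by auto
        then show ?thesis using O'(2) by (auto simp: N_def)
      qed
    qed metis
    define V where "V = {z \<in> phase_space \<inter> D. dist (conserved I1 I2 z) (conserved I1 I2 p) < e}"
    \<comment> \<open>The equation is required only while the curve is in \<open>D'\<close>, so this
      applies to the truncated solution, for existence, and to every true evolution, for
      confinement.\<close>
    have trap: "z t \<in> phase_space \<inter> N"
      if z0: "z 0 \<in> V" and cont: "continuous_on UNIV z"
        and ode: "\<And>t. z t \<in> D' \<Longrightarrow>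
          (z has_vector_derivative ham_vf I1 I2 (1 / norm (snd (fst (z t)))) (z t)) (at t)" for z t
    proof -
      have "z t \<in> {y \<in> N. y \<in> phase_space}"
      proof (rule trapped[OF cont openD])
        show "z 0 \<in> D" using z0 by (simp add: V_def)
        fix t assume D: "\<And>v. 0 \<le> v \<Longrightarrow> v < 1 \<Longrightarrow> z (v * t) \<in> D"
        define T where "T = (\<lambda>v. v * t) ` {0..1}"
        have T: "connected T" "convex T" "0 \<in> T" "t \<in> T"
          unfolding T_def
          by (auto intro!: connected_continuous_image continuous_intros convex_linear_image
              simp: image_iff linear_iff algebra_simps)
        have cz: "continuous_on {0..1} (\<lambda>v. z (v * t))"
          by (rule continuous_on_compose2[OF cont]) (auto intro!: continuous_intros)
        \<comment> \<open>Membership in \<open>D\<close> is known for \<open>v < 1\<close> only;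
          continuity and closedness of \<open>D'\<close> supply the endpoint, where the equation
          still holds.\<close>
        have D01: "z (v * t) \<in> D'" if v: "v \<in> {0..1}" for v
        proof -
          have cl: "closure {0..<1::real} = {0..1}" by simp
          have "z (w * t) \<in> D'" if "w \<in> {0..<1}" for w
            using D[of w] DD' that by (simp add: subset_iff del: split_paired_All)
          then have "(\<lambda>v. z (v * t)) ` {0..<1} \<subseteq> D'" by blast
          then have "(\<lambda>v. z (v * t)) ` closure {0..<1} \<subseteq> D'"
            using cz closedD' by (intro image_closure_subset) (simp_all only: cl)
          then have "(\<lambda>v. z (v * t)) ` {0..1} \<subseteq> D'" by (simp only: cl)
          then show ?thesis using v by blast
        qed
        then have DT: "z u \<in> D'" if "u \<in> T" for u using that by (auto simp: T_def)
        have B': "((\<lambda>u. fst (fst (z u))) has_vector_derivative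
           fst (fst (z u)) ** hat (body_velocity I1 I2 (z u))) (at u)" if "u \<in> T" for u
          using bounded_linear.has_vector_derivative[OF bounded_linear_fst
              bounded_linear.has_vector_derivative[OF bounded_linear_fst ode[OF DT[OF that]]]]
          by (simp add: ham_vf_def)
        have rot0: "rotation_matrix (fst (fst (z 0)))"
          using z0 by (simp add: V_def phase_space_iff)
        have ortho: "orthogonal_matrix (fst (fst (z u)))" if "u \<in> T" for u
          by (rule skew_flow_orthogonal[OF T(1,3) _ that B']) (use rot0 in \<open>simp add: rotation_matrix_def\<close>)
        have contB: "continuous_on T (\<lambda>u. fst (fst (z u)))"
          by (intro continuous_intros continuous_on_subset[OF cont]) auto
        have rot: "rotation_matrix (fst (fst (z t)))"
          using continuous_orthogonal_rotation[of T "\<lambda>u. fst (fst (z u))" 0 t] T(1,3,4) contB rot0 ortho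
          by blast
        have "((\<lambda>u. conserved I1 I2 (z u)) has_vector_derivative 0) (at u within T)" if "u \<in> T" for u
          by (rule has_vector_derivative_at_within[OF conserved_deriv[where t = u, OF I0 ne0[OF DT[OF that]]
                ode[OF DT[OF that]]]])
        then obtain w where "\<And>u. u \<in> T \<Longrightarrow> conserved I1 I2 (z u) = w"
          using has_vector_derivative_zero_constant[OF T(2)] by metis
        then have "conserved I1 I2 (z t) = conserved I1 I2 (z 0)" using T(3,4) by simp
        then have "dist (conserved I1 I2 (z t)) (conserved I1 I2 p) < e"
          using z0 by (simp add: V_def)
        moreover have "z t \<in> S" using DT[OF T(4)] rot by (simp add: S_def)
        ultimately show "z t \<in> {y \<in> N. y \<in> phase_space}"
          using e(2) rot ne0[OF DT[OF T(4)]] by (simp add: phase_space_iff)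
      qed (use N(2) in auto)
      then show ?thesis by simp
    qed
    show "\<exists>V\<subseteq>phase_space. p \<in> (top_of_set phase_space) interior_of V \<and>
               (\<forall>z0 \<in> V. (\<exists>z. evolution I1 I2 z \<and> z 0 = z0) \<and>
                  (\<forall>z. evolution I1 I2 z \<and> z 0 = z0 \<longrightarrow> (\<forall>t. z t \<in> U)))"
    proof (intro exI[of _ V] conjI ballI allI impI)
      show "V \<subseteq> phase_space" by (auto simp: V_def)
      have "openin (top_of_set phase_space) V"
      proof -
        have "continuous_on phase_space (conserved I1 I2)"
          by (rule continuous_on_conserved[OF I0]) (simp add: phase_space_iff)
        then have "openin (top_of_set phase_space) (phase_space \<inter> (conserved I1 I2) -` ball (conserved I1 I2 p) e)"
          by (rule continuous_openin_preimage_gen) simp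
        moreover have "V = (phase_space \<inter> (conserved I1 I2) -` ball (conserved I1 I2 p) e) \<inter> (phase_space \<inter> D)"
          by (auto simp: V_def dist_commute)
        ultimately show ?thesis
          using openin_Int[of "top_of_set phase_space"] openin_open_Int[OF openD, of phase_space] by metis
      qed
      moreover have "p \<in> V" using pD pphase e(1) by (simp add: V_def)
      ultimately show "p \<in> (top_of_set phase_space) interior_of V"
        by (simp add: interior_of_openin)
    next
      fix z0 assume z0: "z0 \<in> V"
      have "p \<in> D'" using pS by (simp add: S_def)
      then have "R - d > 0" "K' \<ge> 0"
        using d order_trans[OF norm_ge_zero normD'] by simp_all
      from truncated_solution[OF this, of z0 I1 I2]
      obtain z where z: "z 0 = z0" "\<And>t. norm (z t) \<le> K' \<Longrightarrow> R - d \<le> norm (snd (fst (z t))) \<Longrightarrow>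
           (z has_vector_derivative ham_vf I1 I2 (1 / norm (snd (fst (z t)))) (z t)) (at t)"
        "continuous_on UNIV z"
        by metis
      have ode: "(z has_vector_derivative ham_vf I1 I2 (1 / norm (snd (fst (z t)))) (z t)) (at t)"
        if "z t \<in> D'" for t
        using z(2) normD'[OF that] that by (simp add: D'_def)
      have "z t \<in> phase_space \<inter> N" for t
        using trap[of z t] z0 z(1,3) ode by blast
      then show "\<exists>z. evolution I1 I2 z \<and> z 0 = z0"
        unfolding evolution_iff[OF I0] using z(1) ode N(2) DD' by blast
    next
      fix z0 z t assume z0: "z0 \<in> V" and z: "evolution I1 I2 z \<and> z 0 = z0"
      then have ode: "(z has_vector_derivative ham_vf I1 I2 (1 / norm (snd (fst (z t)))) (z t)) (at t)" for t
        by (simp add: evolution_iff[OF I0])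
      then have "continuous_on UNIV z"
        by (auto intro!: continuous_at_imp_continuous_on has_vector_derivative_continuous)
      then have "z t \<in> phase_space \<inter> N"
        using trap[of z t] z0 z ode by blast
      then show "z t \<in> U" using OU by (auto simp: N_def)
    qed
  qed
  then show ?thesis by (simp add: p_def Meq)
qed

unbundle no cross3_syntax

theorem proposition4p11:
  fixes I1 I2 R \<theta> \<eta> :: real and \<xi> Rvec :: "real^3" and p :: phase
  assumes inertia: "0 < I1" "I1 < 1/2" "0 < I2" "I2 < 1/2" "I1 + 2 * I2 = 1"
    and R: "R > 0"
    and theta: "\<theta> \<in> {-pi<..pi}" "\<theta> \<noteq> pi / 2"
    and xi: "\<xi> = norm \<xi> *\<^sub>R vector [sin \<theta>, 0, cos \<theta>]"
    and Rvec: "Rvec = vector [0, R, 0]"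
    and norm_xi: "(norm \<xi>)\<^sup>2 = (2 * R\<^sup>2 + 3 - 9 * I2) / (2 * R ^ 5)"
    and eta: "\<eta> = - ((I2 - I1) / I1) * norm \<xi> * sin \<theta>"
    and p: "p = point_of I1 I2 (mat 1, Rvec) (\<xi>, \<eta>)"
    and large: "0 \<le> 3 + 102 * I2 - 351 * I2\<^sup>2 \<Longrightarrow>
      R\<^sup>2 > 1/2 * (3 * (1 - I2) + sqrt (3 + 102 * I2 - 351 * I2\<^sup>2))"
    \<comment> \<open>corrected form of the preceding bound, which alone does not suffice:
      beyond it the radial second variation is positive\<close>
    and large': "0 \<le> 9 + 102 * I2 - 351 * I2\<^sup>2 \<Longrightarrow>
      R\<^sup>2 > 1/4 * (3 * (1 - I2) + sqrt (9 + 102 * I2 - 351 * I2\<^sup>2))"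
  shows "relative_equilibrium I1 I2 p (\<xi>, \<eta>) \<and>
    (I1 > I2 \<longrightarrow> Gmu_stable I1 I2 p) \<and>
    (I1 < I2 \<and> \<theta> \<noteq> - pi / 2 \<longrightarrow> linearly_unstable I1 I2 p (\<xi>, \<eta>))"
proof -
  define k where "k = norm \<xi>"
  have \<xi>: "\<xi> = k *\<^sub>R vector [sin \<theta>, 0, cos \<theta>]" using xi by (simp add: k_def)
  have k2: "k\<^sup>2 = (2 * R\<^sup>2 + 3 - 9 * I2) / (2 * R ^ 5)" using norm_xi by (simp add: k_def)
  have W: "2 * (R\<^sup>2)\<^sup>2 - 3 * (1 - I2) * R\<^sup>2 - 15 * (1 - 3 * I2) * I2 > 0"
    by (rule second_variation_pos[OF large'])
  have r: "norm Rvec = R" "Rvec \<noteq> 0" "Rvec $ 1 = 0" "Rvec \<bullet> \<xi> = 0"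
    using R by (auto simp: Rvec \<xi> norm_eq_sqrt_inner inner_vec_def sum_3 vec_eq_iff forall_3)
  have \<eta>: "\<eta> = - ((I2 - I1) / I1) * \<xi> $ 1"
    unfolding eta by (subst (2) \<xi>) (simp add: k_def)
  have \<xi>\<xi>: "\<xi> \<bullet> \<xi> = (1 / norm Rvec) ^ 3 - 3 / 2 * (3 * I2 - 1) * (1 / norm Rvec) ^ 5"
  proof -
    have "\<xi> \<bullet> \<xi> = (2 * R\<^sup>2 + 3 - 9 * I2) / (2 * R ^ 5)"
      using norm_xi by (simp add: power2_norm_eq_inner)
    also have "\<dots> = (1 / R) ^ 3 - 3 / 2 * (3 * I2 - 1) * (1 / R) ^ 5"
      using R by (simp add: divide_simps) (simp add: algebra_simps eval_nat_numeral)
    finally show ?thesis by (simp only: r(1))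
  qed
  have p': "p = ((mat 1, Rvec), ((I2 + Rvec \<bullet> Rvec) *\<^sub>R \<xi>, cross3 \<xi> Rvec))"
    unfolding p by (rule point_of_eq[OF inertia(1) r(4) \<eta>])
  have "relative_equilibrium I1 I2 p (\<xi>, \<eta>)"
    unfolding p' by (rule relative_equilibrium_hyperbolic[OF inertia(1,3) r(2,4,3) \<xi>\<xi> \<eta>])
  moreover have "Gmu_stable I1 I2 p" if "I1 > I2"
  proof -
    have "k > 0"
    proof -
      \<comment> \<open>For oblate bodies the trace condition gives \<open>I2 < 1/3\<close>, so the
        angular velocity cannot vanish.\<close>
      have "2 * R\<^sup>2 + 3 - 9 * I2 > 0"
        using that inertia(5) zero_le_power2[of R] by linarith
      then have "k\<^sup>2 > 0" using R unfolding k2 by simp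
      then show ?thesis by (simp add: k_def)
    qed
    then show ?thesis
      unfolding p' by (rule Gmu_stable_hyperbolic[OF that inertia(3) R _ _ Rvec \<xi> k2 W]) simp
  qed
  moreover have "linearly_unstable I1 I2 p (\<xi>, \<eta>)" if "I1 < I2" "\<theta> \<noteq> - pi / 2"
  proof -
    \<comment> \<open>In the given interval the cosine vanishes only at \<open>pi / 2\<close> and
      \<open>- pi / 2\<close>, both excluded at this point.\<close>
    have "cos \<theta> \<noteq> 0"
    proof
      assume "cos \<theta> = 0"
      then obtain i where i: "odd i" "\<theta> = of_int i * (pi / 2)"
        using cos_zero_iff_int by blast
      have "of_int i * (pi / 2) > (- 2) * (pi / 2)" "of_int i * (pi / 2) \<le> 2 * (pi / 2)"
        using theta(1) unfolding i(2) by auto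
      then have "- 2 < i" "i \<le> 2"
        by (simp_all only: mult_less_cancel_right mult_le_cancel_right) (use pi_gt_zero in auto)
      then have "i = -1 \<or> i = 1" using i(1) by presburger
      then show False using i(2) theta(2) that(2) by auto
    qed
    then show ?thesis
      unfolding p' by (intro linearly_unstable_hyperbolic[OF inertia(1,3) that(1) R Rvec \<xi> _ _ k2 W \<eta>]) simp
  qed
  ultimately show ?thesis by blast
qed

end
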